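(* Let $\emptyset\neq C\subseteq\mathbb{D}$ be closed. Then the following are equivalent. 1. $C$ is a sub-triangulation of the circle. 2. Condition (Tri1) holds, all extreme points of $\mathrm{conv}(C)$ are contained in $\mathbb{S}$, and the following holds: for $x,y,z\in\Delta(C)\cup\nabla(C)$ pairwise distinct, there exists a unique $c_{xyz}\in\Delta(C)$ such that $x,y,z$ are subsets of pairwise different connected components of $\mathbb{D}\setminus\partial c_{xyz}$. 3. There exists a sequence $(C_n)_{n\in\mathbb{N}}$ of finite sub-triangulations of the circle with $C_n\to C$ as $n\to\infty$ in the Hausdorff metric topology. Furthermore, $C$ is a triangulation of the circle if and only if $C_n$ in 3. can be chosen as a triangulation of a regular $n$-gon inscribed in $\mathbb{S}$ (for $n\ge3$).
   Context: $\mathbb{D}$ is a closed disc (of circumference $1$) in the plane and $\mathbb{S}=\partial\mathbb{D}$ its bounding circle. For $A\subseteq\mathbb{D}$, $\mathrm{conv}(A)$ is the convex hull, $\Delta(A)$ is the set of connected components of $\mathrm{conv}(A)\setminus A$, and $\nabla(A)$ is the set of connected components of $\mathbb{D}\setminus\mathrm{conv}(A)$. A sub-triangulation of the circle is a closed, non-empty subset $C$ of $\mathbb{D}$ such that: (Tri1) $\Delta(C)$ consists of open interiors of triangles with vertices in $\mathbb{S}$. (Tri2) $C$ is the union of pairwise non-crossing (non-intersecting except at endpoints), possibly degenerate (one-point), closed straight line segments with endpoints in $\mathbb{S}$. A sub-triangulation $C$ is a triangulation of the circle if $\mathbb{S}\subseteq C$. It is finite if $C\cap\mathbb{S}$ is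 a finite set. A triangulation of a regular $n$-gon inscribed in $\mathbb{S}$ is the union of the sides of the $n$-gon and of a set of non-crossing diagonals dividing the $n$-gon into $n-2$ triangles. The Hausdorff metric topology is considered on the set of non-empty closed subsets of $\mathbb{D}$. *)

theory Defs
  imports "HOL-Analysis.Analysis"
begin

text \<open>The plane is \<^typ>\<open>complex\<close>; a circle of circumference 1 has radius \<open>1 / (2 * pi)\<close>.\<close>

definition disc :: "complex set" where
  "disc = cball 0 (1 / (2 * pi))"

definition circ :: "complex set" where
  "circ = sphere 0 (1 / (2 * pi))"

definition Delta :: "complex set \<Rightarrow> complex set set" where
  "Delta A = components (convex hull A - A)"

definition Nabla :: "complex set \<Rightarrow> complex set set" where
  "Nabla A = components (disc - convex hull A)"

definition open_triangles :: "complex set \<Rightarrow> complex set set" where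
  "open_triangles V =
    {interior (convex hull {a, b, c}) | a b c. {a, b, c} \<subseteq> V \<and> \<not> collinear {a, b, c}}"

definition Tri1 :: "complex set \<Rightarrow> bool" where
  "Tri1 C \<longleftrightarrow> Delta C \<subseteq> open_triangles circ"

text \<open>A pair stands for the segment joining its two entries. Pairs that differ only in the
  order of the entries stand for the same segment, so they are not compared with each other.\<close>

definition noncrossing :: "(complex \<times> complex) set \<Rightarrow> bool" where
  "noncrossing L \<longleftrightarrow>
    (\<forall>(a, b) \<in> L. \<forall>(c, d) \<in> L. {a, b} \<noteq> {c, d} \<longrightarrow>
       closed_segment a b \<inter> closed_segment c d \<subseteq> {a, b} \<inter> {c, d})"

definition Tri2 :: "complex set \<Rightarrow> bool" where
  "Tri2 C \<longleftrightarrow>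
    (\<exists>L \<subseteq> circ \<times> circ. noncrossing L \<and> C = (\<Union>(a, b) \<in> L. closed_segment a b))"

definition sub_triangulation :: "complex set \<Rightarrow> bool" where
  "sub_triangulation C \<longleftrightarrow> closed C \<and> C \<noteq> {} \<and> C \<subseteq> disc \<and> Tri1 C \<and> Tri2 C"

definition circle_triangulation :: "complex set \<Rightarrow> bool" where
  "circle_triangulation C \<longleftrightarrow> sub_triangulation C \<and> circ \<subseteq> C"

definition finite_sub_triangulation :: "complex set \<Rightarrow> bool" where
  "finite_sub_triangulation C \<longleftrightarrow> sub_triangulation C \<and> finite (C \<inter> circ)"

text \<open>Vertices of the regular \<open>n\<close>-gon inscribed in the circle with one vertex at angle \<open>t\<close>;
  periodic in \<open>k\<close> with period \<open>n\<close>.\<close>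

definition ngon_vertex :: "real \<Rightarrow> nat \<Rightarrow> nat \<Rightarrow> complex" where
  "ngon_vertex t n k = rcis (1 / (2 * pi)) (t + 2 * pi * real k / real n)"

definition ngon :: "real \<Rightarrow> nat \<Rightarrow> complex set" where
  "ngon t n = convex hull (ngon_vertex t n ` {..<n})"

definition ngon_sides :: "real \<Rightarrow> nat \<Rightarrow> (complex \<times> complex) set" where
  "ngon_sides t n = {(ngon_vertex t n k, ngon_vertex t n (Suc k)) | k. k < n}"

definition ngon_diagonals :: "real \<Rightarrow> nat \<Rightarrow> (complex \<times> complex) set" where
  "ngon_diagonals t n =
    {(ngon_vertex t n i, ngon_vertex t n j) | i j.
       i < n \<and> j < n \<and> i \<noteq> j \<and> j \<noteq> Suc i mod n \<and> i \<noteq> Suc j mod n}"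

definition regular_ngon_triangulation :: "nat \<Rightarrow> complex set \<Rightarrow> bool" where
  "regular_ngon_triangulation n T \<longleftrightarrow>
    (\<exists>t. \<exists>L \<subseteq> ngon_diagonals t n. noncrossing L \<and>
       T = (\<Union>(a, b) \<in> ngon_sides t n \<union> L. closed_segment a b) \<and>
       components (ngon t n - T) \<subseteq> open_triangles UNIV \<and>
       card (components (ngon t n - T)) = n - 2)"

text \<open>Only meaningful for non-empty bounded sets.\<close>

definition hausdorff_dist :: "'a::metric_space set \<Rightarrow> 'a set \<Rightarrow> real" where
  "hausdorff_dist A B = max (SUP a\<in>A. infdist a B) (SUP b\<in>B. infdist b A)"

definition hausdorff_tendsto :: "(nat \<Rightarrow> 'a::metric_space set) \<Rightarrow> 'a set \<Rightarrow> bool" where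
  "hausdorff_tendsto X A \<longleftrightarrow> (\<lambda>n. hausdorff_dist (X n) A) \<longlonglongrightarrow> 0"

end

theory Submission
  imports Defs
begin

text \<open>
  Everything is expressed through the sign of the orientation of three points; two chords of the
  circle cross iff one of them strictly separates the endpoints of the other.

  (1) implies (2): take a closed noncrossing family of chords with union \<open>C\<close> and, among its chords
  separating \<open>x\<close> from \<open>y\<close> and \<open>z\<close>, an extremal one. The triangle behind it separates \<open>x, y, z\<close>. Two
  different triangles lie behind a side of each other, so they cannot both separate \<open>x, y, z\<close>.

  (2) implies (1): call a chord in \<open>C\<close> rigid if no chord in \<open>C\<close> crosses it. Sides of triangles and of the
  hull are rigid. Behind each edge of a gap of the rigid chords that lies in \<open>C\<close> there is a face, as
  otherwise some chord in \<open>C\<close> would cross the edge. A triangle separating three such faces would have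
  to lie in the gap, so the gap has at most two edges and is covered by two fans of chords.

  (3) implies (1): chords through a countable dense set converge along a diagonal subsequence, and so do
  the triangles around a point of the hull outside \<open>C\<close>.

  (1) implies (3): finitely many chords are dense in \<open>C\<close> up to \<open>\<epsilon>\<close>, and all but finitely many triangles
  of \<open>Delta C\<close> are thin. Adding the sides of the others, every maximal noncrossing family on a
  finite set of vertices that contains these chords is close to \<open>C\<close>. For regular polygons the
  endpoints are first rounded down to vertices, which is monotone in the angle and hence creates no
  crossings. A maximal noncrossing family on \<open>n\<close> vertices has \<open>n - 2\<close> triangles, by induction
  removing an ear.
\<close>

section \<open>Orientation and chords\<close>

text \<open>(Tri2) only asserts that some family of chords exists, and that family is far from
  unique: the full disc is swept out by noncrossing chords in many ways, none of them preferred. A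
  proof of (2) implies (1) therefore has to choose, and it can rely only on what \<open>C\<close>
  itself determines, the chords that no chord inside \<open>C\<close> crosses. Choices remain only
  in the gaps between these. A filled inscribed triangle shows the obstacle: it satisfies (Tri1) and
  its extreme points lie on the circle, but no triangle of \<open>Delta C\<close> separates the
  three caps outside it. Condition 2 excludes such gaps with three edges; with at most two edges,
  fans at the starting points of the edges reach everything. For regular polygons, how large
  \<open>n\<close> must be depends on the error, whereas one triangulation has to be named for each
  \<open>n\<close>. The choice is freed from the error by taking a nearly optimal one for every
  \<open>n\<close>.\<close>

definition orient :: "complex \<Rightarrow> complex \<Rightarrow> complex \<Rightarrow> real" where
  "orient a b c = Im (cnj (b - a) * (c - a))"

lemma orient_same [simp]: "orient a a c = 0" "orient a b a = 0" "orient a b b = 0"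
  by (simp_all add: orient_def algebra_simps)

lemma orient_swap: "orient b a c = - orient a b c"
  by (simp add: orient_def algebra_simps)

lemma orient_rotate: "orient b c a = orient a b c"
  by (simp add: orient_def algebra_simps)

text \<open>For fixed \<open>a\<close> and \<open>b\<close>, \<open>orient\<close> is twice the
  signed area of the triangle and so affine in the third point: zero on the line through
  \<open>a\<close> and \<open>b\<close>, positive on its left. All sign arguments rest on
  this.\<close>

lemma orient_convex:
  "orient a b ((1 - t) *\<^sub>R c + t *\<^sub>R d) = (1 - t) * orient a b c + t * orient a b d"
  by (simp add: orient_def algebra_simps)

lemma tendsto_orient [tendsto_intros]:
  assumes "(f \<longlongrightarrow> a) F" "(g \<longlongrightarrow> b) F" "(h \<longlongrightarrow> c) F"
  shows "((\<lambda>x. orient (f x) (g x) (h x)) \<longlongrightarrow> orient a b c) F"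
  unfolding orient_def by (intro tendsto_intros assms)

lemma continuous_on_orient [continuous_intros]:
  assumes "continuous_on S f" "continuous_on S g" "continuous_on S h"
  shows "continuous_on S (\<lambda>x. orient (f x) (g x) (h x))"
  unfolding orient_def by (intro continuous_intros assms)

lemma convex_orient:
  "convex {c. 0 < orient a b c}" "convex {c. 0 \<le> orient a b c}"
  "convex {c. orient a b c < 0}" "convex {c. orient a b c \<le> 0}"
proof -
  \<comment> \<open>The vector \<open>b - a\<close> turned by a right angle, a normal of the line
    pointing to its left.\<close>
  let ?n = "\<i> * (b - a)"
  have eq: "orient a b c = inner ?n c - inner ?n a" for c
    by (simp add: orient_def inner_complex_def algebra_simps)
  show "convex {c. 0 < orient a b c}"
    using convex_halfspace_gt[of "inner ?n a" ?n] by (simp add: eq)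
  show "convex {c. 0 \<le> orient a b c}"
    using convex_halfspace_ge[of "inner ?n a" ?n] by (simp add: eq)
  show "convex {c. orient a b c < 0}"
    using convex_halfspace_lt[of ?n "inner ?n a"] by (simp add: eq)
  show "convex {c. orient a b c \<le> 0}"
    using convex_halfspace_le[of ?n "inner ?n a"] by (simp add: eq)
qed

lemma orient_sign_change:
  assumes "orient a b c * orient a b d < 0"
  obtains q where "q \<in> open_segment c d" "orient a b q = 0"
proof -
  \<comment> \<open>The parameter at which the affine function \<open>orient a b\<close> vanishes
    between \<open>c\<close> and \<open>d\<close>.\<close>
  define s where "s = orient a b c / (orient a b c - orient a b d)"
  have cd: "c \<noteq> d" using assms by (metis not_square_less_zero)
  have ne: "orient a b c - orient a b d \<noteq> 0"
    using assms by (smt (verit) mult_nonneg_nonneg mult_nonpos_nonpos)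
  have s: "0 < s" "s < 1"
    using assms unfolding s_def by (auto simp: divide_simps mult_less_0_iff)
  have "(1 - s) * orient a b c + s * orient a b d = 0"
    using ne by (simp add: s_def field_simps)
  then show thesis
    using that[of "(1 - s) *\<^sub>R c + s *\<^sub>R d"] s cd orient_convex[of a b s c d]
    by (auto simp: in_segment)
qed

lemma orient_segment_nonneg:
  assumes "q \<in> closed_segment c d" "0 \<le> orient a b c" "0 \<le> orient a b d"
  shows "0 \<le> orient a b q"
  using assms closed_segment_subset[OF _ _ convex_orient(2)[of a b], of c d] by auto

lemma orient_segment_nonpos:
  assumes "q \<in> closed_segment c d" "orient a b c \<le> 0" "orient a b d \<le> 0"
  shows "orient a b q \<le> 0"
  using assms closed_segment_subset[OF _ _ convex_orient(4)[of a b], of c d] by auto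

lemma orient_open_segment_pos:
  assumes "q \<in> open_segment c d" "0 \<le> orient a b c" "0 \<le> orient a b d"
    "0 < orient a b c \<or> 0 < orient a b d"
  shows "0 < orient a b q"
proof -
  obtain s where s: "0 < s" "s < 1" "q = (1 - s) *\<^sub>R c + s *\<^sub>R d"
    using assms(1) by (auto simp: in_segment)
  have "0 \<le> (1 - s) * orient a b c" "0 \<le> s * orient a b d"
    using s assms by auto
  moreover have "0 < (1 - s) * orient a b c \<or> 0 < s * orient a b d"
    using s assms by auto
  ultimately show ?thesis unfolding s(3) orient_convex by linarith
qed

lemma orient_on_segment:
  assumes "q \<in> closed_segment a b" shows "orient a b q = 0"
  using orient_segment_nonneg[OF assms, of a b] orient_segment_nonpos[OF assms, of a b] by simp

lemma collinear_orient: "collinear {a, b, c} \<longleftrightarrow> orient a b c = 0"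
proof -
  have "collinear {a,b,c} \<longleftrightarrow> collinear {b,a,c}" by (simp add: insert_commute)
  also have "\<dots> \<longleftrightarrow> collinear {0, b - a, c - a}"
    using collinear_3[of b a c] by simp
  also have "\<dots> \<longleftrightarrow> (\<exists>x. c - a = x *\<^sub>R (b - a)) \<or> b = a"
    by (auto simp: collinear_lemma) 
  also have "\<dots> \<longleftrightarrow> orient a b c = 0"
  proof
    assume "(\<exists>x. c - a = x *\<^sub>R (b - a)) \<or> b = a"
    then show "orient a b c = 0"
    proof
      assume "\<exists>x. c - a = x *\<^sub>R (b - a)"
      then obtain x where "c - a = x *\<^sub>R (b - a)" by blast
      then show ?thesis by (simp only: orient_def) (simp add: algebra_simps)
    qed simp
  next
    assume 0: "orient a b c = 0"
    show "(\<exists>x. c - a = x *\<^sub>R (b - a)) \<or> b = a"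
    proof (cases "b = a")
      case False
      \<comment> \<open>This imaginary part is \<open>orient a b c\<close> divided by the squared
        norm of \<open>b - a\<close>, so the quotient is real.\<close>
      have "Im ((c - a) / (b - a)) = 0"
        using 0 by (simp add: orient_def Im_divide algebra_simps)
      then have "(c - a) / (b - a) = of_real (Re ((c - a) / (b - a)))"
        by (simp add: complex_eq_iff)
      then have "c - a = Re ((c - a) / (b - a)) *\<^sub>R (b - a)"
        using False by (metis eq_iff_diff_eq_0 nonzero_divide_eq_eq scaleR_conv_of_real)
      then show ?thesis by blast
    qed simp
  qed
  finally show ?thesis .
qed

section \<open>Chords of the disc and when two of them cross\<close>

lemma circ_subset_disc: "circ \<subseteq> disc"
  by (auto simp: circ_def disc_def)

lemma compact_disc: "compact disc" and convex_disc: "convex disc" and compact_circ: "compact circ"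
  by (simp_all add: disc_def circ_def)

lemma chord_subset_disc: "a \<in> circ \<Longrightarrow> b \<in> circ \<Longrightarrow> closed_segment a b \<subseteq> disc"
  using circ_subset_disc convex_disc by (metis closed_segment_subset subsetD)

text \<open>Strict convexity with its exact defect. The sign of \<open>s * (1 - s)\<close> tells the
  points inside a chord from those on its extension.\<close>

lemma norm_convex_combination:
  fixes a b :: complex
  shows "(norm ((1 - s) *\<^sub>R a + s *\<^sub>R b))\<^sup>2
       = (1 - s) * (norm a)\<^sup>2 + s * (norm b)\<^sup>2 - s * (1 - s) * (norm (b - a))\<^sup>2"
  unfolding cmod_power2 by (simp add: power2_eq_square algebra_simps)

text \<open>On the extension of the chord \<open>s * (1 - s)\<close> is negative, which pushes the
  norm above the radius. This is the standard way below to turn a zero of \<open>orient\<close> into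
  a point of a chord.\<close>

lemma line_meets_disc:
  assumes "a \<in> circ" "b \<in> circ" "a \<noteq> b" "orient a b p = 0" "p \<in> disc"
  shows "p \<in> closed_segment a b"
proof -
  have "collinear {a, b, p}" using assms by (simp add: collinear_orient)

  have "collinear {a, p, b}" using \<open>collinear {a, b, p}\<close> by (simp add: insert_commute)
  then obtain u where u: "p = u *\<^sub>R a + (1 - u) *\<^sub>R b"
    using assms(3) unfolding collinear_3_expand by blast
  define s where "s = 1 - u"
  have p: "p = (1 - s) *\<^sub>R a + s *\<^sub>R b" using u by (simp add: s_def)
  have "(norm p)\<^sup>2 \<le> (1/(2*pi))\<^sup>2"
    using assms(5) by (simp add: disc_def power_mono)
  moreover have "(norm a)\<^sup>2 = (1/(2*pi))\<^sup>2" "(norm b)\<^sup>2 = (1/(2*pi))\<^sup>2"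
    using assms(1,2) by (simp_all add: circ_def)
  ultimately have "0 \<le> s * (1 - s) * (norm (b - a))\<^sup>2"
    unfolding p norm_convex_combination by (simp add: algebra_simps)
  then have "0 \<le> s * (1 - s)"
    using assms(3) by (simp add: zero_le_mult_iff)
  then have "0 \<le> s" "s \<le> 1" by (auto simp: zero_le_mult_iff)
  then show ?thesis using p by (auto simp: in_segment)
qed

lemma open_segment_disc:
  assumes "a \<in> disc" "b \<in> disc" "q \<in> open_segment a b"
  shows "norm q < 1 / (2 * pi)"
proof -
  obtain s where s: "0 < s" "s < 1" "q = (1 - s) *\<^sub>R a + s *\<^sub>R b" and ab: "a \<noteq> b"
    using assms(3) by (auto simp: in_segment)
  have n: "(norm a)\<^sup>2 \<le> (1/(2*pi))\<^sup>2" "(norm b)\<^sup>2 \<le> (1/(2*pi))\<^sup>2"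
    using assms by (simp_all add: disc_def power_mono)
  have "(norm q)\<^sup>2 < (1/(2*pi))\<^sup>2"
  proof -
    have "(1 - s) * (norm a)\<^sup>2 \<le> (1 - s) * (1/(2*pi))\<^sup>2" "s * (norm b)\<^sup>2 \<le> s * (1/(2*pi))\<^sup>2"
      using s n by (auto intro!: mult_left_mono)
    moreover have "0 < s * (1 - s) * (norm (b - a))\<^sup>2" using s ab by simp
    ultimately show ?thesis unfolding s(3) norm_convex_combination by (simp add: algebra_simps)
  qed
  then show ?thesis by (simp add: power_less_imp_less_base)
qed

lemma circ_Int_chord:
  assumes "a \<in> disc" "b \<in> disc" "q \<in> closed_segment a b" "q \<in> circ"
  shows "q = a \<or> q = b"
  using assms open_segment_disc[of a b q] by (force simp: open_segment_def circ_def)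

lemma orient_circ_eq_0:
  assumes "a \<in> circ" "b \<in> circ" "c \<in> circ"
  shows "orient a b c = 0 \<longleftrightarrow> a = b \<or> b = c \<or> a = c"
  using assms line_meets_disc[of a b c] circ_Int_chord[of a b c] circ_subset_disc by auto

text \<open>Strict separation yields a point inside \<open>c d\<close> on the line through
  \<open>a\<close> and \<open>b\<close>. It lies in the disc but off the circle, hence strictly
  inside \<open>a b\<close>; so \<open>a\<close> and \<open>b\<close> cannot be on the same side of
  \<open>c d\<close>.\<close>

lemma cross_sym:
  assumes "a \<in> circ" "b \<in> circ" "c \<in> circ" "d \<in> circ" "orient a b c * orient a b d < 0"
  shows "orient c d a * orient c d b < 0"
proof -
  obtain q where q: "q \<in> open_segment c d" "orient a b q = 0"
    using orient_sign_change[OF assms(5)] by blast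
  have ab: "a \<noteq> b" using assms(5) by auto
  have qd: "q \<in> disc" using q chord_subset_disc assms open_closed_segment by blast
  have "q \<in> closed_segment a b" using line_meets_disc[OF assms(1,2) ab q(2) qd] .
  moreover have "q \<notin> circ" using open_segment_disc[OF _ _ q(1)] assms circ_subset_disc
    by (force simp: circ_def)
  ultimately have qab: "q \<in> open_segment a b" using assms by (auto simp: open_segment_def)
  have "orient c d q = 0" using q(1) orient_on_segment open_closed_segment by blast
  moreover have "orient c d a \<noteq> 0 \<and> orient c d b \<noteq> 0"
    using orient_circ_eq_0[of c d a] orient_circ_eq_0[of c d b] assms by auto
  ultimately show ?thesis
    using orient_open_segment_pos[OF qab, of c d] orient_open_segment_pos[OF qab, of d c]
    by (smt (verit) mult_less_0_iff orient_swap)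
qed

text \<open>For chords of the circle this is \<^const>\<open>noncrossing\<close> in sign form; being a closed condition, it
  survives closures and limits.\<close>

definition ncr :: "(complex \<times> complex) set \<Rightarrow> bool" where
  "ncr L \<longleftrightarrow> (\<forall>(a, b) \<in> L. \<forall>(c, d) \<in> L. 0 \<le> orient a b c * orient a b d)"

lemma ncrD: "ncr L \<Longrightarrow> (a, b) \<in> L \<Longrightarrow> (c, d) \<in> L \<Longrightarrow> 0 \<le> orient a b c * orient a b d"
  by (auto simp: ncr_def)

text \<open>A common point off the circle is interior to both chords. As \<open>c\<close> and
  \<open>d\<close> are weakly on one side of \<open>a b\<close>, both must then lie on that line,
  and the chords coincide.\<close>

lemma ncr_inter:
  assumes "a \<in> circ" "b \<in> circ" "c \<in> circ" "d \<in> circ" "0 \<le> orient a b c * orient a b d"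
    "{a, b} \<noteq> {c, d}" "q \<in> closed_segment a b" "q \<in> closed_segment c d"
  shows "q \<in> {a, b} \<inter> {c, d}"
proof -
  have o: "orient a b q = 0" using assms orient_on_segment by blast
  have q: "q \<in> circ"
  proof (rule ccontr)
    assume nq: "q \<notin> circ"
    then have qo: "q \<in> open_segment a b" "q \<in> open_segment c d"
      using assms by (auto simp: open_segment_def)
    have "orient a b c = 0 \<and> orient a b d = 0"
      using orient_open_segment_pos[OF qo(2), of a b] orient_open_segment_pos[OF qo(2), of b a] o assms(5)
      by (smt (verit) orient_swap mult_pos_neg mult_neg_pos)
    then show False
      using orient_circ_eq_0[of a b c] orient_circ_eq_0[of a b d] assms(1-4,6) qo
      by (auto simp: open_segment_def)
  qed
  then show ?thesis
    using circ_Int_chord[of a b q] circ_Int_chord[of c d q] assms circ_subset_disc by auto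
qed

lemma noncrossing_iff:
  assumes "L \<subseteq> circ \<times> circ"
  shows "noncrossing L \<longleftrightarrow> ncr L"
proof
  assume L: "noncrossing L"
  show "ncr L" unfolding ncr_def
  proof clarify
    fix a b c d assume ab: "(a, b) \<in> L" and cd: "(c, d) \<in> L"
    have circ: "a \<in> circ" "b \<in> circ" "c \<in> circ" "d \<in> circ" using ab cd assms by auto
    show "0 \<le> orient a b c * orient a b d"
    proof (rule ccontr)
      assume "\<not> ?thesis"
      then have n: "orient a b c * orient a b d < 0" by simp
      then obtain q where q: "q \<in> open_segment c d" "orient a b q = 0"
        using orient_sign_change by blast
      have "a \<noteq> b" using n by auto
      then have "q \<in> closed_segment a b"
        using line_meets_disc[of a b q] q circ chord_subset_disc open_closed_segment by blast
      moreover have "{a, b} \<noteq> {c, d}" using n by (auto simp: doubleton_eq_iff)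
      ultimately have "q \<in> {c, d}"
        using L ab cd q open_closed_segment unfolding noncrossing_def by blast
      then show False using q by (auto simp: open_segment_def)
    qed
  qed
next
  assume L: "ncr L"
  show "noncrossing L" unfolding noncrossing_def
  proof clarify
    fix a b c d q
    assume "(a, b) \<in> L" "(c, d) \<in> L" "{a, b} \<noteq> {c, d}" "q \<in> closed_segment a b" "q \<in> closed_segment c d"
    then show "q \<in> {a, b} \<inter> {c, d}"
      using ncr_inter[of a b c d q] ncrD[OF L] assms by (metis SigmaD1 SigmaD2 subsetD)
  qed
qed

section \<open>Triangles inscribed in the circle\<close>

definition ang :: "complex \<Rightarrow> real" where
  "ang z = Arg2pi z"

lemma circ_ang:
  assumes "z \<in> circ" shows "z = rcis (1 / (2 * pi)) (ang z)" "0 \<le> ang z" "ang z < 2 * pi"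
  using assms Arg2pi_eq[of z] Arg2pi_ge_0[of z] Arg2pi_lt_2pi[of z]
  by (auto simp: ang_def circ_def rcis_def cis_conv_exp)

lemma ang_eq_iff: "a \<in> circ \<Longrightarrow> b \<in> circ \<Longrightarrow> ang a = ang b \<longleftrightarrow> a = b"
  by (metis circ_ang(1))

text \<open>Twice the classical area 2 R^2 sin A sin B sin C of an inscribed triangle: half an arc
  is an inscribed angle, up to sign and supplement.\<close>

lemma orient_rcis:
  "orient (rcis r \<alpha>) (rcis r \<beta>) (rcis r \<gamma>)
   = 4 * r\<^sup>2 * sin ((\<beta> - \<alpha>) / 2) * sin ((\<gamma> - \<beta>) / 2) * sin ((\<gamma> - \<alpha>) / 2)"
proof -
  define x y where "x = (\<beta> - \<alpha>) / 2" and "y = (\<gamma> - \<beta>) / 2"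
  have eqs: "\<beta> - \<alpha> = 2 * x" "\<gamma> - \<beta> = 2 * y" "(\<gamma> - \<alpha>) / 2 = x + y" "\<gamma> - \<alpha> = 2 * (x + y)"
    by (simp_all add: x_def y_def field_simps)
  have "orient (rcis r \<alpha>) (rcis r \<beta>) (rcis r \<gamma>) = r\<^sup>2 * (sin (\<gamma> - \<beta>) + sin (\<beta> - \<alpha>) - sin (\<gamma> - \<alpha>))"
    by (simp add: orient_def rcis_def sin_diff power2_eq_square algebra_simps)
  also have "sin (\<gamma> - \<beta>) + sin (\<beta> - \<alpha>) - sin (\<gamma> - \<alpha>) = 4 * sin x * sin y * sin (x + y)"
  proof -
    have "sin (2 * x) + sin (2 * y) = 2 * sin (x + y) * cos (x - y)"
    proof -
      have "2 * x = (x + y) + (x - y)" "2 * y = (x + y) - (x - y)" by simp_all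
      then show ?thesis by (simp only: sin_add sin_diff)
    qed
    moreover have "sin (2 * (x + y)) = 2 * sin (x + y) * cos (x + y)" by (rule sin_double)
    ultimately have "sin (2 * y) + sin (2 * x) - sin (2 * (x + y))
        = 2 * sin (x + y) * (cos (x - y) - cos (x + y))" by (simp add: algebra_simps)
    also have "cos (x - y) - cos (x + y) = 2 * sin x * sin y"
      by (simp add: cos_add cos_diff)
    finally show ?thesis unfolding eqs by simp
  qed
  finally show ?thesis unfolding x_def[symmetric] y_def[symmetric] eqs(3) by simp
qed

lemma sgn_sin_half:
  fixes d :: real assumes "- (2 * pi) < d" "d < 2 * pi"
  shows "sgn (sin (d / 2)) = sgn d"
proof -
  consider "d = 0" | "d > 0" | "d < 0" by linarith
  then show ?thesis
  proof cases
    case 2 then have "sin (d / 2) > 0" using assms by (intro sin_gt_zero) auto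
    with 2 show ?thesis by simp
  next
    case 3 then have "sin (- d / 2) > 0" using assms by (intro sin_gt_zero) auto
    with 3 show ?thesis by simp
  qed simp
qed

lemma sgn_orient:
  assumes "a \<in> circ" "b \<in> circ" "c \<in> circ"
  shows "sgn (orient a b c) = sgn (ang b - ang a) * sgn (ang c - ang b) * sgn (ang c - ang a)"
proof -
  have "sgn (orient a b c) = sgn (orient (rcis (1/(2*pi)) (ang a)) (rcis (1/(2*pi)) (ang b)) (rcis (1/(2*pi)) (ang c)))"
    using circ_ang(1) assms by metis
  also have "\<dots> = sgn (sin ((ang b - ang a)/2)) * sgn (sin ((ang c - ang b)/2)) * sgn (sin ((ang c - ang a)/2))"
    by (simp add: orient_rcis sgn_mult)
  also have "\<dots> = sgn (ang b - ang a) * sgn (ang c - ang b) * sgn (ang c - ang a)"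
    using circ_ang(2,3)[OF assms(1)] circ_ang(2,3)[OF assms(2)] circ_ang(2,3)[OF assms(3)]
    by (simp add: sgn_sin_half)
  finally show ?thesis .
qed

text \<open>Positive orientation is cyclic order of the angles. Facts about several points of the
  circle thereby become statements about the linear order of reals.\<close>

lemma orient_pos_iff:
  assumes "a \<in> circ" "b \<in> circ" "c \<in> circ"
  shows "0 < orient a b c \<longleftrightarrow> ang a < ang b \<and> ang b < ang c \<or> ang b < ang c \<and> ang c < ang a
      \<or> ang c < ang a \<and> ang a < ang b"
proof -
  have "0 < orient a b c \<longleftrightarrow> sgn (orient a b c) = 1" by (auto simp: sgn_if)
  then show ?thesis unfolding sgn_orient[OF assms] by (auto simp: sgn_if)
qed

lemma orient_neg_iff:
  assumes "a \<in> circ" "b \<in> circ" "c \<in> circ"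
  shows "orient a b c < 0 \<longleftrightarrow> ang b < ang a \<and> ang a < ang c \<or> ang a < ang c \<and> ang c < ang b
      \<or> ang c < ang b \<and> ang b < ang a"
  using orient_pos_iff[OF assms(2,1,3)] orient_swap[of a b c] by simp

text \<open>By connectedness a change of sign produces a zero of \<open>orient a b\<close>, and in
  the disc such a zero lies on the chord.\<close>

lemma one_side:
  assumes "connected S" "S \<subseteq> disc" "a \<in> circ" "b \<in> circ" "a \<noteq> b" "S \<inter> closed_segment a b = {}"
  shows "(\<forall>q\<in>S. 0 < orient a b q) \<or> (\<forall>q\<in>S. orient a b q < 0)"
proof (rule ccontr)
  assume "\<not> ?thesis"
  then obtain p q where pq: "p \<in> S" "q \<in> S" "orient a b p \<le> 0" "0 \<le> orient a b q"
    by (meson not_le)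
  have "connected (orient a b ` S)"
    by (intro connected_continuous_image assms continuous_intros)
  moreover have "orient a b p \<in> orient a b ` S" "orient a b q \<in> orient a b ` S"
    using pq by auto
  ultimately have "0 \<in> orient a b ` S"
    using pq(3,4) unfolding connected_iff_interval by blast
  then obtain z where "z \<in> S" "orient a b z = 0" by force
  then show False using line_meets_disc[of a b z] assms by blast
qed

text \<open>The open triangle of a counterclockwise triple. For any other triple it is empty,
  because the three values add up to \<open>orient a b c\<close>.\<close>

definition tri :: "complex \<Rightarrow> complex \<Rightarrow> complex \<Rightarrow> complex set" where
  "tri a b c = {p. 0 < orient a b p \<and> 0 < orient b c p \<and> 0 < orient c a p}"

lemma tri_rotate: "tri b c a = tri a b c" by (auto simp: tri_def)

text \<open>Cramer's rule: barycentric coordinates are ratios of signed areas.\<close>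

lemma barycentric:
  assumes "orient a b c \<noteq> 0"
  shows "p = (orient b c p / orient a b c) *\<^sub>R a + (orient c a p / orient a b c) *\<^sub>R b
           + (orient a b p / orient a b c) *\<^sub>R c"
    "orient b c p / orient a b c + orient c a p / orient a b c + orient a b p / orient a b c = 1"
proof -
  have s: "orient b c p + orient c a p + orient a b p = orient a b c"
    by (simp add: orient_def algebra_simps)
  then show "orient b c p / orient a b c + orient c a p / orient a b c + orient a b p / orient a b c = 1"
    using assms by (simp add: add_divide_distrib[symmetric])
  have e: "orient a b c *\<^sub>R p = orient b c p *\<^sub>R a + orient c a p *\<^sub>R b + orient a b p *\<^sub>R c"
    by (simp add: orient_def complex_eq_iff algebra_simps)
  have "p = (1 / orient a b c) *\<^sub>R (orient a b c *\<^sub>R p)" using assms by simp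
  also have "\<dots> = (orient b c p / orient a b c) *\<^sub>R a + (orient c a p / orient a b c) *\<^sub>R b
           + (orient a b p / orient a b c) *\<^sub>R c"
    unfolding e by (simp add: scaleR_add_right)
  finally show "p = (orient b c p / orient a b c) *\<^sub>R a + (orient c a p / orient a b c) *\<^sub>R b
           + (orient a b p / orient a b c) *\<^sub>R c" .
qed

lemma hull3_eq:
  assumes "0 < orient a b c"
  shows "convex hull {a, b, c} = {p. 0 \<le> orient a b p \<and> 0 \<le> orient b c p \<and> 0 \<le> orient c a p}"
    (is "_ = ?R")
proof
  have "convex ({p. 0 \<le> orient a b p} \<inter> {p. 0 \<le> orient b c p} \<inter> {p. 0 \<le> orient c a p})"
    by (intro convex_Int convex_orient)
  moreover have "?R = {p. 0 \<le> orient a b p} \<inter> {p. 0 \<le> orient b c p} \<inter> {p. 0 \<le> orient c a p}" by auto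
  moreover have "{a, b, c} \<subseteq> ?R"
    using assms orient_rotate[of a b c] orient_rotate[of b c a] by simp
  ultimately show "convex hull {a, b, c} \<subseteq> ?R" by (metis hull_minimal)
next
  show "?R \<subseteq> convex hull {a, b, c}"
  proof
    fix p assume p: "p \<in> ?R"
    show "p \<in> convex hull {a, b, c}"
      unfolding convex_hull_3 mem_Collect_eq
      by (rule exI[of _ "orient b c p / orient a b c"], rule exI[of _ "orient c a p / orient a b c"],
          rule exI[of _ "orient a b p / orient a b c"])
        (use p assms barycentric[of a b c p] in auto)
  qed
qed

lemma open_tri: "open (tri a b c)"
  unfolding tri_def by (intro open_Collect_conj open_Collect_less continuous_intros)

lemma convex_tri: "convex (tri a b c)"
proof -
  have "tri a b c = {p. 0 < orient a b p} \<inter> {p. 0 < orient b c p} \<inter> {p. 0 < orient c a p}"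
    by (auto simp: tri_def)
  then show ?thesis by (simp add: convex_Int convex_orient)
qed

lemma orient_interior_pos:
  assumes "p \<in> interior S" "S \<subseteq> {q. 0 \<le> orient a b q}" "a \<noteq> b"
  shows "0 < orient a b p"
proof (rule ccontr)
  assume "\<not> ?thesis"
  then have p0: "orient a b p = 0" using assms interior_subset by fastforce
  obtain e where e: "e > 0" "ball p e \<subseteq> S" using assms(1) mem_interior by blast
  \<comment> \<open>The point at distance \<open>e / 2\<close> from \<open>p\<close>, straight to
    the right of the line; it is still in \<open>S\<close>.\<close>
  define q where "q = p + of_real (e / (2 * norm (b - a))) * (- \<i> * (b - a))"
  have "dist p q = e / 2"
    using e(1) assms(3) unfolding q_def dist_norm by (simp add: norm_mult norm_divide)
  then have "q \<in> S" using e by auto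
  have "orient a b (p + of_real s * (- \<i> * (b - a))) = orient a b p - s * (norm (b - a))\<^sup>2" for s
    unfolding orient_def cmod_power2 by (simp add: power2_eq_square algebra_simps)
  then have "orient a b q = orient a b p - e / (2 * norm (b - a)) * (norm (b - a))\<^sup>2"
    unfolding q_def .
  also have "\<dots> < 0" using p0 e(1) assms(3) by (simp add: power2_eq_square)
  finally show False using \<open>q \<in> S\<close> assms(2) by force
qed

lemma interior_hull3:
  assumes "0 < orient a b c"
  shows "interior (convex hull {a, b, c}) = tri a b c"
proof
  have ne: "a \<noteq> b" "b \<noteq> c" "c \<noteq> a" using assms by auto
  show "interior (convex hull {a, b, c}) \<subseteq> tri a b c"
    unfolding tri_def hull3_eq[OF assms]
    using ne by (auto elim!: orient_interior_pos)
  show "tri a b c \<subseteq> interior (convex hull {a, b, c})"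
    by (rule interior_maximal[OF _ open_tri]) (auto simp: tri_def hull3_eq[OF assms])
qed

lemma tri_nonempty:
  assumes "0 < orient a b c" shows "tri a b c \<noteq> {}"
proof -
  have "orient x y ((a + b + c) / 3) = (orient x y a + orient x y b + orient x y c) / 3" for x y
    by (simp add: orient_def field_simps)
  from this[of a b] this[of b c] this[of c a] have "(a + b + c) / 3 \<in> tri a b c"
    using assms orient_rotate[of a b c] orient_rotate[of b c a] unfolding tri_def by simp
  then show ?thesis by blast
qed

lemma closure_tri:
  assumes "0 < orient a b c" shows "closure (tri a b c) = convex hull {a, b, c}"
proof -
  have "closure (interior (convex hull {a, b, c})) = closure (convex hull {a, b, c})"
    by (rule convex_closure_interior) (use tri_nonempty interior_hull3 assms in auto)
  also have "\<dots> = convex hull {a, b, c}"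
    by (simp add: closure_closed compact_imp_closed finite_imp_compact_convex_hull)
  finally show ?thesis by (simp add: interior_hull3[OF assms])
qed

lemma hull3_on_side:
  assumes "0 < orient a b c" "p \<in> convex hull {a, b, c}" "orient a b p = 0"
  shows "p \<in> closed_segment a b"
proof -
  define s where "s = orient c a p / orient a b c"
  have n: "0 \<le> orient b c p" "0 \<le> orient c a p"
    using assms(2) unfolding hull3_eq[OF assms(1)] by auto
  have e: "orient b c p / orient a b c = 1 - s"
    using barycentric(2)[of a b c p] assms(1,3) by (simp add: s_def)
  have "p = (1 - s) *\<^sub>R a + s *\<^sub>R b"
    using barycentric(1)[of a b c p] assms(1,3) unfolding e s_def by simp
  moreover have "0 \<le> 1 - s" unfolding e[symmetric] using n assms(1) by simp
  moreover have "0 \<le> s" unfolding s_def using n assms(1) by simp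
  ultimately show ?thesis unfolding in_segment by auto
qed

lemma frontier_tri:
  assumes "0 < orient a b c"
  shows "frontier (tri a b c) = closed_segment a b \<union> closed_segment b c \<union> closed_segment c a"
proof -
  have o: "0 < orient b c a" "0 < orient c a b" using assms orient_rotate by metis+
  have fr: "frontier (tri a b c) = convex hull {a, b, c} - tri a b c"
    by (simp add: frontier_def closure_tri[OF assms] interior_open open_tri)
  have h: "convex hull {b, c, a} = convex hull {a, b, c}" "convex hull {c, a, b} = convex hull {a, b, c}"
    by (simp_all add: insert_commute)
  show ?thesis
  proof
    show "frontier (tri a b c) \<subseteq> closed_segment a b \<union> closed_segment b c \<union> closed_segment c a"
    proof
      fix p assume "p \<in> frontier (tri a b c)"
      then have p: "p \<in> convex hull {a, b, c}" "p \<notin> tri a b c" unfolding fr by auto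
      then have "orient a b p = 0 \<or> orient b c p = 0 \<or> orient c a p = 0"
        unfolding hull3_eq[OF assms] tri_def by auto
      then show "p \<in> closed_segment a b \<union> closed_segment b c \<union> closed_segment c a"
        using hull3_on_side[OF assms] hull3_on_side[OF o(1)] hull3_on_side[OF o(2)] p h by auto
    qed
    have "closed_segment x y \<subseteq> convex hull {a, b, c}" if "x \<in> {a,b,c}" "y \<in> {a,b,c}" for x y
      using that by (metis closed_segment_subset convex_convex_hull hull_inc)
    moreover have "closed_segment x y \<inter> tri a b c = {}" if "(x,y) \<in> {(a,b),(b,c),(c,a)}" for x y
      using that orient_on_segment by (fastforce simp: tri_def)
    ultimately show "closed_segment a b \<union> closed_segment b c \<union> closed_segment c a \<subseteq> frontier (tri a b c)"
      unfolding fr by blast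
  qed
qed

lemma tri_subset_disc:
  assumes "a \<in> circ" "b \<in> circ" "c \<in> circ" "0 < orient a b c"
  shows "tri a b c \<subseteq> ball 0 (1 / (2 * pi))" "convex hull {a, b, c} \<subseteq> disc" "tri a b c \<subseteq> disc"
proof -
  show h: "convex hull {a, b, c} \<subseteq> disc"
    using assms circ_subset_disc by (intro hull_minimal convex_disc) auto
  then have "tri a b c \<subseteq> interior disc"
    using interior_hull3[OF assms(4)] interior_mono by metis
  then show "tri a b c \<subseteq> ball 0 (1 / (2 * pi))" by (simp add: disc_def)
  then show "tri a b c \<subseteq> disc" by (auto simp: disc_def)
qed

text \<open>Any point of the circle other than the vertices lies on the arc cut off by one of the
  sides, and is therefore strictly to the right of that side.\<close>

lemma circ_Int_hull3:
  assumes "a \<in> circ" "b \<in> circ" "c \<in> circ" "d \<in> circ" "0 < orient a b c"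
    "0 \<le> orient a b d" "0 \<le> orient b c d" "0 \<le> orient c a d"
  shows "d = a \<or> d = b \<or> d = c"
proof (rule ccontr)
  assume n: "\<not> ?thesis"
  have "a \<noteq> b" "b \<noteq> c" "c \<noteq> a" using assms by auto
  with n have "0 < orient a b d" "0 < orient b c d" "0 < orient c a d"
    using orient_circ_eq_0[of _ _ d] assms by (metis order_less_le)+
  then show False using assms(1-5) by (auto simp: orient_pos_iff)
qed

text \<open>If the chord met the triangle, noncrossing would put both of its ends weakly to the left
  of every side. The ends are then vertices, and the chord is a side or a point, disjoint from the
  open triangle.\<close>

lemma tri_Int_chord:
  assumes "a \<in> circ" "b \<in> circ" "c \<in> circ" "d \<in> circ" "e \<in> circ" "0 < orient a b c"
    "0 \<le> orient a b d * orient a b e" "0 \<le> orient b c d * orient b c e"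
    "0 \<le> orient c a d * orient c a e"
  shows "closed_segment d e \<inter> tri a b c = {}"
proof (rule ccontr)
  assume "\<not> ?thesis"
  then obtain q where q: "q \<in> closed_segment d e" "q \<in> tri a b c" by auto
  have key: "0 \<le> orient x y d \<and> 0 \<le> orient x y e"
    if "0 < orient x y q" "0 \<le> orient x y d * orient x y e" for x y
    using that orient_segment_nonpos[OF q(1), of x y] by (auto simp: zero_le_mult_iff)
  have nn: "0 \<le> orient a b d \<and> 0 \<le> orient a b e" "0 \<le> orient b c d \<and> 0 \<le> orient b c e"
    "0 \<le> orient c a d \<and> 0 \<le> orient c a e"
    using key q(2) assms(7-9) by (auto simp: tri_def)
  have "d = a \<or> d = b \<or> d = c" "e = a \<or> e = b \<or> e = c"
    using circ_Int_hull3[of a b c] assms nn by auto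
  then consider "q \<in> closed_segment a b" | "q \<in> closed_segment b c" | "q \<in> closed_segment c a"
    using q(1) by (auto simp: closed_segment_commute)
  then show False using q(2) by cases (use orient_on_segment in \<open>fastforce simp: tri_def\<close>)+
qed

lemma open_triangles_iff:
  "t \<in> open_triangles V \<longleftrightarrow> (\<exists>a\<in>V. \<exists>b\<in>V. \<exists>c\<in>V. 0 < orient a b c \<and> t = tri a b c)"
proof
  assume "t \<in> open_triangles V"
  then obtain a b c where abc: "{a, b, c} \<subseteq> V" "orient a b c \<noteq> 0" "t = interior (convex hull {a, b, c})"
    by (auto simp: open_triangles_def collinear_orient)
  show "\<exists>a\<in>V. \<exists>b\<in>V. \<exists>c\<in>V. 0 < orient a b c \<and> t = tri a b c"
  proof (cases "0 < orient a b c")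
    case True then show ?thesis using abc interior_hull3 by blast
  next
    case False
    then have "0 < orient b a c" using abc(2) orient_swap[of a b c] by simp
    moreover have "t = tri b a c"
      using interior_hull3[OF calculation] abc(3) by (simp add: insert_commute)
    ultimately show ?thesis using abc(1) by blast
  qed
next
  assume "\<exists>a\<in>V. \<exists>b\<in>V. \<exists>c\<in>V. 0 < orient a b c \<and> t = tri a b c"
  then obtain a b c where "{a, b, c} \<subseteq> V" "0 < orient a b c" "t = interior (convex hull {a, b, c})"
    using interior_hull3 by fastforce
  then show "t \<in> open_triangles V"
    unfolding open_triangles_def collinear_orient mem_Collect_eq
    by (intro exI[of _ a] exI[of _ b] exI[of _ c]) auto
qed

lemma open_in_components:
  fixes t U :: "complex set"
  assumes "open t" "connected t" "t \<noteq> {}" "t \<subseteq> U" "frontier t \<inter> U = {}"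
  shows "t \<in> components U"
  unfolding in_components_maximal
proof (intro conjI allI impI)
  fix d assume d: "d \<noteq> {} \<and> t \<subseteq> d \<and> d \<subseteq> U \<and> connected d"
  show "d = t"
  proof (rule ccontr)
    assume "d \<noteq> t"
    then have "d \<inter> frontier t \<noteq> {}"
      using d assms(3) by (intro connected_Int_frontier) auto
    then show False using d assms(5) by blast
  qed
qed (use assms in auto)

lemma tri_in_components:
  assumes "0 < orient a b c" "tri a b c \<subseteq> U"
    "closed_segment a b \<inter> U = {}" "closed_segment b c \<inter> U = {}" "closed_segment c a \<inter> U = {}"
  shows "tri a b c \<in> components U"
  by (rule open_in_components)
    (use assms tri_nonempty in \<open>auto simp: open_tri convex_tri convex_connected frontier_tri\<close>)

text \<open>For a side of a counterclockwise triangle, the cap of the disc behind that side.\<close>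

definition beyond :: "complex \<Rightarrow> complex \<Rightarrow> complex set" where
  "beyond a b = {q \<in> disc. orient a b q < 0}"

lemma convex_beyond: "convex (beyond a b)"
proof -
  have "beyond a b = disc \<inter> {q. orient a b q < 0}" by (auto simp: beyond_def)
  then show ?thesis by (simp add: convex_Int convex_disc convex_orient)
qed

lemma beyond_in_components:
  assumes "a \<in> circ" "b \<in> circ" "a \<noteq> b" "beyond a b \<noteq> {}" "beyond a b \<subseteq> U" "U \<subseteq> disc"
    "closed_segment a b \<inter> U = {}"
  shows "beyond a b \<in> components U"
  unfolding in_components_maximal
proof (intro conjI allI impI)
  fix d assume d: "d \<noteq> {} \<and> beyond a b \<subseteq> d \<and> d \<subseteq> U \<and> connected d"
  then have "(\<forall>q\<in>d. 0 < orient a b q) \<or> (\<forall>q\<in>d. orient a b q < 0)"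
    using assms by (intro one_side) auto
  moreover obtain q where "q \<in> beyond a b" using assms(4) by auto
  then have "q \<in> d" "orient a b q < 0" using d by (auto simp: beyond_def)
  ultimately have "\<forall>q\<in>d. orient a b q < 0" by (meson not_less_iff_gr_or_eq)
  then have "d \<subseteq> beyond a b" using d assms(6) unfolding beyond_def by blast
  then show "d = beyond a b" using d by blast
qed (use assms convex_connected[OF convex_beyond[of a b]] in auto)

lemma beyond_in_components_tri:
  assumes "a \<in> circ" "b \<in> circ" "c \<in> circ" "0 < orient a b c" "beyond a b \<noteq> {}"
  shows "beyond a b \<in> components (disc - frontier (tri a b c))"
proof (rule beyond_in_components)
  have "closed_segment x y \<inter> beyond a b = {}" if "x \<in> {a,b,c}" "y \<in> {a,b,c}" for x y
  proof -
    have "0 \<le> orient a b x" "0 \<le> orient a b y" using that assms(4) by auto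
    then show ?thesis using orient_segment_nonneg[of _ x y a b] by (force simp: beyond_def)
  qed
  then show "beyond a b \<subseteq> disc - frontier (tri a b c)"
    using frontier_tri[OF assms(4)] by (auto simp: beyond_def disjoint_iff)
qed (use assms frontier_tri[OF assms(4)] in auto)

lemma tri_in_components_disc:
  assumes "a \<in> circ" "b \<in> circ" "c \<in> circ" "0 < orient a b c"
  shows "tri a b c \<in> components (disc - frontier (tri a b c))"
  using assms tri_subset_disc[OF assms] tri_nonempty frontier_disjoint_eq[of "tri a b c"] 
  by (intro open_in_components) (auto simp: open_tri convex_tri convex_connected)

section \<open>Maximal noncrossing families\<close>

definition chords :: "(complex \<times> complex) set \<Rightarrow> complex set" where
  "chords L = (\<Union>(a, b) \<in> L. closed_segment a b)"

text \<open>Maximality in the form of a closure property: a chord that crosses nothing in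
  \<open>G\<close> is in \<open>G\<close>. This automatically includes one-point chords and both
  orders of each pair.\<close>

definition maxnc :: "complex set \<Rightarrow> (complex \<times> complex) set \<Rightarrow> bool" where
  "maxnc V G \<longleftrightarrow> G \<subseteq> V \<times> V \<and> ncr G \<and>
     (\<forall>a\<in>V. \<forall>b\<in>V. (\<forall>(c, d) \<in> G. 0 \<le> orient a b c * orient a b d) \<longrightarrow> (a, b) \<in> G)"

lemma nc_sym:
  assumes "a \<in> circ" "b \<in> circ" "c \<in> circ" "d \<in> circ"
  shows "0 \<le> orient a b c * orient a b d \<longleftrightarrow> 0 \<le> orient c d a * orient c d b"
  using cross_sym[of a b c d] cross_sym[of c d a b] assms by (meson not_le)

lemma maxnc_extend:
  assumes "finite V" "V \<subseteq> circ" "F \<subseteq> V \<times> V" "ncr F"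
  obtains G where "F \<subseteq> G" "maxnc V G"
proof -
  define S where "S = {G. F \<subseteq> G \<and> G \<subseteq> V \<times> V \<and> ncr G}"
  have "finite S" unfolding S_def
    by (rule finite_subset[of _ "Pow (V \<times> V)"]) (use assms(1) in auto)
  moreover have "F \<in> S" using assms by (auto simp: S_def)
  ultimately obtain G where GS: "G \<in> S" "\<forall>H\<in>S. G \<subseteq> H \<longrightarrow> G = H"
    using finite_has_maximal2[of S F] by blast
  have G: "F \<subseteq> G \<and> G \<subseteq> V \<times> V \<and> ncr G" using GS(1) by (simp add: S_def)
  have "maxnc V G" unfolding maxnc_def
  proof (intro conjI ballI impI)
    fix a b assume ab: "a \<in> V" "b \<in> V" "\<forall>(c, d)\<in>G. 0 \<le> orient a b c * orient a b d"
    have "ncr (insert (a, b) G)" unfolding ncr_def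
    proof clarify
      fix c d c' d' assume *: "(c, d) \<in> insert (a, b) G" "(c', d') \<in> insert (a, b) G"
      then have "c \<in> circ" "d \<in> circ" "c' \<in> circ" "d' \<in> circ" using G ab(1,2) assms(2) by auto
      then show "0 \<le> orient c d c' * orient c d d'"
        using * ab(3) G nc_sym[of a b c d] by (auto simp: ncr_def)
    qed
    then have "insert (a, b) G \<in> S" using G ab(1,2) by (auto simp: S_def)
    then have "G = insert (a, b) G" using GS(2) by blast
    then show "(a, b) \<in> G" by blast
  qed (use G in auto)
  then show thesis using that G by blast
qed

lemma maxnc_sym:
  assumes "maxnc V G" "(a, b) \<in> G" shows "(b, a) \<in> G"
proof -
  have "0 \<le> orient b a c * orient b a d" if "(c, d) \<in> G" for c d
    using ncrD[of G a b c d] that assms by (simp add: maxnc_def orient_swap[of b a])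
  then show ?thesis using assms unfolding maxnc_def by blast
qed

lemma maxnc_refl: "maxnc V G \<Longrightarrow> a \<in> V \<Longrightarrow> (a, a) \<in> G"
  unfolding maxnc_def by (metis (no_types, lifting) case_prodI2 mult_zero_left order_refl orient_same(1))

text \<open>An edge of the hull is crossed by nothing, as both factors are nonpositive.\<close>

lemma maxnc_empty_side:
  assumes "maxnc V G" "V \<subseteq> circ" "a \<in> V" "b \<in> V" "\<And>c. c \<in> V \<Longrightarrow> orient a b c \<le> 0"
  shows "(a, b) \<in> G"
proof -
  have "0 \<le> orient a b c * orient a b d" if "(c, d) \<in> G" for c d
    using that assms by (intro mult_nonpos_nonpos) (auto simp: maxnc_def)
  then show ?thesis using assms(1,3,4) unfolding maxnc_def by blast
qed

text \<open>Counterclockwise order as seen from \<open>a\<close> is transitive.\<close>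

lemma orient_trans:
  assumes "a \<in> circ" "b \<in> circ" "c \<in> circ" "d \<in> circ" "0 < orient a b c" "0 < orient a c d"
  shows "0 < orient a b d"
  using assms by (auto simp: orient_pos_iff)

text \<open>The angle of \<open>x\<close> measured from \<open>a\<close>, except that \<open>a\<close> itself comes last.\<close>

definition key :: "complex \<Rightarrow> complex \<Rightarrow> real" where
  "key a x = (if ang a < ang x then ang x else ang x + 2 * pi)"

lemma orient_key:
  assumes "a \<in> circ" "x \<in> circ" "y \<in> circ" "x \<noteq> a" "y \<noteq> a"
  shows "0 < orient a x y \<longleftrightarrow> key a x < key a y"
  using assms circ_ang(2,3)[of x] circ_ang(2,3)[of y] ang_eq_iff[of x a] ang_eq_iff[of y a]
  unfolding orient_pos_iff[OF assms(1-3)] key_def by (auto split: if_splits)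

text \<open>\<open>c\<close> is the first neighbour of \<open>a\<close> met after \<open>b\<close>.
  A chord crossing \<open>b c\<close> starts strictly between \<open>b\<close> and \<open>c\<close>:
  if it ends in \<open>a\<close>, this contradicts the choice of \<open>c\<close>; otherwise it
  crosses \<open>a b\<close> or \<open>a c\<close>. Hence maximality supplies
  \<open>b c\<close>.\<close>

lemma maxnc_third_vertex:
  assumes G: "maxnc V G" "finite V" "V \<subseteq> circ" and ab: "(a, b) \<in> G" "\<exists>v\<in>V. 0 < orient a b v"
  obtains c where "c \<in> V" "0 < orient a b c" "(a, c) \<in> G" "(b, c) \<in> G"
proof -
  have GV: "G \<subseteq> V \<times> V" and nG: "ncr G" using G(1) by (auto simp: maxnc_def)
  have abV: "a \<in> V" "b \<in> V" "a \<in> circ" "b \<in> circ" using GV G(3) ab(1) by auto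
  define W where "W = {v\<in>V. 0 < orient a b v}"
  have W: "finite W" "W \<noteq> {}" using G ab(2) by (auto simp: W_def)
  \<comment> \<open>The last vertex before returning to \<open>a\<close>. The chord
    \<open>a l\<close> is an edge of the hull and so in \<open>G\<close>; this guarantees that
    \<open>a\<close> has a neighbour in \<open>W\<close>.\<close>
  obtain l where l: "l \<in> W" "\<And>d. d \<in> W \<Longrightarrow> key a d \<le> key a l"
  proof -
    have "Max (key a ` W) \<in> key a ` W" using W by (intro Max_in) auto
    then obtain l where "l \<in> W" "key a l = Max (key a ` W)" by force
    then show thesis using that[of l] W by simp
  qed
  have lc: "l \<in> V" "l \<in> circ" "l \<noteq> a" "0 < orient a b l" using l(1) G(3) by (auto simp: W_def)
  have "(a, l) \<in> G"
  proof (rule maxnc_empty_side[OF G(1,3)])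
    fix v assume v: "v \<in> V"
    show "orient a l v \<le> 0"
    proof (rule ccontr)
      assume "\<not> ?thesis"
      then have o: "0 < orient a l v" by simp
      have "v \<in> circ" "v \<noteq> a" using v G(3) o by auto
      then have "v \<in> W" using orient_trans[of a b l v] lc o abV v by (auto simp: W_def)
      then show False using l(2)[of v] o orient_key[of a l v] lc abV \<open>v \<in> circ\<close> \<open>v \<noteq> a\<close> by simp
    qed
  qed (use abV lc in auto)
  define N where "N = {v\<in>W. (a, v) \<in> G}"
  have N: "finite N" "N \<noteq> {}" using W(1) l(1) \<open>(a, l) \<in> G\<close> by (auto simp: N_def)
  obtain c where c: "c \<in> N" "\<And>d. d \<in> N \<Longrightarrow> key a c \<le> key a d"
  proof -
    have "Min (key a ` N) \<in> key a ` N" using N by (intro Min_in) auto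
    then obtain c where "c \<in> N" "key a c = Min (key a ` N)" by force
    then show thesis using that[of c] N by simp
  qed
  have cc: "c \<in> V" "c \<in> circ" "c \<noteq> a" "0 < orient a b c" "(a, c) \<in> G"
    using c(1) G(3) by (auto simp: N_def W_def)
  have no: False if de: "(d, e) \<in> G" and neg: "orient b c d < 0" and pos: "0 < orient b c e" for d e
  proof -
    have dec: "d \<in> V" "d \<in> circ" "e \<in> circ" using GV G(3) de by auto
    have d: "0 < orient a b d" "0 < orient a d c"
      using neg cc(4) abV cc dec by (auto simp: orient_pos_iff orient_neg_iff)
    show False
    proof (cases "e = a")
      case True
      then have "d \<in> N" using maxnc_sym[OF G(1) de] d dec by (auto simp: N_def W_def)
      moreover have "d \<noteq> a" using d by auto
      ultimately show False using c(2)[of d] d orient_key[of a d c] abV cc dec by auto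
    next
      case False
      have "0 \<le> orient a b d * orient a b e" using ncrD[OF nG ab(1) de] .
      then have "0 \<le> orient a b e" using d(1) by (simp add: zero_le_mult_iff)
      moreover have "e \<noteq> b" using pos by auto
      ultimately have "0 < orient a b e"
        using orient_circ_eq_0[of a b e] abV dec False cc(4) by (metis less_eq_real_def orient_same(1) order_less_irrefl)
      then have "0 < orient a c e" using pos cc abV dec
        by (auto simp: orient_pos_iff)
      moreover have "orient a c d < 0" using d(2) cc abV dec by (auto simp: orient_pos_iff orient_neg_iff)
      ultimately show False using ncrD[OF nG cc(5) de] by (auto simp: zero_le_mult_iff)
    qed
  qed
  have "(b, c) \<in> G"
  proof -
    have "0 \<le> orient b c d * orient b c e" if "(d, e) \<in> G" for d e
      using no[OF that] no[OF maxnc_sym[OF G(1) that]] by (meson mult_less_0_iff not_le)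
    then show ?thesis using G(1) abV cc unfolding maxnc_def by blast
  qed
  then show thesis using that cc by blast
qed

lemma chords_mono: "L \<subseteq> M \<Longrightarrow> chords L \<subseteq> chords M" by (auto simp: chords_def)

lemma maxnc_subset_hull:
  assumes "maxnc V G" shows "V \<subseteq> chords G" "chords G \<subseteq> convex hull V"
proof -
  show "V \<subseteq> chords G" using maxnc_refl[OF assms] by (force simp: chords_def)
  have "closed_segment a b \<subseteq> convex hull V" if "(a, b) \<in> G" for a b
    using that assms by (intro closed_segment_subset hull_inc) (auto simp: maxnc_def)
  then show "chords G \<subseteq> convex hull V" by (auto simp: chords_def)
qed

lemma hull_chords:
  assumes "maxnc V G" shows "convex hull (chords G) = convex hull V"
  using maxnc_subset_hull[OF assms] by (metis convex_convex_hull hull_minimal hull_mono subset_antisym)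

text \<open>Among the chords with \<open>p\<close> strictly on their left, take one with the fewest vertices on its left;
  the third vertex of the triangle on that side cuts off even fewer.\<close>

lemma maxnc_triangle_containing:
  assumes G: "maxnc V G" "finite V" "V \<subseteq> circ" and p: "p \<in> convex hull V" "p \<notin> chords G"
  obtains a b c where "(a, b) \<in> G" "(b, c) \<in> G" "(c, a) \<in> G" "0 < orient a b c" "p \<in> tri a b c"
proof -
  have GV: "G \<subseteq> V \<times> V" and nG: "ncr G" using G(1) by (auto simp: maxnc_def)
  have pd: "p \<in> disc"
    using p(1) hull_minimal[of V disc convex] G(3) circ_subset_disc convex_disc by blast
  have off: "orient a b p \<noteq> 0" if "(a, b) \<in> G" "a \<noteq> b" for a b
    using line_meets_disc[of a b p] pd p(2) that GV G(3) by (auto simp: chords_def)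
  have left: "\<exists>v\<in>V. 0 < orient a b v" if "0 < orient a b p" for a b
  proof (rule ccontr)
    assume "\<not> ?thesis"
    then have "convex hull V \<subseteq> {q. orient a b q \<le> 0}"
      by (intro hull_minimal convex_orient) force
    then show False using that p(1) by force
  qed
  let ?P = "\<lambda>e. e \<in> G \<and> 0 < orient (fst e) (snd e) p"
  have ex: "\<exists>e. ?P e"
  proof -
    \<comment> \<open>If \<open>G\<close> had only one-point chords, nothing could cross a chord
      between two vertices, and maximality would put it into \<open>G\<close>.\<close>
    have "\<exists>a b. (a, b) \<in> G \<and> a \<noteq> b"
    proof (rule ccontr)
      assume n: "\<nexists>a b. (a, b) \<in> G \<and> a \<noteq> b"
      obtain a where a: "a \<in> V" using p(1) by fastforce
      have "V \<noteq> {a}" using p maxnc_subset_hull[OF G(1)] by auto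
      then obtain b where "b \<in> V" "a \<noteq> b" using a by blast
      moreover have "0 \<le> orient a b c * orient a b d" if "(c, d) \<in> G" for c d
        using n that by (cases "c = d") auto
      then have "(a, b) \<in> G" using G(1) a \<open>b \<in> V\<close> unfolding maxnc_def by blast
      ultimately show False using n by blast
    qed
    then obtain a b where "(a, b) \<in> G" "a \<noteq> b" by blast
    then have "?P (a, b) \<or> ?P (b, a)"
      using off[of a b] maxnc_sym[OF G(1)] orient_swap[of a b p] by auto
    then show ?thesis by blast
  qed
  define m where "m e = card {v\<in>V. 0 < orient (fst e) (snd e) v}" for e
  obtain a b where ab: "(a, b) \<in> G" "0 < orient a b p" and min: "\<And>e. ?P e \<Longrightarrow> m (a, b) \<le> m e"
  proof -
    obtain e where e: "?P e" "\<And>e'. ?P e' \<Longrightarrow> m e \<le> m e'"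
      using ex_has_least_nat[of ?P _ m] ex by blast
    then show thesis using that[of "fst e" "snd e"] by simp
  qed
  obtain c where c: "c \<in> V" "0 < orient a b c" "(a, c) \<in> G" "(b, c) \<in> G"
    using maxnc_third_vertex[OF G ab(1) left[OF ab(2)]] by blast
  have circ: "a \<in> circ" "b \<in> circ" "c \<in> circ" using GV G(3) ab(1) c(1) by auto
  \<comment> \<open>Contradiction with minimality: such a chord has \<open>p\<close> on its left and
    loses at least the vertex \<open>c\<close>.\<close>
  have smaller: False if xy: "(x, y) \<in> G" "0 < orient x y p" and
    sub: "\<And>v. v \<in> V \<Longrightarrow> 0 < orient x y v \<Longrightarrow> 0 < orient a b v" and "\<not> 0 < orient x y c" for x y
  proof -
    have "m (x, y) < m (a, b)" unfolding m_def
      by (rule psubset_card_mono) (use that c G(2) in auto)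
    then show False using min[of "(x, y)"] xy by simp
  qed
  have "0 < orient b c p"
  proof (rule ccontr)
    assume n: "\<not> ?thesis"
    have "b \<noteq> c" using c(2) by auto
    then have "0 < orient c b p" using n off[OF c(4)] orient_swap[of b c p] by linarith
    then show False
      using smaller[OF maxnc_sym[OF G(1) c(4)]] c(2) circ G(3) orient_trans[of b _ c a]
      by (metis orient_rotate orient_same(3) less_irrefl subsetD)
  qed
  moreover have "0 < orient c a p"
  proof (rule ccontr)
    assume n: "\<not> ?thesis"
    have "c \<noteq> a" using c(2) by auto
    then have "0 < orient a c p"
      using n off[OF maxnc_sym[OF G(1) c(3)]] orient_swap[of c a p] by linarith
    then show False
      using smaller[OF c(3)] c(2) circ G(3) orient_trans[of a b c]
      by (metis orient_same(3) less_irrefl subsetD)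
  qed
  ultimately show thesis
    using that[of a b c] ab c maxnc_sym[OF G(1)] by (auto simp: tri_def)
qed

lemma ncr_triangle_disjoint:
  assumes "ncr L" "L \<subseteq> circ \<times> circ" "(a, b) \<in> L" "(b, c) \<in> L" "(c, a) \<in> L" "0 < orient a b c"
  shows "tri a b c \<inter> chords L = {}"
proof -
  have "closed_segment d e \<inter> tri a b c = {}" if "(d, e) \<in> L" for d e
    using assms(2-5) that by (intro tri_Int_chord assms(6) ncrD[OF assms(1)]) auto
  then show ?thesis by (auto simp: chords_def)
qed

lemma tri_subset_hull:
  assumes "0 < orient a b c" shows "tri a b c \<subseteq> convex hull {a, b, c}"
  unfolding interior_hull3[OF assms, symmetric] by (rule interior_subset)

lemma components_maxnc:
  assumes G: "maxnc V G" "finite V" "V \<subseteq> circ"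
  shows "components (convex hull V - chords G)
       = {tri a b c | a b c. (a, b) \<in> G \<and> (b, c) \<in> G \<and> (c, a) \<in> G \<and> 0 < orient a b c}"
    (is "components ?U = ?R")
proof -
  have GV: "G \<subseteq> V \<times> V" and nG: "ncr G" using G(1) by (auto simp: maxnc_def)
  have comp: "tri a b c \<in> components ?U"
    if t: "(a, b) \<in> G" "(b, c) \<in> G" "(c, a) \<in> G" "0 < orient a b c" for a b c
  proof (rule tri_in_components[OF t(4)])
    have "tri a b c \<inter> chords G = {}"
      by (rule ncr_triangle_disjoint[OF nG _ t]) (use GV G(3) in blast)
    moreover have "convex hull {a, b, c} \<subseteq> convex hull V"
      using t GV by (intro hull_mono) auto
    ultimately show "tri a b c \<subseteq> ?U" using tri_subset_hull[OF t(4)] by blast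
  qed (use t in \<open>auto simp: chords_def\<close>)
  show ?thesis
  proof
    show "?R \<subseteq> components ?U" using comp by auto
    show "components ?U \<subseteq> ?R"
    proof
      fix x assume x: "x \<in> components ?U"
      obtain p where p: "p \<in> x" using in_components_nonempty[OF x] by auto
      then have "p \<in> ?U" using in_components_subset[OF x] by auto
      then obtain a b c where abc: "(a, b) \<in> G" "(b, c) \<in> G" "(c, a) \<in> G" "0 < orient a b c" "p \<in> tri a b c"
        using maxnc_triangle_containing[OF G, of p] by blast
      then have "x = tri a b c"
        using components_eq[OF x comp[OF abc(1-4)]] p by blast
      then show "x \<in> ?R" using abc by blast
    qed
  qed
qed

lemma maxnc_finite_sub_triangulation:
  assumes G: "maxnc V G" "finite V" "V \<subseteq> circ" "V \<noteq> {}"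
  shows "finite_sub_triangulation (chords G)"
proof -
  have GV: "G \<subseteq> V \<times> V" and nG: "ncr G" using G(1) by (auto simp: maxnc_def)
  have fin: "finite G" using GV G(2) finite_subset by blast
  have "closed (chords G)" unfolding chords_def using fin by (intro closed_UN) auto
  moreover have ne: "chords G \<noteq> {}" using maxnc_subset_hull[OF G(1)] G(4) by blast
  moreover have "closed_segment a b \<subseteq> disc" if "(a, b) \<in> G" for a b
    using chord_subset_disc that GV G(3) by blast
  then have sub: "chords G \<subseteq> disc" by (auto simp: chords_def)
  moreover have Gc: "G \<subseteq> circ \<times> circ" using GV G(3) by blast
  have "Tri1 (chords G)"
    unfolding Tri1_def Delta_def hull_chords[OF G(1)] components_maxnc[OF G(1-3)]
  proof clarify
    fix a b c assume "(a, b) \<in> G" "(b, c) \<in> G" "(c, a) \<in> G" "0 < orient a b c"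
    then show "tri a b c \<in> open_triangles circ"
      using Gc unfolding open_triangles_iff by (metis SigmaD1 subsetD)
  qed
  moreover have "Tri2 (chords G)" unfolding Tri2_def
    using Gc nG noncrossing_iff[OF Gc] unfolding chords_def by blast
  moreover have "chords G \<inter> circ \<subseteq> V"
  proof
    fix q assume "q \<in> chords G \<inter> circ"
    then obtain a b where "(a, b) \<in> G" "q \<in> closed_segment a b" "q \<in> circ" by (auto simp: chords_def)
    moreover have "a \<in> V" "b \<in> V" using \<open>(a, b) \<in> G\<close> GV by auto
    ultimately show "q \<in> V" using circ_Int_chord[of a b q] G(3) circ_subset_disc by blast
  qed
  then have "finite (chords G \<inter> circ)" using G(2) finite_subset by blast
  ultimately show ?thesis by (simp add: finite_sub_triangulation_def sub_triangulation_def)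
qed

section \<open>Regular polygons\<close>

text \<open>Triangles recorded as vertex sets, so that the three cyclic orders of a triple count
  once.\<close>

definition cliques :: "(complex \<times> complex) set \<Rightarrow> complex set set" where
  "cliques G = {{a, b, c} | a b c. (a, b) \<in> G \<and> (b, c) \<in> G \<and> (c, a) \<in> G \<and> 0 < orient a b c}"

lemma cliquesE:
  assumes "S \<in> cliques G" "x \<in> S"
  obtains y z where "S = {x, y, z}" "(x, y) \<in> G" "(y, z) \<in> G" "(z, x) \<in> G" "0 < orient x y z"
proof -
  obtain a b c where abc: "S = {a, b, c}" "(a, b) \<in> G" "(b, c) \<in> G" "(c, a) \<in> G" "0 < orient a b c"
    using assms(1) by (auto simp: cliques_def)
  have "x = a \<or> x = b \<or> x = c" using assms(2) abc(1) by auto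
  then show thesis
  proof (elim disjE)
    assume "x = a" then show thesis using that[of b c] abc by auto
  next
    assume "x = b" then show thesis using that[of c a] abc orient_rotate[of b c a] by auto
  next
    assume "x = c" then show thesis using that[of a b] abc orient_rotate[of c a b] orient_rotate[of b c a] by auto
  qed
qed

text \<open>Take a chord with some, but as few as possible, vertices on its left. Nothing is left
  behind the other two sides of the triangle on it, so its third vertex \<open>c\<close> is the tip
  of an ear.\<close>

lemma maxnc_ear:
  assumes G: "maxnc V G" "finite V" "V \<subseteq> circ" "3 \<le> card V"
  obtains a b c where "(a, b) \<in> G" "(b, c) \<in> G" "(c, a) \<in> G" "0 < orient a b c"
    "\<And>v. v \<in> V \<Longrightarrow> 0 \<le> orient b c v" "\<And>v. v \<in> V \<Longrightarrow> 0 \<le> orient c a v"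
proof -
  have GV: "G \<subseteq> V \<times> V" using G(1) by (auto simp: maxnc_def)
  let ?P = "\<lambda>e. e \<in> G \<and> (\<exists>v\<in>V. 0 < orient (fst e) (snd e) v)"
  have ex: "\<exists>e. ?P e"
  proof (rule ccontr)
    assume n: "\<not> ?thesis"
    have no: "a = b" if ab: "(a, b) \<in> G" for a b
    proof (rule ccontr)
      assume ne: "a \<noteq> b"
      have "card {a, b} < card V" using G(4) card_insert_le_m1[of 2 "{b}" a] by simp
      then obtain v where v: "v \<in> V" "v \<noteq> a" "v \<noteq> b"
        by (metis card_mono finite.emptyI finite.insertI insertCI not_le subsetI)
      have circ: "a \<in> circ" "b \<in> circ" "v \<in> circ" using ab GV G(3) v(1) by auto
      then have "orient a b v \<noteq> 0" using orient_circ_eq_0[of a b v] v ne by auto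
      then consider "0 < orient a b v" | "0 < orient b a v"
        using orient_swap[of a b v] by linarith
      then show False
      proof cases
        case 1 then have "?P (a, b)" using ab v by auto
        then show False using n by blast
      next
        case 2 then have "?P (b, a)" using maxnc_sym[OF G(1) ab] v by auto
        then show False using n by blast
      qed
    qed
    have "card V \<noteq> 0" using G(4) by simp
    then obtain a where a: "a \<in> V" by fastforce
    have "V \<noteq> {a}" using G(4) by auto
    then obtain b where b: "b \<in> V" "b \<noteq> a" using a by auto
    have "0 \<le> orient a b c * orient a b d" if "(c, d) \<in> G" for c d
      using no[OF that] by simp
    then have "(a, b) \<in> G" using G(1) a b unfolding maxnc_def by blast
    then show False using no b by blast
  qed
  define m where "m e = card {v\<in>V. 0 < orient (fst e) (snd e) v}" for e
  obtain a b where ab: "(a, b) \<in> G" "\<exists>v\<in>V. 0 < orient a b v"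
    and min: "\<And>e. ?P e \<Longrightarrow> m (a, b) \<le> m e"
  proof -
    obtain e where e: "?P e" "\<And>e'. ?P e' \<Longrightarrow> m e \<le> m e'"
      using ex_has_least_nat[of ?P _ m] ex by blast
    then show thesis using that[of "fst e" "snd e"] by simp
  qed
  obtain c where c: "c \<in> V" "0 < orient a b c" "(a, c) \<in> G" "(b, c) \<in> G"
    using maxnc_third_vertex[OF G(1-3) ab] by blast
  have circ: "a \<in> circ" "b \<in> circ" "c \<in> circ" using GV G(3) ab(1) c(1) by auto
  have empty: "\<not> 0 < orient x y w" if xy: "(x, y) \<in> G" and w: "w \<in> V" and
    sub: "\<And>v. v \<in> V \<Longrightarrow> 0 < orient x y v \<Longrightarrow> 0 < orient a b v" and xyc: "\<not> 0 < orient x y c" for x y w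
  proof
    assume "0 < orient x y w"
    moreover have "m (x, y) < m (a, b)" unfolding m_def
      by (rule psubset_card_mono) (use sub xyc c G(2) in auto)
    ultimately show False using min[of "(x, y)"] xy w by auto
  qed
  have cb: "0 < orient a b v" if "v \<in> V" "0 < orient c b v" for v
    using orient_trans[of b v c a] circ G(3) that c(2)
    by (metis orient_rotate subsetD)
  have ac: "0 < orient a b v" if "v \<in> V" "0 < orient a c v" for v
    using orient_trans[of a b c v] circ G(3) that c(2) by blast
  have "0 \<le> orient b c v" if "v \<in> V" for v
    using empty[OF maxnc_sym[OF G(1) c(4)] that cb] orient_swap[of c b v] by simp
  moreover have "0 \<le> orient c a v" if "v \<in> V" for v
    using empty[OF c(3) that ac] orient_swap[of a c v] by simp
  ultimately show thesis
    using that[of a b c] ab c maxnc_sym[OF G(1)] by blast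
qed

text \<open>Induction on the number of vertices: deleting the tip of an ear destroys exactly one
  triangle, and the remaining family is maximal on the remaining vertices.\<close>

lemma card_cliques:
  assumes "maxnc V G" "finite V" "V \<subseteq> circ" "2 \<le> card V"
  shows "card (cliques G) = card V - 2 \<and> finite (cliques G)"
  using assms
proof (induction "card V - 2" arbitrary: V G)
  case 0
  have "cliques G = {}"
  proof (rule ccontr)
    assume "cliques G \<noteq> {}"
    then obtain a b c where abc: "(a, b) \<in> G" "(b, c) \<in> G" "0 < orient a b c" by (auto simp: cliques_def)
    then have "a \<noteq> b" "b \<noteq> c" "a \<noteq> c" by auto
    then have "card {a, b, c} = 3" by simp
    moreover have "{a, b, c} \<subseteq> V" using abc 0 by (auto simp: maxnc_def)
    ultimately show False using card_mono[of V "{a,b,c}"] 0 by simp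
  qed
  then show ?case using 0 by simp
next
  case (Suc n)
  note G = \<open>maxnc V G\<close> \<open>finite V\<close> \<open>V \<subseteq> circ\<close>
  have GV: "G \<subseteq> V \<times> V" and nG: "ncr G" using G(1) by (auto simp: maxnc_def)
  have "3 \<le> card V" using Suc.hyps(2) by simp
  then obtain a b c where abc: "(a, b) \<in> G" "(b, c) \<in> G" "(c, a) \<in> G" "0 < orient a b c"
    "\<And>v. v \<in> V \<Longrightarrow> 0 \<le> orient b c v" "\<And>v. v \<in> V \<Longrightarrow> 0 \<le> orient c a v"
    using maxnc_ear[OF G] by blast
  have V3: "a \<in> V" "b \<in> V" "c \<in> V" "a \<in> circ" "b \<in> circ" "c \<in> circ" using abc GV G(3) by auto
  have ne: "a \<noteq> b" "b \<noteq> c" "c \<noteq> a" using abc(4) by auto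
  have nb: "d = a \<or> d = b \<or> d = c" if "(c, d) \<in> G" for d
  proof -
    have "0 \<le> orient a b d" using ncrD[OF nG abc(1) that] abc(4) by (auto simp: zero_le_mult_iff)
    then show ?thesis
      using circ_Int_hull3[of a b c d] V3 abc(4-6) that GV G(3) by blast
  qed
  define V' G' where "V' = V - {c}" and "G' = G \<inter> (V' \<times> V')"
  have "maxnc V' G'" unfolding maxnc_def
  proof (intro conjI ballI impI)
    show "G' \<subseteq> V' \<times> V'" by (simp add: G'_def)
    show "ncr G'" using nG by (auto simp: ncr_def G'_def)
    fix d e assume de: "d \<in> V'" "e \<in> V'" and nc: "\<forall>(x, y)\<in>G'. 0 \<le> orient d e x * orient d e y"
    have deV: "d \<in> V" "e \<in> V" "d \<in> circ" "e \<in> circ" using de G(3) by (auto simp: V'_def)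
    \<comment> \<open>The chords of \<open>G\<close> at \<open>c\<close> go to \<open>a\<close>,
      \<open>b\<close> or \<open>c\<close> itself and have all vertices on one side, so no chord
      crosses them. A chord admissible among the remaining vertices is therefore admissible among
      all.\<close>
    have side: "0 \<le> orient d e c * orient d e x" if "x = a \<or> x = b \<or> x = c" for x
    proof -
      have "0 \<le> orient c x d * orient c x e"
        using that abc(5,6)[of d] abc(5,6)[of e] deV orient_swap[of b c]
        by (auto simp: mult_nonpos_nonpos)
      then show ?thesis using nc_sym[of d e c x] V3 deV that by auto
    qed
    have "0 \<le> orient d e x * orient d e y" if xy: "(x, y) \<in> G" for x y
    proof -
      consider "(x, y) \<in> G'" | "x = c" | "y = c" using xy GV by (auto simp: G'_def V'_def)
      then show ?thesis
      proof cases
        case 1 then show ?thesis using nc by auto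
      next
        case 2 then show ?thesis using side[of y] nb xy by blast
      next
        case 3 then show ?thesis using side[of x] nb maxnc_sym[OF G(1) xy] by (metis mult.commute)
      qed
    qed
    then have "(d, e) \<in> G" using G(1) deV unfolding maxnc_def by blast
    then show "(d, e) \<in> G'" using de by (simp add: G'_def)
  qed
  moreover have cV': "card V' = card V - 1" using V3 G(2) by (simp add: V'_def)
  moreover have "n = card V' - 2" "2 \<le> card V'" "finite V'" "V' \<subseteq> circ"
    using cV' Suc.hyps(2) G by (auto simp: V'_def)
  ultimately have IH: "card (cliques G') = card V' - 2 \<and> finite (cliques G')"
    using Suc.hyps(1) by blast
  have "cliques G = insert {a, b, c} (cliques G')"
  proof
    show "insert {a, b, c} (cliques G') \<subseteq> cliques G"
      using abc by (auto simp: cliques_def G'_def)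
    show "cliques G \<subseteq> insert {a, b, c} (cliques G')"
    proof
      fix S assume S: "S \<in> cliques G"
      show "S \<in> insert {a, b, c} (cliques G')"
      proof (cases "c \<in> S")
        case True
        obtain y z where yz: "S = {c, y, z}" "(c, y) \<in> G" "(z, c) \<in> G" "0 < orient c y z"
          using cliquesE[OF S True] by metis
        have "y = a \<or> y = b \<or> y = c" "z = a \<or> z = b \<or> z = c"
          using nb yz(2) maxnc_sym[OF G(1) yz(3)] by blast+
        moreover have "y \<noteq> c" "z \<noteq> c" "y \<noteq> z" using yz(4) by auto
        ultimately show ?thesis using yz(1) by auto
      next
        case False
        obtain x y z where xyz: "S = {x, y, z}" "(x, y) \<in> G" "(y, z) \<in> G" "(z, x) \<in> G" "0 < orient x y z"
          using S by (auto simp: cliques_def)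
        have "x \<in> V'" "y \<in> V'" "z \<in> V'" using False xyz GV by (auto simp: V'_def)
        then have "S \<in> cliques G'" using xyz unfolding cliques_def G'_def by blast
        then show ?thesis by blast
      qed
    qed
  qed
  moreover have "{a, b, c} \<notin> cliques G'"
  proof
    assume "{a, b, c} \<in> cliques G'"
    then show False using cliquesE[of "{a, b, c}" G' c] by (auto simp: G'_def V'_def)
  qed
  ultimately show ?case using IH cV' Suc.hyps(2) by simp
qed

lemma card_components_maxnc:
  assumes G: "maxnc V G" "finite V" "V \<subseteq> circ" "2 \<le> card V"
  shows "card (components (convex hull V - chords G)) = card V - 2"
proof -
  have Gc: "G \<subseteq> circ \<times> circ" using G by (auto simp: maxnc_def)
  have "components (convex hull V - chords G) = (\<lambda>S. interior (convex hull S)) ` cliques G"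
    unfolding components_maxnc[OF G(1-3)] cliques_def
  proof (intro subset_antisym subsetI)
    fix t assume "t \<in> {tri a b c | a b c. (a, b) \<in> G \<and> (b, c) \<in> G \<and> (c, a) \<in> G \<and> 0 < orient a b c}"
    then obtain a b c where abc: "t = tri a b c" "(a, b) \<in> G" "(b, c) \<in> G" "(c, a) \<in> G" "0 < orient a b c"
      by auto
    then have "t = interior (convex hull {a, b, c})" by (simp add: interior_hull3)
    then show "t \<in> (\<lambda>S. interior (convex hull S)) ` {{a, b, c} | a b c. (a, b) \<in> G \<and> (b, c) \<in> G \<and> (c, a) \<in> G \<and> 0 < orient a b c}"
      using abc by blast
  next
    fix t assume "t \<in> (\<lambda>S. interior (convex hull S)) ` {{a, b, c} | a b c. (a, b) \<in> G \<and> (b, c) \<in> G \<and> (c, a) \<in> G \<and> 0 < orient a b c}"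
    then obtain a b c where abc: "t = interior (convex hull {a, b, c})" "(a, b) \<in> G" "(b, c) \<in> G" "(c, a) \<in> G" "0 < orient a b c"
      by auto
    then have "t = tri a b c" by (simp add: interior_hull3)
    then show "t \<in> {tri a b c | a b c. (a, b) \<in> G \<and> (b, c) \<in> G \<and> (c, a) \<in> G \<and> 0 < orient a b c}"
      using abc by blast
  qed
  \<comment> \<open>The vertices are recovered as the points of the closed triangle on the
    circle.\<close>
  moreover have "inj_on (\<lambda>S. interior (convex hull S)) (cliques G)"
  proof (rule inj_on_inverseI)
    fix S assume "S \<in> cliques G"
    then obtain a b c where abc: "S = {a, b, c}" "(a, b) \<in> G" "(b, c) \<in> G" "0 < orient a b c"
      by (auto simp: cliques_def)
    have circ: "a \<in> circ" "b \<in> circ" "c \<in> circ" using abc Gc by auto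
    have "closure (interior (convex hull S)) \<inter> circ = convex hull {a, b, c} \<inter> circ"
      using abc by (simp add: interior_hull3 closure_tri)
    also have "\<dots> = {a, b, c}"
      using circ_Int_hull3[OF circ _ abc(4)] circ hull_inc[of _ "{a, b, c}" convex] hull3_eq[OF abc(4)] by auto
    finally show "closure (interior (convex hull S)) \<inter> circ = S" using abc by simp
  qed
  ultimately show ?thesis using card_cliques[OF G] by (simp add: card_image)
qed

section \<open>Vertices of the regular polygon and rounding to them\<close>

abbreviation ngon_vertices :: "nat \<Rightarrow> complex set" where
  "ngon_vertices n \<equiv> ngon_vertex 0 n ` {..<n}"

lemma ngon_vertex_circ: "ngon_vertex t n k \<in> circ"
  by (simp add: ngon_vertex_def circ_def)

text \<open>All constructed polygons have a vertex at angle 0. The order of the indices below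
  \<open>n\<close> is then the order of the angles.\<close>

lemma ang_ngon_vertex:
  assumes "k < n" shows "ang (ngon_vertex 0 n k) = 2 * pi * real k / real n"
proof -
  have "2 * pi * real k / real n < 2 * pi" using assms by (simp add: field_simps)
  then show ?thesis unfolding ang_def
    by (intro Arg2pi_unique[of "1 / (2 * pi)"]) (use assms in \<open>auto simp: ngon_vertex_def rcis_def cis_conv_exp\<close>)
qed

lemma ngon_vertex_mod:
  assumes "0 < n" shows "ngon_vertex t n (k mod n) = ngon_vertex t n k"
proof -
  have "real k = real (k mod n) + real n * real (k div n)"
    by (metis mod_mult_div_eq of_nat_add of_nat_mult)
  then have "t + 2 * pi * real k / real n = (t + 2 * pi * real (k mod n) / real n) + 2 * pi * real (k div n)"
    using assms by (simp add: field_simps)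
  then show ?thesis unfolding ngon_vertex_def rcis_def
    by (simp add: cis_mult[symmetric] cis_multiple_2pi)
qed

lemma ang_ngon_vertex_less:
  assumes "i < n" "j < n"
  shows "ang (ngon_vertex 0 n i) < ang (ngon_vertex 0 n j) \<longleftrightarrow> i < j"
  using assms by (simp add: ang_ngon_vertex divide_simps)

lemma card_ngon_vertices: "card (ngon_vertices n) = n"
proof -
  have "inj_on (ngon_vertex 0 n) {..<n}"
    using ang_ngon_vertex_less by (intro inj_onI) (metis lessThan_iff linorder_neqE_nat order_less_irrefl)
  then show ?thesis by (simp add: card_image)
qed

lemma regular_ngon_triangulation_maxnc:
  assumes "3 \<le> n" "maxnc (ngon_vertices n) G"
  shows "regular_ngon_triangulation n (chords G)"
proof -
  have V: "finite (ngon_vertices n)" "ngon_vertices n \<subseteq> circ" using ngon_vertex_circ by auto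
  have GV: "G \<subseteq> ngon_vertices n \<times> ngon_vertices n" and nG: "ncr G" using assms(2) by (auto simp: maxnc_def)
  have Gc: "G \<subseteq> circ \<times> circ" using GV V by blast
  have side: "(ngon_vertex 0 n k, ngon_vertex 0 n (Suc k)) \<in> G" if k: "k < n" for k
  proof -
    have s: "ngon_vertex 0 n (Suc k) = ngon_vertex 0 n (Suc k mod n)" using ngon_vertex_mod[of n 0 "Suc k"] k by simp
    \<comment> \<open>Traversed backwards, a side has all vertices weakly on its right, so it
      belongs to \<open>G\<close>. The last side ends at vertex 0, which is why the index is reduced
      modulo \<open>n\<close>.\<close>
    have "(ngon_vertex 0 n (Suc k mod n), ngon_vertex 0 n k) \<in> G"
    proof (rule maxnc_empty_side[OF assms(2) V(2)])
      fix v assume "v \<in> ngon_vertices n"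
      then obtain j where j: "j < n" "v = ngon_vertex 0 n j" by auto
      have m: "Suc k mod n < n" "Suc k mod n = (if Suc k = n then 0 else Suc k)" using k by (auto simp: mod_Suc)
      have "\<not> 0 < orient (ngon_vertex 0 n (Suc k mod n)) (ngon_vertex 0 n k) v"
        unfolding j(2) orient_pos_iff[OF ngon_vertex_circ ngon_vertex_circ ngon_vertex_circ]
          ang_ngon_vertex_less[OF m(1) k] ang_ngon_vertex_less[OF k j(1)] ang_ngon_vertex_less[OF j(1) m(1)]
        using j(1) unfolding m(2) by auto
      then show "orient (ngon_vertex 0 n (Suc k mod n)) (ngon_vertex 0 n k) v \<le> 0" by simp
    qed (use k in auto)
    then show ?thesis using maxnc_sym[OF assms(2)] s by simp
  qed
  define L where "L = G \<inter> ngon_diagonals 0 n"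
  have "ncr L" using nG by (auto simp: ncr_def L_def)
  then have "noncrossing L" using Gc by (subst noncrossing_iff) (auto simp: L_def)
  moreover have "chords G = chords (ngon_sides 0 n \<union> L)"
  proof
    show "chords (ngon_sides 0 n \<union> L) \<subseteq> chords G"
      using side by (intro chords_mono) (auto simp: ngon_sides_def L_def)
    show "chords G \<subseteq> chords (ngon_sides 0 n \<union> L)"
    proof
      fix q assume "q \<in> chords G"
      then obtain x y where xy: "(x, y) \<in> G" "q \<in> closed_segment x y" by (auto simp: chords_def)
      then obtain i j where ij: "i < n" "j < n" "x = ngon_vertex 0 n i" "y = ngon_vertex 0 n j" using GV by auto
      have s: "(ngon_vertex 0 n k, ngon_vertex 0 n (Suc k mod n)) \<in> ngon_sides 0 n" if "k < n" for k
        using that ngon_vertex_mod[of n 0 "Suc k"] by (auto simp: ngon_sides_def)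
      consider "i = j" | "j = Suc i mod n" | "i = Suc j mod n" | "(x, y) \<in> ngon_diagonals 0 n"
        using ij unfolding ngon_diagonals_def by blast
      then show "q \<in> chords (ngon_sides 0 n \<union> L)"
      proof cases
        \<comment> \<open>A one-point chord is a vertex and lies on the side that starts
          there.\<close>
        case 1
        then have "q \<in> closed_segment (ngon_vertex 0 n i) (ngon_vertex 0 n (Suc i mod n))" using xy ij by simp
        then show ?thesis using s[OF ij(1)] unfolding chords_def by blast
      next
        case 2
        then show ?thesis using s[OF ij(1)] xy ij unfolding chords_def by blast
      next
        case 3
        then show ?thesis using s[OF ij(2)] xy ij closed_segment_commute[of x y] unfolding chords_def by blast
      next
        case 4
        then show ?thesis using xy unfolding chords_def L_def by blast
      qed
    qed
  qed
  moreover have "components (ngon 0 n - chords G) \<subseteq> open_triangles UNIV"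
    unfolding ngon_def components_maxnc[OF assms(2) V] open_triangles_iff subset_iff by blast
  moreover have "card (components (ngon 0 n - chords G)) = n - 2"
    unfolding ngon_def using card_components_maxnc[OF assms(2) V] assms(1) card_ngon_vertices by simp
  moreover have "L \<subseteq> ngon_diagonals 0 n" by (simp add: L_def)
  ultimately show ?thesis unfolding regular_ngon_triangulation_def
    by (intro exI[of _ 0] exI[of _ L]) (auto simp: chords_def)
qed

text \<open>Rounding to the nearest vertex would send angles just below a full turn to vertex 0 and
  destroy monotonicity; rounding down does not.\<close>

definition round_vertex :: "nat \<Rightarrow> complex \<Rightarrow> complex" where
  "round_vertex n z = ngon_vertex 0 n (nat \<lfloor>real n * ang z / (2 * pi)\<rfloor>)"

text \<open>Chord against arc, from |sin x| <= |x|.\<close>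

lemma norm_rcis_diff_le: "0 \<le> r \<Longrightarrow> norm (rcis r \<alpha> - rcis r \<beta>) \<le> r * \<bar>\<alpha> - \<beta>\<bar>"
proof -
  assume r: "0 \<le> r"
  have "rcis r \<alpha> - rcis r \<beta> = of_real r * (cis \<beta> * (cis (\<alpha> - \<beta>) - 1))"
    by (simp add: rcis_def algebra_simps cis_mult)
  then have "norm (rcis r \<alpha> - rcis r \<beta>) = r * norm (exp (\<i> * of_real (\<alpha> - \<beta>)) - 1)"
    using r by (simp add: norm_mult cis_conv_exp)
  also have "norm (exp (\<i> * of_real (\<alpha> - \<beta>)) - 1) = 2 * \<bar>sin ((\<alpha> - \<beta>) / 2)\<bar>"
    by (rule dist_exp_i_1)
  also have "\<dots> \<le> \<bar>\<alpha> - \<beta>\<bar>" using abs_sin_x_le_abs_x[of "(\<alpha> - \<beta>) / 2"] by simp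
  finally show ?thesis using r by (simp add: mult_left_mono)
qed

text \<open>The circumference is 1, so consecutive vertices are an arc of length 1 / n
  apart.\<close>

lemma round_vertex:
  assumes "0 < n" "z \<in> circ"
  shows "round_vertex n z \<in> ngon_vertices n" "dist (round_vertex n z) z \<le> 1 / real n"
proof -
  define k where "k = nat \<lfloor>real n * ang z / (2 * pi)\<rfloor>"
  have x: "0 \<le> real n * ang z / (2 * pi)" "real n * ang z / (2 * pi) < real n"
    using circ_ang(2,3)[OF assms(2)] assms(1) by (auto simp: field_simps)
  have k: "real k \<le> real n * ang z / (2 * pi)" "real n * ang z / (2 * pi) < real k + 1"
    using x(1) unfolding k_def by linarith+
  then have "k < n" using x(2) by linarith
  then show "round_vertex n z \<in> ngon_vertices n" by (simp add: round_vertex_def k_def)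
  have "dist (round_vertex n z) z = norm (rcis (1/(2*pi)) (2 * pi * real k / real n) - rcis (1/(2*pi)) (ang z))"
    using circ_ang(1)[OF assms(2)] by (simp add: round_vertex_def k_def[symmetric] ngon_vertex_def dist_norm)
  also have "\<dots> \<le> 1/(2*pi) * \<bar>2 * pi * real k / real n - ang z\<bar>" by (rule norm_rcis_diff_le) simp
  also have "\<dots> = \<bar>real k - real n * ang z / (2 * pi)\<bar> / real n"
  proof -
    have "real k - real n * ang z / (2 * pi) = real n / (2 * pi) * (2 * pi * real k / real n - ang z)"
      using assms(1) by (simp add: field_simps)
    then show ?thesis using assms(1) by (simp add: abs_mult)
  qed
  also have "\<dots> \<le> 1 / real n" using k by (intro divide_right_mono) auto
  finally show "dist (round_vertex n z) z \<le> 1 / real n" .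
qed

lemma ang_round_vertex_less:
  assumes "0 < n" "x \<in> circ" "y \<in> circ" "ang (round_vertex n x) < ang (round_vertex n y)"
  shows "ang x < ang y"
proof (rule ccontr)
  assume "\<not> ?thesis"
  then have "real n * ang y / (2 * pi) \<le> real n * ang x / (2 * pi)"
    by (simp add: divide_right_mono mult_left_mono)
  then have le: "nat \<lfloor>real n * ang y / (2 * pi)\<rfloor> \<le> nat \<lfloor>real n * ang x / (2 * pi)\<rfloor>"
    by (intro nat_mono floor_mono)
  have lt: "nat \<lfloor>real n * ang z / (2 * pi)\<rfloor> < n" if "z \<in> circ" for z
  proof -
    have "real n * ang z / (2 * pi) < real n"
      using circ_ang(2,3)[OF that] assms(1) by (auto simp: field_simps)
    then show ?thesis using assms(1) by linarith
  qed
  show False using assms(4) le unfolding round_vertex_def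
      ang_ngon_vertex_less[OF lt[OF assms(2)] lt[OF assms(3)]] by linarith
qed

text \<open>A strict inequality between rounded angles holds already before rounding. So a nonzero
  orientation after rounding has the sign it had before, and rounding can only make orientations
  vanish.\<close>

lemma ncr_round_vertex:
  assumes "0 < n" "L \<subseteq> circ \<times> circ" "ncr L"
  shows "ncr ((\<lambda>(a, b). (round_vertex n a, round_vertex n b)) ` L)"
  unfolding ncr_def
proof clarify
  fix a b c d assume ab: "(a, b) \<in> L" and cd: "(c, d) \<in> L"
  have circ: "a \<in> circ" "b \<in> circ" "c \<in> circ" "d \<in> circ" using ab cd assms(2) by auto
  have r: "round_vertex n z \<in> circ" for z by (simp add: round_vertex_def ngon_vertex_circ)
  have pos: "0 < orient x y z" if "x \<in> circ" "y \<in> circ" "z \<in> circ"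
    "0 < orient (round_vertex n x) (round_vertex n y) (round_vertex n z)" for x y z
    using that ang_round_vertex_less[OF assms(1)] by (auto simp: orient_pos_iff r)
  have neg: "orient x y z < 0" if "x \<in> circ" "y \<in> circ" "z \<in> circ"
    "orient (round_vertex n x) (round_vertex n y) (round_vertex n z) < 0" for x y z
    using pos[of y x z] that by (simp add: orient_swap[of x y z] orient_swap[of "round_vertex n x" "round_vertex n y"])
  show "0 \<le> orient (round_vertex n a) (round_vertex n b) (round_vertex n c)
         * orient (round_vertex n a) (round_vertex n b) (round_vertex n d)"
    using ncrD[OF assms(3) ab cd] pos[OF circ(1-3)] pos[OF circ(1,2,4)] neg[OF circ(1-3)] neg[OF circ(1,2,4)]
    by (smt (verit) mult_less_0_iff mult_nonneg_nonpos mult_nonpos_nonneg)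
qed

section \<open>Rigid chords and faces\<close>

lemma ray_circ:
  assumes "k \<in> disc" "p \<in> disc" "p \<noteq> k"
  obtains m where "m \<in> circ" "p \<in> closed_segment k m" "m \<noteq> k"
proof (cases "p \<in> circ")
  case True then show thesis using that[of p] assms by simp
next
  case False
  then have "p \<in> interior disc" using assms(2) by (auto simp: disc_def circ_def)
  then obtain d where d: "0 < d" "p + d *\<^sub>R (p - k) \<in> frontier disc"
    using ray_to_frontier[OF compact_imp_bounded[OF compact_disc], of p "p - k"] assms(3)
    by (metis right_minus_eq)
  define m where "m = p + d *\<^sub>R (p - k)"
  have "m \<in> circ" using d(2) by (simp add: m_def disc_def circ_def)
  moreover have "p = (1 - 1 / (1 + d)) *\<^sub>R k + (1 / (1 + d)) *\<^sub>R m"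
  proof -
    have "(1 + d) *\<^sub>R p = d *\<^sub>R k + m" by (simp add: m_def algebra_simps)
    then have "(1 / (1 + d)) *\<^sub>R ((1 + d) *\<^sub>R p) = (1 / (1 + d)) *\<^sub>R (d *\<^sub>R k + m)" by simp
    moreover have "1 - 1 / (1 + d) = d / (1 + d)" using d(1) by (simp add: field_simps)
    ultimately show ?thesis using d(1) by (simp add: scaleR_add_right)
  qed
  then have "p \<in> closed_segment k m" using d(1) unfolding in_segment by (intro exI[of _ "1 / (1 + d)"]) auto
  moreover have "m \<noteq> k"
  proof
    assume "m = k"
    then have "(1 + d) *\<^sub>R (p - k) = 0" by (simp add: m_def algebra_simps)
    then show False using d(1) assms(3) by simp
  qed
  ultimately show thesis using that by blast
qed

text \<open>Inversion at \<open>m\<close> maps the circle minus \<open>m\<close> to a line; this turns the orientation of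
  triples containing \<open>m\<close> into the order of the line.\<close>

lemma orient_inversion:
  assumes "m \<in> circ" "x \<in> circ" "y \<in> circ" "x \<noteq> m" "y \<noteq> m"
  shows "0 < orient m x y \<longleftrightarrow> Im (m / (x - m)) < Im (m / (y - m))"
proof -
  have m0: "m \<noteq> 0" using assms(1) by (auto simp: circ_def)
  have Re: "Re (m / (z - m)) = - 1 / 2" if "z \<in> circ" "z \<noteq> m" for z
  proof -
    define w where "w = m / (z - m)"
    have w0: "w \<noteq> 0" using m0 that by (simp add: w_def)
    \<comment> \<open>As \<open>z\<close> and \<open>m\<close> have equal norm, \<open>w\<close> is
      equidistant from 0 and -1; this gives the line onto which the inversion maps the
      circle.\<close>
    have "z * w = m * (w + 1)" using that by (simp add: w_def field_simps)
    then have "norm z * norm w = norm m * norm (w + 1)" by (metis norm_mult)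
    then have "norm w = norm (w + 1)" using that assms(1) by (simp add: circ_def)
    then have "(norm w)\<^sup>2 = (norm (w + 1))\<^sup>2" by simp
    then have "Re w = - 1 / 2" unfolding cmod_power2 by (simp add: power2_eq_square algebra_simps)
    then show ?thesis by (simp add: w_def)
  qed
  define w v where "w = m / (x - m)" and "v = m / (y - m)"
  have wv: "w \<noteq> 0" "v \<noteq> 0" using m0 assms by (auto simp: w_def v_def)
  have xy: "x - m = m / w" "y - m = m / v" using m0 assms by (auto simp: w_def v_def)
  have "cnj (x - m) * (y - m) = of_real ((norm m)\<^sup>2 / ((norm w)\<^sup>2 * (norm v)\<^sup>2)) * (w * cnj v)"
  proof -
    have "of_real ((norm m)\<^sup>2 / ((norm w)\<^sup>2 * (norm v)\<^sup>2)) = (m * cnj m) / ((w * cnj w) * (v * cnj v))"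
      unfolding complex_norm_square[symmetric] by simp
    then show ?thesis unfolding xy using wv by simp
  qed
  then have "orient m x y = (norm m)\<^sup>2 / ((norm w)\<^sup>2 * (norm v)\<^sup>2) * Im (w * cnj v)"
    by (simp only: orient_def) simp
  also have "Im (w * cnj v) = (Im v - Im w) / 2"
    using Re[of x] Re[of y] assms by (simp add: w_def[symmetric] v_def[symmetric] field_simps)
  finally have "orient m x y = (norm m)\<^sup>2 / ((norm w)\<^sup>2 * (norm v)\<^sup>2) * ((Im v - Im w) / 2)" .
  moreover have "0 < (norm m)\<^sup>2 / ((norm w)\<^sup>2 * (norm v)\<^sup>2)" using m0 wv by simp
  ultimately obtain K where "orient m x y = K * ((Im v - Im w) / 2)" "0 < K" by blast
  then have "0 < orient m x y \<longleftrightarrow> 0 < (Im v - Im w) / 2"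
    by (simp only: zero_less_mult_iff) auto
  then show ?thesis by (simp add: w_def v_def)
qed

text \<open>Inversion at \<open>m\<close> carries \<open>K\<close> to a compact subset of a line.
  The preimages of its two extreme points are the ends of the gap of \<open>K\<close> around
  \<open>m\<close>.\<close>

lemma circ_gap:
  assumes "compact K" "K \<subseteq> circ" "m \<in> circ" "m \<notin> K" "k \<in> K" "k' \<in> K" "k \<noteq> k'"
  obtains a b where "a \<in> K" "b \<in> K" "a \<noteq> b" "0 < orient a b m" "\<And>x. x \<in> K \<Longrightarrow> orient a b x \<le> 0"
proof -
  define f where "f x = Im (m / (x - m))" for x
  have cont: "continuous_on K f" unfolding f_def
    by (intro continuous_intros) (use assms(4) in auto)
  have ne: "K \<noteq> {}" using assms(5) by auto
  obtain a where a: "a \<in> K" "\<And>x. x \<in> K \<Longrightarrow> f a \<le> f x"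
    using continuous_attains_inf[OF assms(1) ne cont] by blast
  obtain b where b: "b \<in> K" "\<And>x. x \<in> K \<Longrightarrow> f x \<le> f b"
    using continuous_attains_sup[OF assms(1) ne cont] by blast
  have o: "0 < orient m x y \<longleftrightarrow> f x < f y" if "x \<in> K" "y \<in> K" for x y
    using orient_inversion[of m x y] assms(2-4) that by (auto simp: f_def)
  have circ: "a \<in> circ" "b \<in> circ" "m \<noteq> a" "m \<noteq> b" using a b assms by auto
  have mono: "x = y" if "x \<in> K" "y \<in> K" "f x = f y" for x y
    using o[of x y] o[of y x] orient_circ_eq_0[of m x y] orient_swap[of m x y] that assms(2-4)
      orient_rotate[of m x y] orient_rotate[of m y x] orient_swap[of x y m]
    by (metis less_irrefl linorder_neqE_linordered_idom neg_0_less_iff_less subsetD orient_rotate orient_swap)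
  have "a \<noteq> b" using a b assms(5-7) mono by (metis antisym)
  then have "f a < f b" using a b mono by (metis order_le_less)
  then have mab: "0 < orient m a b" using o a b by blast
  then have "0 < orient a b m" using orient_rotate[of a b m] by simp
  moreover have "orient a b x \<le> 0" if x: "x \<in> K" for x
  proof (rule ccontr)
    assume n: "\<not> ?thesis"
    have xc: "x \<in> circ" using x assms(2) by auto
    have "x \<noteq> a" "x \<noteq> b" using n by auto
    then have "f a < f x" "f x < f b" using a b x mono by (metis order_le_less)+
    then have "0 < orient m a x" "0 < orient m x b" using o a b x by auto
    then show False
      using n xc circ assms(3) by (auto simp: orient_pos_iff not_le)
  qed
  ultimately show thesis using that a b \<open>a \<noteq> b\<close> by blast
qed

lemma same_component:
  assumes "x \<in> components U" "y \<in> components U" "connected S" "S \<subseteq> U" "x \<inter> S \<noteq> {}" "y \<inter> S \<noteq> {}"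
  shows "x = y"
  using components_maximal[OF assms(1,3,4,5)] components_maximal[OF assms(2,3,4,6)]
    components_eq[OF assms(1,2)] assms(5) by blast

text \<open>The test runs over all chords inside \<open>C\<close> and not over a chosen family, so
  the notion depends on \<open>C\<close> alone. One-point chords and both orders of a pair are
  included.\<close>

definition rigid :: "complex set \<Rightarrow> (complex \<times> complex) set" where
  "rigid C = {(a, b). a \<in> circ \<and> b \<in> circ \<and> closed_segment a b \<subseteq> C \<and>
     (\<forall>c\<in>circ. \<forall>d\<in>circ. closed_segment c d \<subseteq> C \<longrightarrow> 0 \<le> orient a b c * orient a b d)}"

lemma rigid_sym: "(a, b) \<in> rigid C \<Longrightarrow> (b, a) \<in> rigid C"
  by (auto simp: rigid_def closed_segment_commute orient_swap[of b a])

lemma rigid_refl: "a \<in> C \<Longrightarrow> a \<in> circ \<Longrightarrow> (a, a) \<in> rigid C"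
  by (auto simp: rigid_def)

lemma rigidD:
  assumes "(a, b) \<in> rigid C"
  shows "a \<in> circ" "b \<in> circ" "closed_segment a b \<subseteq> C" "a \<in> C" "b \<in> C"
    "\<And>c d. c \<in> circ \<Longrightarrow> d \<in> circ \<Longrightarrow> closed_segment c d \<subseteq> C \<Longrightarrow> 0 \<le> orient a b c * orient a b d"
  using assms by (auto simp: rigid_def)

lemma rigid_ncr: "ncr (rigid C)"
  by (auto simp: ncr_def rigid_def)

lemma closed_pairs_segment_subset:
  fixes C :: "complex set" assumes "closed C" shows "closed {(a, b). closed_segment a b \<subseteq> C}"
proof -
  have "{(a, b). closed_segment a b \<subseteq> C} = (\<Inter>s\<in>{0..1}. (\<lambda>e. (1 - s) *\<^sub>R fst e + s *\<^sub>R snd e) -` C)"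
    unfolding in_segment subset_iff by fastforce
  moreover have "closed \<dots>"
    by (intro closed_INT ballI closed_vimage assms continuous_intros)
  ultimately show ?thesis by simp
qed

text \<open>Closedness is what makes a segment that meets rigid chords meet a nearest one.\<close>

lemma closed_rigid:
  assumes "closed C" shows "closed (rigid C)"
proof -
  have "rigid C = (circ \<times> circ) \<inter> {(a, b). closed_segment a b \<subseteq> C} \<inter>
     (\<Inter>c\<in>circ. \<Inter>d\<in>{d\<in>circ. closed_segment c d \<subseteq> C}.
        {e. 0 \<le> orient (fst e) (snd e) c * orient (fst e) (snd e) d})"
    by (auto simp: rigid_def)
  moreover have "closed \<dots>"
    by (intro closed_Int closed_INT ballI closed_pairs_segment_subset assms closed_Times
        compact_imp_closed compact_circ closed_Collect_le continuous_intros)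
  ultimately show ?thesis by simp
qed

abbreviation (input) faces :: "complex set \<Rightarrow> complex set set" where
  "faces C \<equiv> Delta C \<union> Nabla C"

text \<open>Common ground of conditions 1 and 2. The equation \<open>hull_C\<close> follows from the
  first because \<open>C\<close> is a union of chords, and from the second by the Krein-Milman
  theorem.\<close>

locale tri1_set =
  fixes C :: "complex set"
  assumes closed_C: "closed C" and nonempty_C: "C \<noteq> {}" and C_subset_disc: "C \<subseteq> disc"
    and tri1: "Tri1 C" and hull_C: "convex hull C = convex hull (C \<inter> circ)"
begin

lemma compact_C: "compact C"
  using compact_Int_closed[OF compact_disc closed_C] C_subset_disc by (simp add: Int_absorb1)

lemma hull_subset_disc: "convex hull C \<subseteq> disc"
  by (intro hull_minimal C_subset_disc convex_disc)

lemma closed_hull: "closed (convex hull C)"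
  using compact_C compact_convex_hull compact_imp_closed by blast

text \<open>A chord in \<open>C\<close> crossing the side \<open>a b\<close> at \<open>q\<close>
  would enter the open triangle right after \<open>q\<close>: near \<open>q\<close> it is still to
  the left of the other two sides. But the triangle is disjoint from \<open>C\<close>.\<close>

lemma rigid_side_of_triangle:
  assumes t: "0 < orient a b c" "a \<in> circ" "b \<in> circ" "c \<in> circ" "tri a b c \<inter> C = {}" "closed_segment a b \<subseteq> C"
  shows "(a, b) \<in> rigid C"
proof -
  have no: False if kl: "k \<in> circ" "l \<in> circ" "closed_segment k l \<subseteq> C" "orient a b k < 0" "0 < orient a b l" for k l
  proof -
    have ab: "a \<noteq> b" using t(1) by auto
    obtain q where q: "q \<in> open_segment k l" "orient a b q = 0"
      using orient_sign_change[of a b k l] kl by (auto simp: mult_neg_pos)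
    have kld: "k \<in> disc" "l \<in> disc" using kl circ_subset_disc by auto
    have "q \<in> disc" using chord_subset_disc[OF kl(1,2)] q(1) open_closed_segment by blast
    then have "q \<in> closed_segment a b" using line_meets_disc t ab q by blast
    moreover have "q \<noteq> a" "q \<noteq> b" using open_segment_disc[OF kld q(1)] t by (auto simp: circ_def)
    ultimately have "q \<in> open_segment a b" by (simp add: open_segment_def)
    moreover have "0 < orient b c a" "0 < orient c a b"
      using t(1) orient_rotate[of a b c] orient_rotate[of b c a] by auto
    ultimately have "0 < orient b c q" "0 < orient c a q"
      using orient_open_segment_pos[of q a b b c] orient_open_segment_pos[of q a b c a] by auto
    have tend: "((\<lambda>s. orient x y ((1 - s) *\<^sub>R q + s *\<^sub>R l)) \<longlongrightarrow> orient x y ((1 - 0) *\<^sub>R q + 0 *\<^sub>R l)) (at_right 0)" for x y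
      by (intro tendsto_intros)
    have "eventually (\<lambda>s. 0 < orient b c ((1 - s) *\<^sub>R q + s *\<^sub>R l)) (at_right 0)"
      "eventually (\<lambda>s. 0 < orient c a ((1 - s) *\<^sub>R q + s *\<^sub>R l)) (at_right 0)"
      using tend[of b c] tend[of c a] \<open>0 < orient b c q\<close> \<open>0 < orient c a q\<close>
      by (auto elim!: order_tendstoD(1))
    moreover have "eventually (\<lambda>s. s \<in> {0<..<1}) (at_right (0::real))"
      by (rule eventually_at_right_real) simp
    ultimately have "eventually (\<lambda>s. 0 < orient b c ((1 - s) *\<^sub>R q + s *\<^sub>R l) \<and>
        0 < orient c a ((1 - s) *\<^sub>R q + s *\<^sub>R l) \<and> s \<in> {0<..<1}) (at_right (0::real))"
      by eventually_elim auto
    then obtain s where s: "0 < orient b c ((1 - s) *\<^sub>R q + s *\<^sub>R l)"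
        "0 < orient c a ((1 - s) *\<^sub>R q + s *\<^sub>R l)" "0 < s" "s < 1"
      using eventually_happens[of _ "at_right (0::real)"] by force
    have "0 < orient a b ((1 - s) *\<^sub>R q + s *\<^sub>R l)"
      unfolding orient_convex using q(2) s kl by simp
    then have "(1 - s) *\<^sub>R q + s *\<^sub>R l \<in> tri a b c" using s by (simp add: tri_def)
    moreover have "(1 - s) *\<^sub>R q + s *\<^sub>R l \<in> closed_segment q l" unfolding in_segment
      using s by (intro exI[of _ s]) auto
    then have "(1 - s) *\<^sub>R q + s *\<^sub>R l \<in> closed_segment k l"
      using q(1) by (metis open_closed_segment subset_closed_segment ends_in_segment(2) subsetD)
    ultimately show False using kl(3) t(5) by blast
  qed
  have "0 \<le> orient a b c' * orient a b d'" if "c' \<in> circ" "d' \<in> circ" "closed_segment c' d' \<subseteq> C" for c' d'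
  proof (rule ccontr)
    assume "\<not> ?thesis"
    then have "orient a b c' < 0 \<and> 0 < orient a b d' \<or> orient a b d' < 0 \<and> 0 < orient a b c'"
      by (auto simp: not_le mult_less_0_iff)
    then show False using no[of c' d'] no[of d' c'] that by (auto simp: closed_segment_commute)
  qed
  then show ?thesis using t unfolding rigid_def by blast
qed

lemma Delta_tri:
  assumes "t \<in> Delta C"
  obtains a b c where "t = tri a b c" "0 < orient a b c" "(a, b) \<in> rigid C" "(b, c) \<in> rigid C" "(c, a) \<in> rigid C"
    "a \<in> circ" "b \<in> circ" "c \<in> circ" "tri a b c \<inter> C = {}" "tri a b c \<subseteq> convex hull C"
proof -
  have "t \<in> open_triangles circ" using assms tri1 by (auto simp: Tri1_def)
  then obtain a b c where abc: "a \<in> circ" "b \<in> circ" "c \<in> circ" "0 < orient a b c" "t = tri a b c"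
    unfolding open_triangles_iff by blast
  have t: "t \<in> components (convex hull C - C)" using assms by (simp add: Delta_def)
  have sub: "t \<subseteq> convex hull C - C" using t by (rule in_components_subset)
  \<comment> \<open>A frontier point outside \<open>C\<close> could be added to the component
    without losing connectedness, but the open set \<open>t\<close> contains none of its
    frontier.\<close>
  have "frontier t \<subseteq> C"
  proof
    fix q assume q: "q \<in> frontier t"
    show "q \<in> C"
    proof (rule ccontr)
      assume nq: "q \<notin> C"
      have qc: "q \<in> closure t" using q by (simp add: frontier_def)
      then have "q \<in> convex hull C" using closure_minimal[OF _ closed_hull, of t] sub by blast
      moreover have "connected (insert q t)"
        by (rule connected_intermediate_closure[of t])
          (use in_components_connected[OF t] qc closure_subset in auto)
      ultimately have "insert q t \<subseteq> t"
        using components_maximal[OF t, of "insert q t"] nq sub in_components_nonempty[OF t] by blast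
      then show False using q open_tri abc(5) by (auto simp: frontier_def interior_open)
    qed
  qed
  then have C: "closed_segment a b \<subseteq> C" "closed_segment b c \<subseteq> C" "closed_segment c a \<subseteq> C"
    using frontier_tri abc by auto
  have d: "tri a b c \<inter> C = {}" "tri b c a \<inter> C = {}" "tri c a b \<inter> C = {}"
    using sub abc(5) tri_rotate[of b c a] tri_rotate[of c a b] by auto
  have o: "0 < orient b c a" "0 < orient c a b" using abc(4) orient_rotate[of b c a] orient_rotate[of a b c] by auto
  show thesis
    using that[of a b c] abc rigid_side_of_triangle[OF abc(4,1,2,3) d(1) C(1)]
      rigid_side_of_triangle[OF o(1) abc(2,3,1) d(2) C(2)]
      rigid_side_of_triangle[OF o(2) abc(3,1,2) d(3) C(3)] sub d by blast
qed

text \<open>What the hull has outside \<open>C\<close> consists of open triangles inside the hull,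
  which lie in its interior.\<close>

lemma hull_boundary_in_C:
  assumes "q \<in> convex hull C" "q \<notin> interior (convex hull C)" shows "q \<in> C"
proof (rule ccontr)
  assume "q \<notin> C"
  then have "q \<in> \<Union>(Delta C)" using assms(1) unfolding Delta_def Union_components by simp
  then obtain t where t: "t \<in> Delta C" "q \<in> t" by blast
  then obtain x y z where "t = tri x y z" "tri x y z \<subseteq> convex hull C" using Delta_tri by metis
  then have "q \<in> interior (convex hull C)" using t(2) open_tri interior_maximal by blast
  then show False using assms(2) by blast
qed

text \<open>The segment is in the boundary of the hull, hence in \<open>C\<close>; it is not crossed
  because all of \<open>C\<close> is weakly on one side.\<close>

lemma hull_edge_rigid:
  assumes "a \<in> C \<inter> circ" "b \<in> C \<inter> circ" "a \<noteq> b" "\<And>x. x \<in> C \<inter> circ \<Longrightarrow> orient a b x \<le> 0"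
  shows "(a, b) \<in> rigid C"
proof -
  have h: "convex hull C \<subseteq> {q. orient a b q \<le> 0}"
    unfolding hull_C using assms(4) by (intro hull_minimal convex_orient) auto
  have "closed_segment a b \<subseteq> C"
  proof
    fix q assume q: "q \<in> closed_segment a b"
    have "q \<in> convex hull C"
      using q assms(1,2) by (metis IntE closed_segment_subset convex_convex_hull hull_inc subsetD)
    moreover have "q \<notin> interior (convex hull C)"
    proof
      assume "q \<in> interior (convex hull C)"
      then have "0 < orient b a q"
        using h assms(3) by (intro orient_interior_pos[of q "convex hull C"]) (auto simp: orient_swap[of b a])
      then show False using orient_on_segment[of q b a] q by (simp add: closed_segment_commute)
    qed
    ultimately show "q \<in> C" by (rule hull_boundary_in_C)
  qed
  moreover have "0 \<le> orient a b c * orient a b d" if "c \<in> circ" "d \<in> circ" "closed_segment c d \<subseteq> C" for c d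
    using that by (intro mult_nonpos_nonpos assms(4)) auto
  ultimately show ?thesis using assms unfolding rigid_def by blast
qed

lemma gap_rigid:
  assumes "m \<in> circ" "m \<notin> C" "k \<in> C \<inter> circ" "k' \<in> C \<inter> circ" "k \<noteq> k'"
  obtains a b where "(a, b) \<in> rigid C" "a \<noteq> b" "0 < orient a b m" "convex hull C \<subseteq> {x. orient a b x \<le> 0}"
proof -
  have "compact (C \<inter> circ)" using compact_C compact_circ closed_C by (simp add: compact_Int)
  then obtain a b where ab: "a \<in> C \<inter> circ" "b \<in> C \<inter> circ" "a \<noteq> b" "0 < orient a b m"
    "\<And>x. x \<in> C \<inter> circ \<Longrightarrow> orient a b x \<le> 0"
    using circ_gap[of "C \<inter> circ" m k k'] assms by blast
  have "convex hull C \<subseteq> {q. orient a b q \<le> 0}"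
    unfolding hull_C using ab(5) by (intro hull_minimal convex_orient) auto
  then show thesis using that hull_edge_rigid[OF ab(1-3,5)] ab by blast
qed

lemma face_basic:
  assumes "x \<in> faces C"
  shows "x \<noteq> {}" "connected x" "x \<subseteq> disc - C"
  using assms in_components_nonempty in_components_connected in_components_subset hull_subset_disc hull_subset[of C convex]
  unfolding Delta_def Nabla_def by blast+

text \<open>A face outside the hull may reach the circle, where distinct chords can meet. Points off
  the circle keep the segments between faces away from it.\<close>

lemma face_point:
  assumes "x \<in> faces C"
  obtains p where "p \<in> x" "norm p < 1 / (2 * pi)"
proof -
  consider "x \<in> Delta C" | "x \<in> Nabla C" using assms by blast
  then show thesis
  proof cases
    case 1
    then obtain a b c where "x = tri a b c" "0 < orient a b c" "a \<in> circ" "b \<in> circ" "c \<in> circ"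
      using Delta_tri by metis
    then show thesis using that face_basic(1)[OF assms] tri_subset_disc(1)[of a b c] by fastforce
  next
    case 2
    then have x: "x \<in> components (disc - convex hull C)" by (simp add: Nabla_def)
    obtain p where p: "p \<in> x" using face_basic(1)[OF assms] by auto
    then have pU: "p \<in> disc" "p \<in> - (convex hull C)" using in_components_subset[OF x] by auto
    obtain e where e: "0 < e" "ball p e \<subseteq> - (convex hull C)"
      using closed_hull pU(2) open_Compl openE by metis
    \<comment> \<open>A slight shrinking towards the centre. As \<open>p\<close> has norm at most
      1/2, it moves by at most \<open>e / 2\<close>; the minimum with 1/2 keeps the factor
      positive.\<close>
    define p' where "p' = (1 - min (1/2) e) *\<^sub>R p"
    have "norm p' < 1 / (2 * pi)"
    proof (cases "p = 0")
      case False
      have "norm p' < norm p" using False e(1) by (simp add: p'_def abs_if min_def)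
      then show ?thesis using pU(1) by (simp add: disc_def)
    qed (simp add: p'_def)
    moreover have "p' \<in> ball p e \<inter> disc"
    proof -
      have "norm p \<le> 1 / 2"
      proof -
        have "1 / (2 * pi) \<le> 1 / 2" using pi_ge_two by (simp add: field_simps)
        moreover have "norm p \<le> 1 / (2 * pi)" using pU(1) unfolding disc_def by simp
        ultimately show ?thesis by linarith
      qed
      moreover have "dist p p' = min (1/2) e * norm p"
        using e(1) by (simp add: p'_def dist_norm algebra_simps)
      moreover have "min (1/2) e * norm p \<le> e * (1/2)" using calculation(1) e(1) by (intro mult_mono) auto
      ultimately have "dist p p' < e" using e(1) by simp
      then show ?thesis using \<open>norm p' < 1 / (2 * pi)\<close> by (simp add: disc_def)
    qed
    moreover have "ball p e \<inter> disc \<subseteq> x"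
      by (rule components_maximal[OF x])
        (use e p pU in \<open>auto intro!: convex_connected convex_Int convex_disc\<close>)
    ultimately show thesis using that by blast
  qed
qed

lemma in_face:
  assumes "p \<in> disc" "p \<notin> C" obtains x where "x \<in> faces C" "p \<in> x"
proof (cases "p \<in> convex hull C")
  case True
  then have "p \<in> \<Union>(Delta C)" using assms unfolding Delta_def Union_components by simp
  then show thesis using that by blast
next
  case False
  then have "p \<in> \<Union>(Nabla C)" using assms unfolding Nabla_def Union_components by simp
  then show thesis using that by blast
qed

lemma face_one_side:
  assumes "x \<in> faces C" "a \<in> circ" "b \<in> circ" "a \<noteq> b" "closed_segment a b \<subseteq> C"
  shows "(\<forall>q\<in>x. 0 < orient a b q) \<or> (\<forall>q\<in>x. orient a b q < 0)"
  using face_basic[OF assms(1)] assms by (intro one_side) auto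

lemma Delta_Nabla_disjoint: "x \<in> Delta C \<Longrightarrow> y \<in> Nabla C \<Longrightarrow> x \<inter> y = {}"
  using in_components_subset[of x] in_components_subset[of y] unfolding Delta_def Nabla_def by blast

lemma faces_disjoint:
  assumes "x \<in> faces C" "y \<in> faces C" "x \<noteq> y" shows "x \<inter> y = {}"
  using assms Delta_Nabla_disjoint components_nonoverlap unfolding Delta_def Nabla_def
  by (metis Un_iff inf_commute)

lemma outside_triangle:
  assumes "0 < orient a b c" "(a, b) \<in> rigid C" "(b, c) \<in> rigid C" "(c, a) \<in> rigid C" "p \<in> disc" "p \<notin> C" "p \<notin> tri a b c"
  shows "orient a b p < 0 \<or> orient b c p < 0 \<or> orient c a p < 0"
proof (rule ccontr)
  assume n: "\<not> ?thesis"
  have "orient a b p \<noteq> 0" "orient b c p \<noteq> 0" "orient c a p \<noteq> 0"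
    using line_meets_disc[of _ _ p] rigidD[OF assms(2)] rigidD[OF assms(3)] rigidD[OF assms(4)] assms
    by (metis orient_same subsetD less_irrefl)+
  then show False using n assms(7) by (auto simp: tri_def)
qed

lemma separate_from_triangle:
  assumes "x \<in> Delta C" "y \<in> faces C" "x \<noteq> y" "p \<in> x" "q \<in> y"
  shows "\<exists>a b. (a, b) \<in> rigid C \<and> orient a b p < 0 \<and> 0 < orient a b q"
proof -
  obtain a b c where t: "x = tri a b c" "0 < orient a b c" "(a, b) \<in> rigid C" "(b, c) \<in> rigid C" "(c, a) \<in> rigid C"
    using Delta_tri[OF assms(1)] by metis
  have "q \<notin> tri a b c" using faces_disjoint[of x y] assms t by auto
  then have "orient a b q < 0 \<or> orient b c q < 0 \<or> orient c a q < 0"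
    using outside_triangle[OF t(2-5)] face_basic(3)[OF assms(2)] assms(5) by blast
  moreover have "0 < orient a b p" "0 < orient b c p" "0 < orient c a p"
    using assms(4) t(1) by (auto simp: tri_def)
  ultimately show ?thesis
    using rigid_sym[OF t(3)] rigid_sym[OF t(4)] rigid_sym[OF t(5)]
      orient_swap[of a b] orient_swap[of b c] orient_swap[of c a]
    by (metis neg_0_less_iff_less neg_less_0_iff_less)
qed

text \<open>If one face is a triangle, one of its sides separates. If both are outside the hull,
  continue the ray from a point \<open>k\<close> of \<open>C\<close> on the circle through
  \<open>p\<close> up to \<open>m\<close> on the circle: the hull edge that cuts off
  \<open>m\<close> cuts off \<open>p\<close> too, and a second face cannot share the connected cap
  behind it.\<close>

lemma separate_faces:
  assumes x: "x \<in> faces C" and y: "y \<in> faces C" and "x \<noteq> y" "p \<in> x" "q \<in> y"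
  obtains a b where "(a, b) \<in> rigid C" "orient a b p < 0" "0 < orient a b q"
proof -
  consider "x \<in> Delta C" | "y \<in> Delta C" | "x \<in> Nabla C" "y \<in> Nabla C" using x y by blast
  then show thesis
  proof cases
    case 1 then show thesis using separate_from_triangle[OF 1 y] assms that by blast
  next
    case 2
    then obtain a b where "(a, b) \<in> rigid C" "orient a b q < 0" "0 < orient a b p"
      using separate_from_triangle[OF 2 x] assms by metis
    then show thesis using that[of b a] rigid_sym orient_swap[of a b] by simp
  next
    case 3
    then have xy: "x \<in> components (disc - convex hull C)" "y \<in> components (disc - convex hull C)"
      by (simp_all add: Nabla_def)
    have pq: "p \<in> disc - convex hull C" "q \<in> disc - convex hull C"
      using in_components_subset xy assms by blast+
    have "C \<inter> circ \<noteq> {}" using hull_C nonempty_C by (metis convex_hull_eq_empty)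
    then obtain k where k: "k \<in> C" "k \<in> circ" by blast
    have kh: "k \<in> convex hull C" using k by (simp add: hull_inc)
    have "\<exists>k'. k' \<in> C \<inter> circ \<and> k' \<noteq> k"
    proof (rule ccontr)
      assume "\<not> ?thesis"
      then have "C \<inter> circ = {k}" using k by blast
      then have h: "convex hull C = {k}" by (simp add: hull_C)
      \<comment> \<open>The hull is the single point \<open>k\<close> of the circle. Removing it
        leaves the disc convex, so there is just one face outside the hull.\<close>
      have "convex (disc - {k})"
      proof (rule convexI)
        fix u v :: complex and r s :: real
        assume uv: "u \<in> disc - {k}" "v \<in> disc - {k}" and rs: "0 \<le> r" "0 \<le> s" "r + s = 1"
        then have "r *\<^sub>R u + s *\<^sub>R v \<in> closed_segment u v" unfolding in_segment
          by (intro exI[of _ s]) (simp add: eq_diff_eq[symmetric])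
        moreover have "closed_segment u v \<subseteq> disc"
          using uv convex_disc closed_segment_subset by blast
        moreover have "k \<notin> closed_segment u v"
          using circ_Int_chord[of u v k] uv k(2) by auto
        ultimately show "r *\<^sub>R u + s *\<^sub>R v \<in> disc - {k}" by auto
      qed
      then have "connected (disc - {k})" by (rule convex_connected)
      then have "x = y"
        by (rule same_component[OF xy]) (use h pq assms in auto)
      then show False using assms by blast
    qed
    then obtain k' where k': "k' \<in> C \<inter> circ" "k' \<noteq> k" by blast
    have "p \<noteq> k" using pq(1) kh by blast
    then obtain m where m: "m \<in> circ" "p \<in> closed_segment k m"
      using ray_circ[of k p] k pq circ_subset_disc by blast
    have "m \<notin> C"
    proof
      assume "m \<in> C"
      then have "closed_segment k m \<subseteq> convex hull C" using kh by (simp add: closed_segment_subset hull_inc)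
      then show False using m pq by blast
    qed
    then obtain a b where ab: "(a, b) \<in> rigid C" "a \<noteq> b" "0 < orient a b m" "convex hull C \<subseteq> {x. orient a b x \<le> 0}"
      using gap_rigid[OF m(1) _ _ k'(1), of k] k k' by blast
    \<comment> \<open>Otherwise the edge meets the way from \<open>p\<close> to \<open>m\<close> in
      a point \<open>u\<close> of \<open>C\<close>, and \<open>p\<close>, lying between
      \<open>k\<close> and \<open>u\<close>, would be in the hull.\<close>
    have pos: "0 < orient a b p"
    proof (rule ccontr)
      assume n: "\<not> ?thesis"
      have "orient a b p \<noteq> 0"
        using line_meets_disc[of a b p] rigidD[OF ab(1)] ab(2) pq hull_subset[of C convex] by blast
      then have "orient a b p < 0" using n by simp
      then obtain u where u: "u \<in> open_segment p m" "orient a b u = 0"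
        using orient_sign_change[of a b p m] ab(3) by (auto simp: mult_neg_pos)
      have "u \<in> disc"
        using u(1) pq m(1) circ_subset_disc convex_disc closed_segment_subset[of p disc m] open_closed_segment by blast
      then have "u \<in> C" using line_meets_disc[of a b u] rigidD[OF ab(1)] ab(2) u by blast
      have "between (m, k) p" "between (p, m) u"
        using m(2) open_closed_segment[OF u(1)]
        unfolding between_mem_segment by (simp_all only: closed_segment_commute)
      then have "between (k, u) p" by (rule between_trans_2)
      then have "p \<in> closed_segment k u" by (simp add: between_mem_segment)
      moreover have "closed_segment k u \<subseteq> convex hull C"
        using kh \<open>u \<in> C\<close> by (simp add: closed_segment_subset hull_inc)
      ultimately show False using pq by blast
    qed
    have "orient a b q \<noteq> 0"
      using line_meets_disc[of a b q] rigidD[OF ab(1)] ab(2) pq hull_subset[of C convex] by blast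
    moreover have "\<not> 0 < orient a b q"
    proof
      assume q: "0 < orient a b q"
      have "x = y"
      proof (rule same_component[OF xy])
        show "connected (disc \<inter> {q. 0 < orient a b q})"
          by (intro convex_connected convex_Int convex_disc convex_orient)
      qed (use ab(4) q pos pq assms in auto)
      then show False using assms by blast
    qed
    ultimately have "orient a b q < 0" by linarith
    then show thesis using that[of b a] rigid_sym[OF ab(1)] pos orient_swap[of b a] by simp
  qed
qed

end

section \<open>The triangle separating three faces\<close>

definition separates3 :: "complex set \<Rightarrow> complex set \<Rightarrow> complex set \<Rightarrow> complex set \<Rightarrow> bool" where
  "separates3 c x y z \<longleftrightarrow>
     (\<exists>X \<in> components (disc - frontier c). \<exists>Y \<in> components (disc - frontier c).
      \<exists>Z \<in> components (disc - frontier c).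
        X \<noteq> Y \<and> Y \<noteq> Z \<and> X \<noteq> Z \<and> x \<subseteq> X \<and> y \<subseteq> Y \<and> z \<subseteq> Z)"

lemma separates3_rotate: "separates3 c x y z \<Longrightarrow> separates3 c y z x"
  unfolding separates3_def by metis

lemma separates3_swap: "separates3 c x y z \<Longrightarrow> separates3 c y x z"
  unfolding separates3_def by metis

text \<open>Join a common point \<open>p\<close> to \<open>a\<close>. This segment meets the chord
  \<open>b c\<close> in a point \<open>q\<close>, which is weakly left of \<open>a b\<close> as a
  point of \<open>b c\<close> but strictly right of it as a point between \<open>p\<close> and
  \<open>a\<close>.\<close>

lemma beyond_disjoint:
  assumes "a \<in> circ" "b \<in> circ" "c \<in> circ" "0 < orient a b c"
  shows "beyond a b \<inter> beyond b c = {}"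
proof (rule ccontr)
  assume "\<not> ?thesis"
  then obtain p where p: "p \<in> disc" "orient a b p < 0" "orient b c p < 0" by (auto simp: beyond_def)
  have "0 < orient b c a" using assms(4) orient_rotate[of b c a] by simp
  then obtain q where q: "q \<in> open_segment p a" "orient b c q = 0"
    using orient_sign_change[of b c p a] p by (auto simp: mult_neg_pos)
  have "q \<in> disc"
    using q(1) p(1) assms(1) circ_subset_disc closed_segment_subset[OF _ _ convex_disc] open_closed_segment by blast
  then have "q \<in> closed_segment b c"
    using line_meets_disc[of b c q] assms q(2) by force
  then have "0 \<le> orient a b q" using orient_segment_nonneg[of q b c a b] assms(4) by simp
  moreover have "0 < orient b a q"
    using orient_open_segment_pos[OF q(1), of b a] p(2) by (simp add: orient_swap[of b a])
  ultimately show False by (simp add: orient_swap[of b a])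
qed

lemma triangle_components:
  assumes "a \<in> circ" "b \<in> circ" "c \<in> circ" "0 < orient a b c"
    "X \<in> {tri a b c, beyond a b, beyond b c, beyond c a}" "X \<noteq> {}"
  shows "X \<in> components (disc - frontier (tri a b c))"
proof -
  have o: "0 < orient b c a" "0 < orient c a b"
    using assms(4) orient_rotate[of b c a] orient_rotate[of a b c] by auto
  have t: "tri b c a = tri a b c" "tri c a b = tri a b c"
    using tri_rotate[of b c a] tri_rotate[of a b c] by auto
  show ?thesis
    using assms(5,6) tri_in_components_disc[OF assms(1-4)] beyond_in_components_tri[OF assms(1-4)]
      beyond_in_components_tri[OF assms(2,3,1) o(1)] beyond_in_components_tri[OF assms(3,1,2) o(2)]
    unfolding t by auto
qed

lemma not_separates3_beyond:
  assumes "a \<in> circ" "b \<in> circ" "c \<in> circ" "0 < orient a b c"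
    "x \<subseteq> beyond a b" "y \<subseteq> beyond a b" "x \<noteq> {}" "y \<noteq> {}"
  shows "\<not> separates3 (tri a b c) x y z"
proof
  assume "separates3 (tri a b c) x y z"
  then obtain X Y where XY: "X \<in> components (disc - frontier (tri a b c))"
    "Y \<in> components (disc - frontier (tri a b c))" "X \<noteq> Y" "x \<subseteq> X" "y \<subseteq> Y"
    unfolding separates3_def by blast
  have B: "beyond a b \<in> components (disc - frontier (tri a b c))"
    using assms by (intro triangle_components) auto
  have "X = beyond a b" "Y = beyond a b"
    using components_eq[OF XY(1) B] components_eq[OF XY(2) B] XY assms by blast+
  then show False using XY(3) by simp
qed

lemma separates3_triangle:
  assumes t: "a \<in> circ" "b \<in> circ" "c \<in> circ" "0 < orient a b c"
    and x: "x \<subseteq> beyond a b" "x \<noteq> {}" "y \<noteq> {}" "z \<noteq> {}"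
    and y: "y = tri a b c \<or> y \<subseteq> beyond b c \<or> y \<subseteq> beyond c a"
    and z: "z = tri a b c \<or> z \<subseteq> beyond b c \<or> z \<subseteq> beyond c a"
    and "\<not> (y = tri a b c \<and> z = tri a b c)" "\<not> (y \<subseteq> beyond b c \<and> z \<subseteq> beyond b c)"
    "\<not> (y \<subseteq> beyond c a \<and> z \<subseteq> beyond c a)"
  shows "separates3 (tri a b c) x y z"
proof -
  have o: "0 < orient b c a" "0 < orient c a b"
    using t(4) orient_rotate[of b c a] orient_rotate[of a b c] by auto
  have d: "beyond a b \<inter> beyond b c = {}" "beyond b c \<inter> beyond c a = {}" "beyond c a \<inter> beyond a b = {}"
    "tri a b c \<inter> beyond a b = {}" "tri a b c \<inter> beyond b c = {}" "tri a b c \<inter> beyond c a = {}"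
    using beyond_disjoint[OF t] beyond_disjoint[OF t(2,3,1) o(1)] beyond_disjoint[OF t(3,1,2) o(2)]
    by (auto simp: tri_def beyond_def)
  have key: "separates3 (tri a b c) x y z" if Y: "Y \<in> {tri a b c, beyond b c, beyond c a}" "y \<subseteq> Y"
    and Z: "Z \<in> {tri a b c, beyond b c, beyond c a}" "z \<subseteq> Z" and YZ: "Y \<noteq> Z" for Y Z
  proof -
    have ne: "beyond a b \<noteq> {}" "Y \<noteq> {}" "Z \<noteq> {}" using x Y Z by auto
    have "beyond a b \<inter> Y = {}" "beyond a b \<inter> Z = {}" using d Y Z by auto
    then have "beyond a b \<noteq> Y" "beyond a b \<noteq> Z" using ne by auto
    moreover have "beyond a b \<in> components (disc - frontier (tri a b c))"
      "Y \<in> components (disc - frontier (tri a b c))" "Z \<in> components (disc - frontier (tri a b c))"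
      using triangle_components[OF t, of "beyond a b"] triangle_components[OF t, of Y]
        triangle_components[OF t, of Z] ne Y(1) Z(1) by auto
    ultimately show ?thesis unfolding separates3_def using x(1) Y(2) Z(2) YZ by blast
  qed
  have ne: "\<not> y \<subseteq> beyond b c \<or> beyond b c \<noteq> {}" "\<not> y \<subseteq> beyond c a \<or> beyond c a \<noteq> {}"
    "\<not> z \<subseteq> beyond b c \<or> beyond b c \<noteq> {}" "\<not> z \<subseteq> beyond c a \<or> beyond c a \<noteq> {}"
    using x by auto
  have tn: "tri a b c \<noteq> {}" using tri_nonempty t(4) by blast
  have tn': "tri a b c \<noteq> beyond b c" "tri a b c \<noteq> beyond c a"
    using d(5,6) tn by auto
  have yz: "beyond b c \<noteq> beyond c a" if "beyond b c \<noteq> {}" using d(2) that by auto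
  from y z show ?thesis
  proof (elim disjE)
    assume "y = tri a b c" "z \<subseteq> beyond b c" then show ?thesis using key[of "tri a b c" "beyond b c"] tn' by simp
  next
    assume "y = tri a b c" "z \<subseteq> beyond c a" then show ?thesis using key[of "tri a b c" "beyond c a"] tn' by simp
  next
    assume "y \<subseteq> beyond b c" "z = tri a b c" then show ?thesis using key[of "beyond b c" "tri a b c"] tn' by simp
  next
    assume "y \<subseteq> beyond c a" "z = tri a b c" then show ?thesis using key[of "beyond c a" "tri a b c"] tn' by simp
  next
    assume "y \<subseteq> beyond b c" "z \<subseteq> beyond c a" then show ?thesis using key[of "beyond b c" "beyond c a"] ne(1) yz by blast
  next
    assume "y \<subseteq> beyond c a" "z \<subseteq> beyond b c" then show ?thesis using key[of "beyond c a" "beyond b c"] ne(3) yz by blast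
  qed (use assms in auto)
qed

context tri1_set begin

text \<open>The vertices are renamed cyclically so that \<open>u v\<close> is the side behind which
  \<open>f\<close> lies.\<close>

lemma Delta_beyond:
  assumes c: "c \<in> Delta C" and f: "f \<in> faces C" "f \<noteq> c"
  obtains u v w where "c = tri u v w" "0 < orient u v w" "u \<in> circ" "v \<in> circ" "w \<in> circ" "f \<subseteq> beyond u v"
    "(u, v) \<in> rigid C" "(v, w) \<in> rigid C" "(w, u) \<in> rigid C"
proof -
  obtain a b d where t: "c = tri a b d" "0 < orient a b d" "(a, b) \<in> rigid C" "(b, d) \<in> rigid C" "(d, a) \<in> rigid C"
    "a \<in> circ" "b \<in> circ" "d \<in> circ"
    using Delta_tri[OF c] by metis
  obtain p where p: "p \<in> f" using face_basic(1)[OF f(1)] by auto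
  have sub: "f \<subseteq> disc" using face_basic(3)[OF f(1)] by auto
  have "p \<notin> c" using faces_disjoint[OF f(1) _ f(2)] c p by blast
  then have out: "orient a b p < 0 \<or> orient b d p < 0 \<or> orient d a p < 0"
    using outside_triangle[OF t(2-5)] face_basic(3)[OF f(1)] p t(1) by blast
  have bey: "f \<subseteq> beyond u v" if "(u, v) \<in> rigid C" "orient u v p < 0" for u v
  proof -
    have "u \<noteq> v" using that by auto
    then have "\<forall>q\<in>f. orient u v q < 0"
      using face_one_side[OF f(1), of u v] rigidD[OF that(1)] that(2) p by (meson not_less_iff_gr_or_eq)
    then show ?thesis using sub by (auto simp: beyond_def)
  qed
  have o: "0 < orient b d a" "0 < orient d a b"
    using t(2) orient_rotate[of b d a] orient_rotate[of a b d] by auto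
  from out show thesis
  proof (elim disjE)
    assume "orient a b p < 0" then show thesis using that[of a b d] bey[OF t(3)] t by blast
  next
    assume "orient b d p < 0"
    then show thesis using that[of b d a] bey[OF t(4)] t o tri_rotate[of b d a] by simp
  next
    assume "orient d a p < 0"
    then show thesis using that[of d a b] bey[OF t(5)] t o tri_rotate[of a b d] by simp
  qed
qed

text \<open>With \<open>c'\<close> behind \<open>u v\<close> and \<open>c\<close> behind
  \<open>u' v'\<close>, the part of the disc on the near side of \<open>u v\<close> is entirely
  behind \<open>u' v'\<close>. So each of three faces is in one of these two caps, and two of them
  share one; the triangle owning that cap does not separate them.\<close>

lemma separating_triangle_unique:
  assumes f: "x \<in> faces C" "y \<in> faces C" "z \<in> faces C"
    and c: "c \<in> Delta C" "separates3 c x y z" and c': "c' \<in> Delta C" "separates3 c' x y z"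
  shows "c = c'"
proof (rule ccontr)
  assume ne: "c \<noteq> c'"
  obtain u v w where t: "c = tri u v w" "0 < orient u v w" "u \<in> circ" "v \<in> circ" "w \<in> circ" "c' \<subseteq> beyond u v"
    "(u, v) \<in> rigid C"
    using Delta_beyond[OF c(1), of c'] c'(1) ne by (metis UnI1)
  obtain u' v' w' where t': "c' = tri u' v' w'" "0 < orient u' v' w'" "u' \<in> circ" "v' \<in> circ" "w' \<in> circ"
    "c \<subseteq> beyond u' v'" using Delta_beyond[OF c'(1), of c] c(1) ne by (metis UnI1)
  have cl: "closure c' \<subseteq> {q. orient u v q \<le> 0}"
    using t(6) by (intro closure_minimal closed_Collect_le continuous_intros) (auto simp: beyond_def)
  define P where "P = disc \<inter> {q. 0 < orient u v q}"
  have "closed_segment u' v' \<subseteq> closure c'"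
    unfolding t'(1) closure_tri[OF t'(2)] by (intro closed_segment_subset hull_inc) auto
  then have dis: "P \<inter> closed_segment u' v' = {}" using cl by (force simp: P_def)
  have "u' \<noteq> v'" using t'(2) by auto
  then have os: "(\<forall>q\<in>P. 0 < orient u' v' q) \<or> (\<forall>q\<in>P. orient u' v' q < 0)"
    using dis t' by (intro one_side) (auto simp: P_def intro!: convex_connected convex_Int convex_disc convex_orient)
  obtain q where q: "q \<in> c" using face_basic(1)[of c] c(1) by blast
  then have "q \<in> P" using t tri_subset_disc(3)[of u v w] by (auto simp: P_def tri_def)
  moreover have "orient u' v' q < 0" using q t'(6) by (auto simp: beyond_def)
  ultimately have "\<forall>q\<in>P. orient u' v' q < 0" using os by (meson not_less_iff_gr_or_eq)
  then have PB: "P \<subseteq> beyond u' v'" by (auto simp: P_def beyond_def)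
  have "u \<noteq> v" using t(2) by auto
  have side: "f \<subseteq> beyond u v \<or> f \<subseteq> beyond u' v'" if "f \<in> faces C" for f
  proof -
    have "f \<subseteq> disc" using face_basic(3)[OF that] by blast
    then have "f \<subseteq> P \<or> f \<subseteq> beyond u v"
      using face_one_side[OF that rigidD(1,2)[OF t(7)] \<open>u \<noteq> v\<close> rigidD(3)[OF t(7)]]
      unfolding P_def beyond_def by blast
    then show ?thesis using PB by blast
  qed
  note no = not_separates3_beyond[OF t(3-5,2)] and no' = not_separates3_beyond[OF t'(3-5,2)]
  note ne = face_basic(1)[OF f(1)] face_basic(1)[OF f(2)] face_basic(1)[OF f(3)]
  have s: "separates3 c x y z" "separates3 c y z x" "separates3 c z x y"
    using c separates3_rotate by blast+
  have s': "separates3 c' x y z" "separates3 c' y z x" "separates3 c' z x y"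
    using c' separates3_rotate by blast+
  show False
    using side[OF f(1)] side[OF f(2)] side[OF f(3)] s s' ne
      no[of x y z] no[of y z x] no[of z x y] no'[of x y z] no'[of y z x] no'[of z x y]
    unfolding t(1) t'(1) by blast
qed

end

section \<open>Closed families of chords, nearest and limiting chords\<close>

lemma compact_chords:
  assumes "closed L" "L \<subseteq> circ \<times> circ" shows "compact (chords L)"
proof -
  have cL: "compact L"
    using compact_Int_closed[OF compact_Times[OF compact_circ compact_circ] assms(1)] assms(2)
    by (simp add: Int_absorb1)
  have "chords L = (\<lambda>(s, e). (1 - s) *\<^sub>R fst e + s *\<^sub>R snd e) ` ({0..1::real} \<times> L)"
    unfolding chords_def in_segment by (force simp: in_segment image_iff)
  moreover have "compact \<dots>"
    unfolding case_prod_unfold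
    by (intro compact_continuous_image continuous_intros compact_Times cL) auto
  ultimately show ?thesis by simp
qed

lemma ncr_closure:
  assumes "ncr L" shows "ncr (closure L)"
proof -
  let ?S = "{p :: (complex \<times> complex) \<times> (complex \<times> complex).
    0 \<le> orient (fst (fst p)) (snd (fst p)) (fst (snd p)) * orient (fst (fst p)) (snd (fst p)) (snd (snd p))}"
  have "closed ?S" by (intro closed_Collect_le continuous_intros)
  moreover have "L \<times> L \<subseteq> ?S" using ncrD[OF assms] by auto
  ultimately have "closure (L \<times> L) \<subseteq> ?S" by (intro closure_minimal)
  then have S: "closure L \<times> closure L \<subseteq> ?S" by (simp only: closure_Times)
  show ?thesis unfolding ncr_def
  proof clarify
    fix a b c d assume "(a, b) \<in> closure L" "(c, d) \<in> closure L"
    then have "((a, b), (c, d)) \<in> ?S" using S by blast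
    then show "0 \<le> orient a b c * orient a b d" by simp
  qed
qed

lemma nearest_crossing:
  assumes "closed L" "L \<subseteq> circ \<times> circ" "closed_segment p q \<inter> chords L \<noteq> {}"
  obtains z a b where "(a, b) \<in> L" "z \<in> closed_segment p q" "z \<in> closed_segment a b"
    "\<And>z'. z' \<in> closed_segment p q \<Longrightarrow> z' \<in> chords L \<Longrightarrow> dist q z \<le> dist q z'"
proof -
  have "closed (closed_segment p q \<inter> chords L)"
    using compact_chords[OF assms(1,2)] by (simp add: closed_Int compact_imp_closed)
  then obtain z where z: "z \<in> closed_segment p q \<inter> chords L"
    "\<And>z'. z' \<in> closed_segment p q \<inter> chords L \<Longrightarrow> dist q z \<le> dist q z'"
    using distance_attains_inf[of "closed_segment p q \<inter> chords L" q] assms(3) by blast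
  then obtain a b where "(a, b) \<in> L" "z \<in> closed_segment a b" by (auto simp: chords_def)
  then show thesis using that z by blast
qed

lemma dist_open_segment_less:
  fixes q z z' :: complex
  assumes "z' \<in> open_segment z q" shows "dist q z' < dist q z"
  using assms dist_in_open_segment[of z' z q] by (simp add: dist_commute)

text \<open>A family for \<open>C\<close> prepared for extremal arguments: closed, so that nearest
  and limiting chords belong to it, and containing every rigid chord, so that the sides of the
  triangles do.\<close>

locale chord_set = tri1_set +
  fixes M :: "(complex \<times> complex) set"
  assumes closed_M: "closed M" and M_circ: "M \<subseteq> circ \<times> circ" and ncr_M: "ncr M"
    and sym_M: "(a, b) \<in> M \<Longrightarrow> (b, a) \<in> M" and rigid_M: "rigid C \<subseteq> M" and chords_M: "chords M = C"
begin

lemma M_segment: "(a, b) \<in> M \<Longrightarrow> closed_segment a b \<subseteq> C"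
  using chords_M by (auto simp: chords_def)

lemma M_orient_nonzero:
  assumes "(a, b) \<in> M" "a \<noteq> b" "p \<in> disc" "p \<notin> C" shows "orient a b p \<noteq> 0"
  using line_meets_disc[of a b p] M_segment[OF assms(1)] M_circ assms by auto

lemma M_same_chord:
  assumes "(a, b) \<in> M" "(c, d) \<in> M" "q \<in> closed_segment a b" "q \<in> closed_segment c d" "q \<notin> circ"
  shows "{a, b} = {c, d}"
  using ncr_inter[of a b c d q] ncrD[OF ncr_M assms(1,2)] assms M_circ by blast

end

text \<open>Betweenness is equality in the triangle inequality, which is a closed condition.\<close>

lemma closed_chord_incidence:
  "closed {p :: complex \<times> (complex \<times> complex). fst p \<in> closed_segment (fst (snd p)) (snd (snd p))}"
proof -
  have "{p :: complex \<times> (complex \<times> complex). fst p \<in> closed_segment (fst (snd p)) (snd (snd p))}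
      = {p. dist (fst (snd p)) (snd (snd p)) = dist (fst (snd p)) (fst p) + dist (fst p) (snd (snd p))}"
    by (auto simp: between_mem_segment[symmetric] between)
  moreover have "closed \<dots>" by (intro closed_Collect_eq continuous_intros)
  ultimately show ?thesis by simp
qed

lemma chord_limit:
  assumes "\<And>n. z n \<in> closed_segment (a n) (b n)" "z \<longlonglongrightarrow> z'" "a \<longlonglongrightarrow> a'" "b \<longlonglongrightarrow> (b'::complex)"
  shows "z' \<in> closed_segment a' b'"
proof -
  have "(\<lambda>n. (z n, (a n, b n))) \<longlonglongrightarrow> (z', (a', b'))" using assms by (intro tendsto_Pair)
  then have "(z', (a', b')) \<in> {p. fst p \<in> closed_segment (fst (snd p)) (snd (snd p))}"
    by (rule closed_sequentially[OF closed_chord_incidence, rotated]) (use assms in auto)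
  then show ?thesis by simp
qed

context chord_set begin

lemma compact_M: "compact M"
  using compact_Int_closed[OF compact_Times[OF compact_circ compact_circ] closed_M] M_circ
  by (simp add: Int_absorb1)

text \<open>By compactness the chords through \<open>z n\<close> converge along a subsequence to a
  chord through \<open>q\<close>. Off the circle only one chord passes through \<open>q\<close>, up
  to order, and the side of \<open>p\<close> settles the order.\<close>

lemma chords_converge:
  assumes "q \<in> closed_segment a b" "(a, b) \<in> M" "q \<notin> circ" "a \<noteq> b"
    and z: "\<And>n. z n \<in> C" "z \<longlonglongrightarrow> q" and p: "0 < orient a b p"
  obtains r e f where "strict_mono (r :: nat \<Rightarrow> nat)" "\<And>n. (e n, f n) \<in> M"
    "\<And>n. z (r n) \<in> closed_segment (e n) (f n)" "e \<longlonglongrightarrow> a" "f \<longlonglongrightarrow> b"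
proof -
  have "\<exists>g. g \<in> M \<and> z n \<in> closed_segment (fst g) (snd g) \<and> 0 \<le> orient (fst g) (snd g) p" for n
  proof -
    obtain e f where ef: "(e, f) \<in> M" "z n \<in> closed_segment e f"
      using z(1)[of n] unfolding chords_M[symmetric] by (auto simp: chords_def)
    show ?thesis
    proof (cases "0 \<le> orient e f p")
      case True then show ?thesis using ef by (intro exI[of _ "(e, f)"]) auto
    next
      case False then show ?thesis using ef sym_M orient_swap[of e f p]
        by (intro exI[of _ "(f, e)"]) (auto simp: closed_segment_commute)
    qed
  qed
  then obtain g where g: "\<And>n. g n \<in> M" "\<And>n. z n \<in> closed_segment (fst (g n)) (snd (g n))"
    "\<And>n. 0 \<le> orient (fst (g n)) (snd (g n)) p" by metis
  obtain l r where l: "l \<in> M" "strict_mono r" "(g \<circ> r) \<longlonglongrightarrow> l"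
    using compact_M g(1) unfolding compact_def by metis
  have t: "(\<lambda>n. fst (g (r n))) \<longlonglongrightarrow> fst l" "(\<lambda>n. snd (g (r n))) \<longlonglongrightarrow> snd l"
    using tendsto_fst[OF l(3)] tendsto_snd[OF l(3)] by (auto simp: o_def)
  have "(\<lambda>n. z (r n)) \<longlonglongrightarrow> q" using LIMSEQ_subseq_LIMSEQ[OF z(2) l(2)] by (simp add: o_def)
  then have ql: "q \<in> closed_segment (fst l) (snd l)"
    by (rule chord_limit[OF g(2) _ t])
  then have e: "{a, b} = {fst l, snd l}"
    using M_same_chord[OF assms(2), of "fst l" "snd l" q] l(1) assms by simp
  have "0 \<le> orient (fst l) (snd l) p"
    by (rule tendsto_lowerbound[OF tendsto_orient[OF t tendsto_const]]) (use g(3) in auto)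
  then have "fst l = a" "snd l = b"
    using e p orient_swap[of a b p] by (auto simp: doubleton_eq_iff)
  then show thesis using that[of r "\<lambda>n. fst (g (r n))" "\<lambda>n. snd (g (r n))"] l(2) g t by simp
qed

text \<open>Of all chords separating \<open>px\<close> from both \<open>py\<close> and \<open>pz\<close>, the one crossing the segment from \<open>px\<close>
  to \<open>py\<close> closest to \<open>py\<close> bounds a triangle of \<open>Delta C\<close> on its far side, since chords accumulating
  there would be closer; this triangle separates the three faces.\<close>

lemma separating_triangle_of_chord:
  assumes x: "x \<in> faces C" and y: "y \<in> faces C" and z: "z \<in> faces C"
    and yz: "y \<noteq> z" and p: "px \<in> x" "py \<in> y" "pz \<in> z" "norm px < 1 / (2 * pi)" "norm py < 1 / (2 * pi)"
    and ab0: "(a0, b0) \<in> M" "orient a0 b0 px < 0" "0 < orient a0 b0 py" "0 < orient a0 b0 pz"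
  shows "\<exists>c\<in>Delta C. separates3 c x y z"
proof -
  have pd: "px \<in> disc" "py \<in> disc" "pz \<in> disc" and pC: "px \<notin> C" "py \<notin> C" "pz \<notin> C"
    using face_basic(3)[OF x] face_basic(3)[OF y] face_basic(3)[OF z] p by auto
  have seg_disc: "closed_segment px py \<subseteq> disc" using pd convex_disc by (simp add: closed_segment_subset)
  have seg_ball: "norm q < 1 / (2 * pi)" if "q \<in> closed_segment px py" for q
    using closed_segment_subset[of px "ball 0 (1/(2*pi))" py] p(4,5) that by (auto simp: subset_iff)
  \<comment> \<open>Weak inequalities make \<open>S\<close> closed. They are strict for every
    nondegenerate chord in \<open>S\<close>, as the three points are outside
    \<open>C\<close>.\<close>
  define S where "S = {e \<in> M. orient (fst e) (snd e) px \<le> 0 \<and> 0 \<le> orient (fst e) (snd e) py \<and> 0 \<le> orient (fst e) (snd e) pz}"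
  have "S = M \<inter> {e. orient (fst e) (snd e) px \<le> 0} \<inter> {e. 0 \<le> orient (fst e) (snd e) py} \<inter> {e. 0 \<le> orient (fst e) (snd e) pz}"
    by (auto simp: S_def)
  then have S: "closed S" "S \<subseteq> circ \<times> circ"
    using M_circ closed_M by (auto simp: S_def intro!: closed_Int closed_Collect_le continuous_intros)
  have cross: "\<exists>u\<in>open_segment v w. u \<in> closed_segment e f"
    if "(e, f) \<in> M" "orient e f v < 0" "0 < orient e f w" "v \<in> disc" "w \<in> disc" for e f v w
  proof -
    have "orient e f v * orient e f w < 0" using that by (intro mult_neg_pos)
    then obtain u where u: "u \<in> open_segment v w" "orient e f u = 0"
      using orient_sign_change by blast
    have "u \<in> disc" using u(1) that(4,5) closed_segment_subset[OF _ _ convex_disc] open_closed_segment by blast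
    moreover have "e \<noteq> f" using that by auto
    ultimately show ?thesis using u line_meets_disc[of e f u] M_circ that(1) by blast
  qed
  obtain u where u: "u \<in> open_segment px py" "u \<in> closed_segment a0 b0"
    using cross[OF ab0(1-3) pd(1,2)] by blast
  have "(a0, b0) \<in> S" using ab0 by (simp add: S_def)
  then have "u \<in> closed_segment px py \<inter> chords S"
    using u open_closed_segment by (auto simp: chords_def)
  then obtain q a b where ab: "(a, b) \<in> S" and q: "q \<in> closed_segment px py" "q \<in> closed_segment a b"
    and near: "\<And>q'. q' \<in> closed_segment px py \<Longrightarrow> q' \<in> chords S \<Longrightarrow> dist py q \<le> dist py q'"
    using nearest_crossing[OF S, of px py] by blast
  have abM: "(a, b) \<in> M" using ab by (simp add: S_def)
  have circ: "a \<in> circ" "b \<in> circ" using abM M_circ by auto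
  have qc: "q \<notin> circ" using seg_ball[OF q(1)] by (auto simp: circ_def)
  then have ne: "a \<noteq> b" using q(2) circ by auto
  have sgn: "orient a b px < 0" "0 < orient a b py" "0 < orient a b pz"
    using M_orient_nonzero[OF abM ne] pd pC ab by (auto simp: S_def order_less_le)
  have qC: "q \<in> C" using M_segment[OF abM] q(2) by blast
  then have qo: "q \<in> open_segment px py" "q \<in> open_segment a b"
    using q pC qc circ by (auto simp: open_segment_def)
  have q0: "orient a b q = 0" using orient_on_segment[OF q(2)] .
  have closer: "dist py q' < dist py q \<and> q' \<in> closed_segment px py" if "q' \<in> open_segment q py" for q'
  proof -
    have "q' \<in> closed_segment px py"
      using that q(1) by (meson closed_segment_subset convex_closed_segment ends_in_segment(2) open_closed_segment subsetD)
    then show ?thesis using dist_open_segment_less[OF that] by simp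
  qed
  define \<gamma> where "\<gamma> s = (1 - s) *\<^sub>R q + s *\<^sub>R py" for s
  have qpy: "q \<noteq> py" using qC pC by auto
  have \<gamma>: "\<gamma> s \<in> open_segment q py" if "0 < s" "s < 1" for s
    using that qpy by (auto simp: \<gamma>_def in_segment)
  have \<gamma>lim: "(\<gamma> \<longlongrightarrow> q) (at_right 0)"
  proof -
    have "((\<lambda>s. (1 - s) *\<^sub>R q + s *\<^sub>R py) \<longlongrightarrow> (1 - 0) *\<^sub>R q + 0 *\<^sub>R py) (at_right 0)" by (intro tendsto_intros)
    then show ?thesis by (simp add: \<gamma>_def[abs_def])
  qed
  have ev1: "eventually (\<lambda>s. s \<in> {0<..<1}) (at_right (0::real))"
    by (rule eventually_at_right_real) simp
  \<comment> \<open>Were points of \<open>C\<close> to accumulate at \<open>q\<close> from the side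
    of \<open>py\<close>, their chords would converge to \<open>a b\<close> and inherit its strict
    signs. They would belong to \<open>S\<close> and cross the segment nearer to
    \<open>py\<close>.\<close>
  have evC: "eventually (\<lambda>s. \<gamma> s \<notin> C) (at_right 0)"
  proof (rule ccontr)
    assume "\<not> ?thesis"
    then have fr: "frequently (\<lambda>s. \<gamma> s \<in> C) (at_right 0)" by (simp add: frequently_def)
    have "\<exists>s. 0 < s \<and> s < inverse (real (Suc n)) \<and> \<gamma> s \<in> C" for n
    proof -
      have "eventually (\<lambda>s. s \<in> {0<..<inverse (real (Suc n))}) (at_right (0::real))"
        by (rule eventually_at_right_real) simp
      then have "frequently (\<lambda>s. \<gamma> s \<in> C \<and> s \<in> {0<..<inverse (real (Suc n))}) (at_right 0)"
        by (rule frequently_eventually_frequently[OF fr])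
      then show ?thesis using frequently_ex by fastforce
    qed
    then obtain s where s: "\<And>n. 0 < s n" "\<And>n. s n < inverse (real (Suc n))" "\<And>n. \<gamma> (s n) \<in> C" by metis
    have s1: "s n < 1" for n
    proof -
      have "inverse (real (Suc n)) \<le> 1" by (simp add: field_simps)
      then show ?thesis using s(2)[of n] by linarith
    qed
    have "s \<longlonglongrightarrow> 0"
    proof (rule tendsto_sandwich[of "\<lambda>_. 0" _ _ "\<lambda>n. inverse (real (Suc n))"])
      show "(\<lambda>n. inverse (real (Suc n))) \<longlonglongrightarrow> 0" by (rule LIMSEQ_inverse_real_of_nat)
    qed (use s in \<open>auto intro!: always_eventually less_imp_le\<close>)
    then have "(\<lambda>n. \<gamma> (s n)) \<longlonglongrightarrow> (1 - 0) *\<^sub>R q + 0 *\<^sub>R py" unfolding \<gamma>_def by (intro tendsto_intros)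
    then have "(\<lambda>n. \<gamma> (s n)) \<longlonglongrightarrow> q" by simp
    then obtain r e f where ef: "strict_mono (r :: nat \<Rightarrow> nat)" "\<And>n. (e n, f n) \<in> M"
      "\<And>n. \<gamma> (s (r n)) \<in> closed_segment (e n) (f n)" "e \<longlonglongrightarrow> a" "f \<longlonglongrightarrow> b"
      using chords_converge[OF q(2) abM qc ne, of "\<lambda>n. \<gamma> (s n)" py] s(3) sgn(2) by metis
    have "eventually (\<lambda>n. orient (e n) (f n) px < 0) sequentially"
      "eventually (\<lambda>n. 0 < orient (e n) (f n) py) sequentially"
      "eventually (\<lambda>n. 0 < orient (e n) (f n) pz) sequentially"
      using order_tendstoD(2)[OF tendsto_orient[OF ef(4,5) tendsto_const] sgn(1)]
        order_tendstoD(1)[OF tendsto_orient[OF ef(4,5) tendsto_const] sgn(2)]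
        order_tendstoD(1)[OF tendsto_orient[OF ef(4,5) tendsto_const] sgn(3)] by auto
    then have "eventually (\<lambda>n. (e n, f n) \<in> S) sequentially"
      by eventually_elim (use ef(2) in \<open>auto simp: S_def\<close>)
    then obtain n where n: "(e n, f n) \<in> S" using eventually_happens sequentially_bot by blast
    then have "\<gamma> (s (r n)) \<in> chords S" using ef(3) by (auto simp: chords_def)
    then show False using near closer[OF \<gamma>[OF s(1) s1]] by fastforce
  qed
  \<comment> \<open>If all of \<open>C\<close> on the circle were weakly right of
    \<open>a b\<close>, then \<open>y\<close> and \<open>z\<close> would share the cap outside the
    hull. A vertex \<open>k\<close> on the left gives a triangle \<open>a b k\<close> in the hull
    that contains the path just after \<open>q\<close>.\<close>
  have evH: "eventually (\<lambda>s. \<gamma> s \<in> convex hull C) (at_right 0)"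
  proof -
    have "\<exists>k\<in>C \<inter> circ. 0 < orient a b k"
    proof (rule ccontr)
      assume "\<not> ?thesis"
      then have h: "convex hull C \<subseteq> {q. orient a b q \<le> 0}"
        unfolding hull_C by (intro hull_minimal convex_orient) force
      have nab: "f \<in> components (disc - convex hull C)" if f: "f \<in> faces C" "pf \<in> f" "0 < orient a b pf" for f pf
      proof -
        have "pf \<notin> convex hull C" using h that(3) by force
        then have "f \<notin> Delta C" using in_components_subset f(2) unfolding Delta_def by blast
        then show ?thesis using f(1) by (simp add: Nabla_def)
      qed
      have "y = z"
      proof (rule same_component[OF nab[OF y p(2) sgn(2)] nab[OF z p(3) sgn(3)]])
        show "connected (disc \<inter> {q. 0 < orient a b q})"
          by (intro convex_connected convex_Int convex_disc convex_orient)
      qed (use h p pd sgn in auto)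
      then show False using yz by simp
    qed
    then obtain k where k: "k \<in> C" "k \<in> circ" "0 < orient a b k" by blast
    have "0 < orient b k a" "0 < orient k a b"
      using k(3) orient_rotate[of b k a] orient_rotate[of a b k] by auto
    then have "0 < orient b k q" "0 < orient k a q"
      using orient_open_segment_pos[OF qo(2), of b k] orient_open_segment_pos[OF qo(2), of k a] by auto
    then have "eventually (\<lambda>s. 0 < orient b k (\<gamma> s)) (at_right 0)" "eventually (\<lambda>s. 0 < orient k a (\<gamma> s)) (at_right 0)"
      using order_tendstoD(1)[OF tendsto_orient[OF tendsto_const tendsto_const \<gamma>lim]] by blast+
    moreover have "eventually (\<lambda>s. 0 < orient a b (\<gamma> s)) (at_right 0)"
      using ev1 by eventually_elim (use q0 sgn in \<open>simp add: \<gamma>_def orient_convex\<close>)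
    ultimately have "eventually (\<lambda>s. \<gamma> s \<in> tri a b k) (at_right 0)"
      by eventually_elim (simp add: tri_def)
    moreover have "tri a b k \<subseteq> convex hull C"
      using tri_subset_hull[OF k(3)] hull_mono[of "{a, b, k}" C convex] M_segment[OF abM] k(1) by auto
    ultimately show ?thesis by (auto elim: eventually_mono)
  qed
  have "eventually (\<lambda>s. \<gamma> s \<in> convex hull C - C \<and> s \<in> {0<..<1}) (at_right 0)"
    using evC evH ev1 by eventually_elim auto
  then obtain \<delta> where \<delta>: "0 < \<delta>" "\<And>s. 0 < s \<Longrightarrow> s < \<delta> \<Longrightarrow> \<gamma> s \<in> convex hull C - C \<and> s \<in> {0<..<1}"
    unfolding eventually_at_right[OF zero_less_one] by auto
  \<comment> \<open>Just after \<open>q\<close> the path stays in one triangle \<open>t\<close>. So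
    \<open>q\<close> is on a side of \<open>t\<close>, and this side is \<open>a b\<close>, the only
    chord through \<open>q\<close>.\<close>
  define W where "W = \<gamma> ` {0<..<\<delta>}"
  have W: "connected W" "W \<subseteq> convex hull C - C" "\<gamma> (\<delta> / 2) \<in> W"
  proof -
    show "connected W" unfolding W_def \<gamma>_def
      by (intro connected_continuous_image continuous_intros) auto
    show "W \<subseteq> convex hull C - C" using \<delta>(2) unfolding W_def by auto
    show "\<gamma> (\<delta> / 2) \<in> W" unfolding W_def using \<delta>(1) by auto
  qed
  then have "\<gamma> (\<delta> / 2) \<in> \<Union>(Delta C)" unfolding Delta_def Union_components by blast
  then obtain t where t: "t \<in> Delta C" "\<gamma> (\<delta> / 2) \<in> t" by blast
  have Wt: "W \<subseteq> t"
    by (rule components_maximal[OF t(1)[unfolded Delta_def] W(1,2)]) (use t(2) W(3) in blast)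
  have qt: "q \<in> closure t"
  proof -
    have "\<gamma> s \<in> closure t" if "0 < s" "s < \<delta>" for s
      by (rule subsetD[OF closure_subset]) (use Wt that in \<open>auto simp: W_def image_subset_iff\<close>)
    then have "eventually (\<lambda>s. \<gamma> s \<in> closure t) (at_right 0)"
      unfolding eventually_at_right[OF zero_less_one] using \<delta>(1) by (intro exI[of _ \<delta>]) auto
    then show ?thesis by (intro Lim_in_closed_set[OF closed_closure _ _ \<gamma>lim]) auto
  qed
  obtain u0 v0 w0 where t0: "t = tri u0 v0 w0" "0 < orient u0 v0 w0" "(u0, v0) \<in> rigid C" "(v0, w0) \<in> rigid C" "(w0, u0) \<in> rigid C"
    "tri u0 v0 w0 \<inter> C = {}" using Delta_tri[OF t(1)] by metis
  have "q \<in> frontier t" using qt qC t0(1,6) by (auto simp: frontier_def open_tri interior_open)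
  then have "q \<in> closed_segment u0 v0 \<or> q \<in> closed_segment v0 w0 \<or> q \<in> closed_segment w0 u0"
    unfolding t0(1) frontier_tri[OF t0(2)] by blast
  then obtain u v w where uvw: "t = tri u v w" "0 < orient u v w" "(u, v) \<in> rigid C" "(v, w) \<in> rigid C" "(w, u) \<in> rigid C"
    "q \<in> closed_segment u v"
  proof (elim disjE)
    assume "q \<in> closed_segment u0 v0" then show thesis using that[of u0 v0 w0] t0 by blast
  next
    assume "q \<in> closed_segment v0 w0"
    then show thesis using that[of v0 w0 u0] t0 tri_rotate[of v0 w0 u0] orient_rotate[of v0 w0 u0] by simp
  next
    assume "q \<in> closed_segment w0 u0"
    then show thesis using that[of w0 u0 v0] t0 tri_rotate[of u0 v0 w0] orient_rotate[of u0 v0 w0] by simp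
  qed
  have "{u, v} = {a, b}" using M_same_chord[OF _ abM uvw(6) q(2) qc] uvw(3) rigid_M by blast
  moreover have "0 < orient u v (\<gamma> (\<delta> / 2))" using t(2) uvw(1) by (simp add: tri_def)
  moreover have "0 < orient a b (\<gamma> (\<delta> / 2))"
    using \<delta>(2)[of "\<delta> / 2"] \<delta>(1) q0 sgn(2) by (simp add: \<gamma>_def orient_convex)
  ultimately have "u = a" "v = b" using orient_swap[of a b] by (auto simp: doubleton_eq_iff)
  then have tw: "t = tri a b w" "0 < orient a b w" "(b, w) \<in> rigid C" "(w, a) \<in> rigid C" using uvw by auto
  have wc: "w \<in> circ" using rigidD[OF tw(3)] by simp
  \<comment> \<open>If both \<open>py\<close> and \<open>pz\<close> were behind another side
    \<open>e f\<close>, the reversed side \<open>f e\<close> would belong to \<open>S\<close> and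
    cross the segment nearer to \<open>py\<close> than \<open>q\<close>.\<close>
  have notboth: False if ef: "(e, f) \<in> rigid C" "0 \<le> orient a b e" "0 \<le> orient a b f"
    "0 < orient e f q" "orient e f py < 0" "orient e f pz < 0" for e f
  proof -
    have efne: "e \<noteq> f" using ef(4) by auto
    have dis: "closed_segment px q \<inter> closed_segment e f = {}"
    proof (rule ccontr)
      assume "\<not> ?thesis"
      then obtain v where v: "v \<in> closed_segment px q" "v \<in> closed_segment e f" by auto
      have "0 \<le> orient a b v" using orient_segment_nonneg[OF v(2)] ef by simp
      moreover have "v \<noteq> q" using v(2) ef(4) orient_on_segment by force
      ultimately have "v \<in> open_segment px q" using v(1) sgn(1) by (auto simp: open_segment_def)
      then have "0 < orient b a v"
        using orient_open_segment_pos[of v px q b a] sgn(1) q0 orient_swap[of b a] by simp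
      then show False using \<open>0 \<le> orient a b v\<close> orient_swap[of b a v] by simp
    qed
    have "closed_segment px q \<subseteq> disc" using seg_disc q(1) pd(1) closed_segment_subset[OF _ _ convex_disc] by blast
    then have "(\<forall>v\<in>closed_segment px q. 0 < orient e f v) \<or> (\<forall>v\<in>closed_segment px q. orient e f v < 0)"
      using dis efne rigidD[OF ef(1)] by (intro one_side) auto
    then have "0 < orient e f px" using ef(4) by (meson ends_in_segment less_asym)
    then have feS: "(f, e) \<in> S"
      using ef rigid_M rigid_sym[OF ef(1)] orient_swap[of f e] by (auto simp: S_def)
    have "q \<in> disc" using seg_disc q(1) by blast
    then obtain v where v: "v \<in> open_segment q py" "v \<in> closed_segment f e"
      using cross[of f e q py] rigid_M rigid_sym[OF ef(1)] ef orient_swap[of f e] pd by auto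
    then have "v \<in> chords S" using feS by (auto simp: chords_def)
    then show False using near closer[OF v(1)] by force
  qed
  have o: "0 < orient b w a" "0 < orient w a b"
    using tw(2) orient_rotate[of b w a] orient_rotate[of a b w] by auto
  have qpos: "0 < orient b w q" "0 < orient w a q"
    using orient_open_segment_pos[OF qo(2), of b w] orient_open_segment_pos[OF qo(2), of w a] o by auto
  have nb: "\<not> (orient b w py < 0 \<and> orient b w pz < 0)" "\<not> (orient w a py < 0 \<and> orient w a pz < 0)"
    using notboth[OF tw(3)] notboth[OF tw(4)] tw(2) qpos by auto
  have loc: "f = t \<or> f \<subseteq> beyond b w \<and> orient b w pf < 0 \<or> f \<subseteq> beyond w a \<and> orient w a pf < 0"
    if f: "f \<in> faces C" "pf \<in> f" "0 < orient a b pf" for f pf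
  proof (cases "f = t")
    case False
    have fd: "f \<subseteq> disc - C" using face_basic(3)[OF f(1)] .
    have "pf \<notin> tri a b w" using faces_disjoint[OF f(1) _ False] t(1) tw(1) f(2) by blast
    then have "orient b w pf < 0 \<or> orient w a pf < 0"
      using outside_triangle[OF tw(2) _ tw(3,4), of pf] uvw(3) \<open>u = a\<close> \<open>v = b\<close> fd f by (auto simp: subset_iff)
    moreover have "f \<subseteq> beyond e g" if "(e, g) \<in> rigid C" "orient e g pf < 0" for e g
    proof -
      have "e \<noteq> g" using that by auto
      then have "\<forall>v\<in>f. orient e g v < 0"
        using face_one_side[OF f(1) rigidD(1,2)[OF that(1)] _ rigidD(3)[OF that(1)]] that(2) f(2) by (meson less_asym)
      then show ?thesis using fd by (auto simp: beyond_def)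
    qed
    ultimately show ?thesis using tw(3,4) by blast
  qed simp
  have xb: "x \<subseteq> beyond a b"
  proof -
    have "\<forall>v\<in>x. orient a b v < 0"
      using face_one_side[OF x circ ne M_segment[OF abM]] sgn(1) p(1) by (meson less_asym)
    then show ?thesis using face_basic(3)[OF x] by (auto simp: beyond_def)
  qed
  have neg: "orient e g pf < 0" if "f \<subseteq> beyond e g" "pf \<in> f" for e g f pf using that by (auto simp: beyond_def)
  have "separates3 (tri a b w) x y z"
    by (rule separates3_triangle[OF circ wc tw(2) xb])
      (use face_basic(1)[OF x] face_basic(1)[OF y] face_basic(1)[OF z] loc[OF y p(2) sgn(2)] loc[OF z p(3) sgn(3)]
        yz nb neg[OF _ p(2)] neg[OF _ p(3)] tw(1) in auto)
  then show ?thesis using t(1) tw(1) by blast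
qed

text \<open>A rigid chord separates \<open>x\<close> from \<open>y\<close>. Whichever side
  \<open>z\<close> is on, one of \<open>x\<close> and \<open>y\<close> is separated from the other
  two faces.\<close>

lemma separating_triangle_exists:
  assumes x: "x \<in> faces C" and y: "y \<in> faces C" and z: "z \<in> faces C"
    and ne: "x \<noteq> y" "y \<noteq> z" "x \<noteq> z"
  shows "\<exists>c\<in>Delta C. separates3 c x y z"
proof -
  obtain px where px: "px \<in> x" "norm px < 1 / (2 * pi)" using face_point[OF x] .
  obtain py where py: "py \<in> y" "norm py < 1 / (2 * pi)" using face_point[OF y] .
  obtain pz where pz: "pz \<in> z" "norm pz < 1 / (2 * pi)" using face_point[OF z] .
  obtain a b where ab: "(a, b) \<in> rigid C" "orient a b px < 0" "0 < orient a b py"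
    using separate_faces[OF x y ne(1) px(1) py(1)] .
  have abM: "(a, b) \<in> M" "(b, a) \<in> M" using ab(1) rigid_M sym_M by auto
  have "orient a b pz \<noteq> 0"
    using M_orient_nonzero[OF abM(1), of pz] ab face_basic(3)[OF z] pz by (metis Diff_iff less_irrefl orient_same(1) subsetD)
  then consider "0 < orient a b pz" | "orient a b pz < 0" by linarith
  then show ?thesis
  proof cases
    case 1
    then show ?thesis using separating_triangle_of_chord[OF x y z ne(2) px(1) py(1) pz(1) px(2) py(2) abM(1) ab(2,3)] by blast
  next
    case 2
    then have "\<exists>c\<in>Delta C. separates3 c y x z"
      using separating_triangle_of_chord[OF y x z ne(3) py(1) px(1) pz(1) py(2) px(2) abM(2)] ab orient_swap[of b a] by auto
    then show ?thesis using separates3_swap by blast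
  qed
qed

end

section \<open>Gaps of the rigid chords\<close>

lemma sub_triangulation_chords:
  assumes "sub_triangulation C"
  obtains L where "L \<subseteq> circ \<times> circ" "ncr L" "chords L = C"
  using assms noncrossing_iff unfolding sub_triangulation_def Tri2_def chords_def by metis

lemma chords_hull_circ:
  assumes "L \<subseteq> circ \<times> circ" "chords L = C"
  shows "convex hull C = convex hull (C \<inter> circ)"
proof
  show "convex hull (C \<inter> circ) \<subseteq> convex hull C" by (intro hull_mono) auto
  have "closed_segment a b \<subseteq> convex hull (C \<inter> circ)" if ab: "(a, b) \<in> L" for a b
  proof -
    have "closed_segment a b \<subseteq> C" using ab assms(2) by (auto simp: chords_def)
    then have "a \<in> C \<inter> circ" "b \<in> C \<inter> circ" using ab assms(1) by auto
    then show ?thesis by (simp add: closed_segment_subset hull_inc)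
  qed
  then have "C \<subseteq> convex hull (C \<inter> circ)" using assms(2) by (auto simp: chords_def)
  then show "convex hull C \<subseteq> convex hull (C \<inter> circ)" by (intro hull_minimal) auto
qed

lemma sub_triangulation_tri1_set:
  assumes "sub_triangulation C" shows "tri1_set C"
proof -
  obtain L where "L \<subseteq> circ \<times> circ" "chords L = C" using sub_triangulation_chords[OF assms] by blast
  then show ?thesis using assms chords_hull_circ unfolding tri1_set_def sub_triangulation_def by blast
qed

lemma (in tri1_set) sub_triangulationI:
  assumes "L \<subseteq> circ \<times> circ" "ncr L" "chords L = C" shows "sub_triangulation C"
  using assms noncrossing_iff[OF assms(1)] closed_C nonempty_C C_subset_disc tri1
  unfolding sub_triangulation_def Tri2_def chords_def by blast

text \<open>A given family is enlarged by reversed pairs and by the rigid chords, which cross no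
  chord inside \<open>C\<close>. Taking the closure keeps the sign condition and stays inside
  \<open>C\<close>.\<close>

lemma sub_triangulation_chord_set:
  assumes "sub_triangulation C" obtains M where "chord_set C M"
proof -
  interpret tri1_set C using sub_triangulation_tri1_set[OF assms] .
  obtain L where L: "L \<subseteq> circ \<times> circ" "ncr L" "chords L = C" using sub_triangulation_chords[OF assms] .
  define L' where "L' = L \<union> (\<lambda>(a, b). (b, a)) ` L \<union> rigid C"
  have seg: "closed_segment a b \<subseteq> C" if "(a, b) \<in> L" for a b using that L(3) by (auto simp: chords_def)
  have L'c: "L' \<subseteq> circ \<times> circ" using L(1) rigidD by (auto simp: L'_def)
  have L's: "L' \<subseteq> {(a, b). closed_segment a b \<subseteq> C}"
  proof clarify
    fix a b x assume "(a, b) \<in> L'" "x \<in> closed_segment a b"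
    then show "x \<in> C"
      using seg[of a b] seg[of b a] rigidD(3)[of a b C] closed_segment_commute[of a b] by (auto simp: L'_def)
  qed
  have sym: "(b, a) \<in> L'" if "(a, b) \<in> L'" for a b using that rigid_sym by (force simp: L'_def)
  have "ncr L'" unfolding ncr_def
  proof clarify
    fix a b c d assume ab: "(a, b) \<in> L'" and cd: "(c, d) \<in> L'"
    have circ: "a \<in> circ" "b \<in> circ" "c \<in> circ" "d \<in> circ" using ab cd L'c by auto
    have cC: "closed_segment a b \<subseteq> C" "closed_segment c d \<subseteq> C" using ab cd L's by auto
    consider "(a, b) \<in> rigid C" | "(c, d) \<in> rigid C"
      | "(a, b) \<in> L \<or> (b, a) \<in> L" "(c, d) \<in> L \<or> (d, c) \<in> L"
      using ab cd by (auto simp: L'_def)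
    then show "0 \<le> orient a b c * orient a b d"
    proof cases
      case 1 then show ?thesis using rigidD(6)[OF 1 circ(3,4) cC(2)] by simp
    next
      case 2 then show ?thesis using rigidD(6)[OF 2 circ(1,2) cC(1)] nc_sym[OF circ] by simp
    next
      case 3
      then show ?thesis
        using ncrD[OF L(2), of a b c d] ncrD[OF L(2), of a b d c] ncrD[OF L(2), of b a c d] ncrD[OF L(2), of b a d c]
        by (auto simp: orient_swap[of b a] mult.commute)
    qed
  qed
  then have "ncr (closure L')" by (rule ncr_closure)
  moreover have cc: "closure L' \<subseteq> circ \<times> circ"
    using L'c by (intro closure_minimal closed_Times compact_imp_closed compact_circ)
  moreover have "closure L' \<subseteq> {(a, b). closed_segment a b \<subseteq> C}"
    using L's closed_pairs_segment_subset[OF closed_C] by (rule closure_minimal)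
  then have "chords (closure L') \<subseteq> C" by (auto simp: chords_def)
  moreover have "C \<subseteq> chords (closure L')"
    unfolding L(3)[symmetric] using closure_subset[of L'] by (intro chords_mono) (auto simp: L'_def)
  moreover have "(b, a) \<in> closure L'" if "(a, b) \<in> closure L'" for a b
  proof -
    have "L' \<subseteq> prod.swap -` closure L'" using sym closure_subset by fastforce
    moreover have "closed (prod.swap -` closure L' :: (complex \<times> complex) set)"
      unfolding prod.swap_def by (intro closed_vimage closed_closure continuous_intros)
    ultimately have "closure L' \<subseteq> prod.swap -` closure L'" by (rule closure_minimal)
    then show ?thesis using that by auto
  qed
  moreover have "rigid C \<subseteq> closure L'" using closure_subset[of L'] by (auto simp: L'_def)
  ultimately have "chord_set C (closure L')"
    by unfold_locales auto
  then show thesis by (rule that)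
qed

lemma sub_triangulation_separating:
  assumes "sub_triangulation C" and "x \<in> faces C" "y \<in> faces C" "z \<in> faces C"
    "x \<noteq> y" "y \<noteq> z" "x \<noteq> z"
  shows "\<exists>!c. c \<in> Delta C \<and> separates3 c x y z"
proof -
  obtain M where "chord_set C M" using sub_triangulation_chord_set[OF assms(1)] .
  then interpret chord_set C M .
  show ?thesis
    using separating_triangle_exists[OF assms(2-7)] separating_triangle_unique[OF assms(2-4)] by blast
qed

lemma sub_triangulation_extreme:
  assumes "sub_triangulation C" shows "{p. p extreme_point_of convex hull C} \<subseteq> circ"
proof -
  interpret tri1_set C using sub_triangulation_tri1_set[OF assms] .
  show ?thesis using extreme_point_of_convex_hull[of _ "C \<inter> circ"] unfolding hull_C by blast
qed

lemma tri1_setI_extreme: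
  assumes "closed C" "C \<noteq> {}" "C \<subseteq> disc" "Tri1 C" "{p. p extreme_point_of convex hull C} \<subseteq> circ"
  shows "tri1_set C"
proof -
  have cC: "compact C" using compact_Int_closed[OF compact_disc assms(1)] assms(3) by (simp add: Int_absorb1)
  have "convex hull C = convex hull {p. p extreme_point_of convex hull C}"
    by (intro Krein_Milman_Minkowski compact_convex_hull cC) simp
  also have "\<dots> \<subseteq> convex hull (C \<inter> circ)"
    using assms(5) extreme_point_of_convex_hull[of _ C] by (intro hull_mono) blast
  finally have "convex hull C \<subseteq> convex hull (C \<inter> circ)" .
  moreover have "convex hull (C \<inter> circ) \<subseteq> convex hull C" by (intro hull_mono) auto
  ultimately show ?thesis using assms unfolding tri1_set_def by blast
qed

text \<open>\<open>k\<close> is on the open arc from \<open>a\<close> to \<open>b\<close> and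
  \<open>u\<close> on the complementary one. This decides later which of two edges can hide a
  point.\<close>

lemma orient_arc:
  assumes "a \<in> circ" "b \<in> circ" "k \<in> circ" "u \<in> circ" "orient a b k < 0" "0 \<le> orient a b u" "u \<noteq> a"
  shows "0 < orient u a k"
proof (cases "u = b")
  case True then show ?thesis using assms(5) orient_swap[of a b k] by simp
next
  case False
  have "a \<noteq> b" using assms(5) by auto
  then have "0 < orient a b u" using orient_circ_eq_0[of a b u] assms False by (metis order_less_le)
  then show ?thesis using assms by (auto simp: orient_pos_iff orient_neg_iff)
qed

text \<open>With \<open>u = w\<close> this is a single fan.\<close>

definition double_fan :: "complex set \<Rightarrow> complex \<Rightarrow> complex \<Rightarrow> (complex \<times> complex) set" where
  "double_fan A u w = {(u, k) | k. k \<in> A \<and> orient u w k \<le> 0} \<union> {(w, k) | k. k \<in> A \<and> 0 \<le> orient u w k}"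

text \<open>Chords with a common first endpoint do not cross, and the two fans stay on opposite
  sides of \<open>u w\<close>.\<close>

lemma ncr_double_fan:
  assumes "A \<subseteq> circ" "u \<in> A" "w \<in> A" shows "ncr (double_fan A u w)"
proof -
  have c: "u \<in> circ" "w \<in> circ" using assms by auto
  have key: "0 \<le> orient u k w * orient u k k'"
    if "k \<in> A" "k' \<in> A" "orient u w k \<le> 0" "0 \<le> orient u w k'" for k k'
  proof -
    have kc: "k \<in> circ" "k' \<in> circ" using that assms(1) by auto
    have e: "orient u k w = - orient u w k"
      using orient_rotate[of u k w] orient_rotate[of k w u] orient_swap[of w u k] orient_rotate[of w u k] orient_rotate[of u w k]
      by (metis orient_rotate orient_swap)
    show ?thesis
    proof (cases "orient u w k = 0")
      case False
      then have neg: "orient u w k < 0" using that(3) by simp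
      have "0 \<le> orient u k k'"
      proof (rule ccontr)
        assume "\<not> ?thesis"
        then have "orient u k k' < 0" by simp
        then have "orient u w k' < 0" using neg c kc by (auto simp: orient_neg_iff)
        then show False using that(4) by simp
      qed
      then show ?thesis using e neg by (simp add: mult_nonpos_nonneg)
    qed (use e in simp)
  qed
  show ?thesis unfolding ncr_def
  proof clarify
    fix a b e f assume ab: "(a, b) \<in> double_fan A u w" and ef: "(e, f) \<in> double_fan A u w"
    have circ: "a \<in> circ" "b \<in> circ" "e \<in> circ" "f \<in> circ"
      using ab ef c assms(1) by (auto simp: double_fan_def)
    consider "a = e" | "a = u" "e = w" "b \<in> A" "f \<in> A" "orient u w b \<le> 0" "0 \<le> orient u w f"
      | "a = w" "e = u" "b \<in> A" "f \<in> A" "orient u w f \<le> 0" "0 \<le> orient u w b"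
      using ab ef by (auto simp: double_fan_def)
    then show "0 \<le> orient a b e * orient a b f"
    proof cases
      case 2 then show ?thesis using key[of b f] by simp
    next
      case 3 then show ?thesis using key[of f b] nc_sym[OF circ] by simp
    qed simp
  qed
qed

text \<open>Follow the ray from \<open>u\<close> or \<open>w\<close>, according to the side of
  \<open>p\<close>, through \<open>p\<close> to the circle. If its end were outside
  \<open>A\<close>, a chord starting at the same apex would separate the end from \<open>p\<close>,
  but a ray from its own starting point cannot change sides.\<close>

lemma double_fan_covers:
  assumes A: "A \<subseteq> circ" "u \<in> A" "w \<in> A" and p: "p \<in> disc" "p \<notin> circ"
    and U: "\<And>k. k \<in> circ \<Longrightarrow> k \<notin> A \<Longrightarrow> orient u w k \<le> 0 \<Longrightarrow> \<exists>b. 0 < orient u b p \<and> orient u b k < 0"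
    and W: "\<And>k. k \<in> circ \<Longrightarrow> k \<notin> A \<Longrightarrow> 0 \<le> orient u w k \<Longrightarrow> \<exists>b. 0 < orient w b p \<and> orient w b k < 0"
  shows "p \<in> chords (double_fan A u w)"
proof -
  have c: "u \<in> disc" "w \<in> disc" "p \<noteq> u" "p \<noteq> w" using A p circ_subset_disc by auto
  show ?thesis
  proof (cases "orient u w p \<le> 0")
    case True
    obtain k where k: "k \<in> circ" "p \<in> closed_segment u k" "k \<noteq> u" using ray_circ[OF c(1) p(1) c(3)] .
    have "p \<in> open_segment u k" using k p c by (auto simp: open_segment_def)
    then have uk: "orient u w k \<le> 0" using orient_open_segment_pos[of p u k u w] True by force
    have "k \<in> A"
    proof (rule ccontr)
      assume "k \<notin> A"
      then obtain b where "0 < orient u b p" "orient u b k < 0" using U[OF k(1) _ uk] by blast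
      then show False using orient_segment_nonpos[OF k(2), of u b] by simp
    qed
    then show ?thesis using k uk unfolding chords_def double_fan_def by blast
  next
    case False
    obtain k where k: "k \<in> circ" "p \<in> closed_segment w k" "k \<noteq> w" using ray_circ[OF c(2) p(1) c(4)] .
    have uk: "0 \<le> orient u w k"
      using orient_segment_nonpos[OF k(2), of u w] False by force
    have "k \<in> A"
    proof (rule ccontr)
      assume "k \<notin> A"
      then obtain b where "0 < orient w b p" "orient w b k < 0" using W[OF k(1) _ uk] by blast
      then show False using orient_segment_nonpos[OF k(2), of w b] by simp
    qed
    then show ?thesis using k uk unfolding chords_def double_fan_def by blast
  qed
qed

context tri1_set begin

text \<open>For \<open>p\<close> on no rigid chord, \<open>visible p\<close> is the set of vertices of the gap of the rigid chords
  around \<open>p\<close>. The gap lies in \<open>C\<close> and has to be filled with chords.\<close>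

definition visible :: "complex \<Rightarrow> complex set" where
  "visible p = {k \<in> C \<inter> circ. \<forall>(a, b) \<in> rigid C. 0 < orient a b p \<longrightarrow> 0 \<le> orient a b k}"

definition loose :: "complex set" where
  "loose = C - chords (rigid C)"

lemma visibleD: "k \<in> visible p \<Longrightarrow> (a, b) \<in> rigid C \<Longrightarrow> 0 < orient a b p \<Longrightarrow> 0 \<le> orient a b k"
  by (auto simp: visible_def)

lemma visible_subset: "visible p \<subseteq> C" "visible p \<subseteq> circ"
  by (auto simp: visible_def)

lemma loose_basic:
  assumes "p \<in> loose" shows "p \<in> C" "p \<in> disc" "p \<notin> circ"
proof -
  show "p \<in> C" "p \<in> disc" using assms C_subset_disc by (auto simp: loose_def)
  show "p \<notin> circ"
  proof
    assume "p \<in> circ"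
    then have "(p, p) \<in> rigid C" using assms rigid_refl by (auto simp: loose_def)
    then show False using assms by (force simp: loose_def chords_def)
  qed
qed

lemma loose_nonzero: "p \<in> loose \<Longrightarrow> (a, b) \<in> rigid C \<Longrightarrow> a \<noteq> b \<Longrightarrow> orient a b p \<noteq> 0"
  using line_meets_disc[of a b p] rigidD[of a b C] loose_basic[of p] by (auto simp: loose_def chords_def)

lemma loose_two_points:
  assumes "p \<in> loose" obtains k k' where "k \<in> C \<inter> circ" "k' \<in> C \<inter> circ" "k \<noteq> k'"
proof -
  have p: "p \<in> convex hull (C \<inter> circ)" using loose_basic[OF assms] hull_C hull_inc[of p C convex] by simp
  then have "C \<inter> circ \<noteq> {}" by (metis convex_hull_empty empty_iff)
  then obtain k where k: "k \<in> C \<inter> circ" by blast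
  have "C \<inter> circ \<noteq> {k}"
  proof
    assume "C \<inter> circ = {k}"
    then have "p = k" using p by simp
    then show False using k loose_basic(3)[OF assms] by blast
  qed
  then show thesis using that k by blast
qed

text \<open>Some rigid chord separates \<open>m\<close> from \<open>p\<close>, a hull edge if
  \<open>m\<close> is outside \<open>C\<close>. The one met nearest to \<open>p\<close> is the edge:
  a rigid chord hiding one of its ends does not cross it, hence hides \<open>q\<close> as well and
  would be met nearer to \<open>p\<close>.\<close>

lemma visible_edge:
  assumes p: "p \<in> loose" and m: "m \<in> circ" "m \<notin> visible p"
  obtains a b where "(a, b) \<in> rigid C" "a \<in> visible p" "b \<in> visible p" "orient a b m < 0" "0 < orient a b p"
proof -
  note pb = loose_basic[OF p]
  have "\<exists>c d. (c, d) \<in> rigid C \<and> orient c d m < 0 \<and> 0 < orient c d p"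
  proof (cases "m \<in> C")
    case True
    then obtain c d where "(c, d) \<in> rigid C" "0 < orient c d p" "\<not> 0 \<le> orient c d m"
      using m unfolding visible_def by blast
    then show ?thesis using not_le by blast
  next
    case False
    obtain k k' where "k \<in> C \<inter> circ" "k' \<in> C \<inter> circ" "k \<noteq> k'" using loose_two_points[OF p] .
    then obtain a b where ab: "(a, b) \<in> rigid C" "a \<noteq> b" "0 < orient a b m" "convex hull C \<subseteq> {x. orient a b x \<le> 0}"
      using gap_rigid[OF m(1) False] by metis
    have "orient a b p \<le> 0" using ab(4) hull_inc[OF pb(1)] by blast
    then have "orient a b p < 0" using loose_nonzero[OF p ab(1,2)] by simp
    then show ?thesis using rigid_sym[OF ab(1)] ab(3) orient_swap[of b a] by (intro exI[of _ b] exI[of _ a]) simp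
  qed
  then obtain c d where cd: "(c, d) \<in> rigid C" "orient c d m < 0" "0 < orient c d p" by blast
  have cross: "\<exists>z\<in>open_segment u p. z \<in> chords (rigid C)"
    if ef: "(e, f) \<in> rigid C" "orient e f u < 0" "0 < orient e f p" "u \<in> disc" for e f u
  proof -
    have "orient e f u * orient e f p < 0" using ef by (intro mult_neg_pos)
    then obtain z where z: "z \<in> open_segment u p" "orient e f z = 0" using orient_sign_change by blast
    have "z \<in> disc" using z(1) ef(4) pb(2) closed_segment_subset[OF _ _ convex_disc] open_closed_segment by blast
    moreover have "e \<noteq> f" using ef by auto
    ultimately have "z \<in> closed_segment e f" using z line_meets_disc[of e f z] rigidD[OF ef(1)] by blast
    then show ?thesis using z ef(1) by (auto simp: chords_def)
  qed
  have md: "m \<in> disc" using m circ_subset_disc by blast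
  obtain z0 where z0: "z0 \<in> open_segment m p" "z0 \<in> chords (rigid C)" using cross[OF cd md] by blast
  have rc: "closed (rigid C)" "rigid C \<subseteq> circ \<times> circ" using closed_rigid closed_C rigidD(1,2) by auto
  have "closed_segment m p \<inter> chords (rigid C) \<noteq> {}" using z0 open_closed_segment by blast
  then obtain q a b where ab: "(a, b) \<in> rigid C" and q: "q \<in> closed_segment m p" "q \<in> closed_segment a b"
    and near: "\<And>z. z \<in> closed_segment m p \<Longrightarrow> z \<in> chords (rigid C) \<Longrightarrow> dist p q \<le> dist p z"
    using nearest_crossing[OF rc, of m p] by blast
  have "dist p q \<le> dist p z0" using near z0 open_closed_segment by blast
  also have "\<dots> < dist p m" using dist_open_segment_less[OF z0(1)] .
  finally have "q \<noteq> m" by auto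
  moreover have qp: "q \<noteq> p" using p q(2) ab by (auto simp: loose_def chords_def)
  ultimately have qo: "q \<in> open_segment m p" using q(1) by (simp add: open_segment_def)
  have "norm q < 1 / (2 * pi)" using open_segment_disc[OF md pb(2) qo] .
  then have qc: "q \<notin> circ" "q \<in> disc" by (auto simp: circ_def disc_def)
  have circ: "a \<in> circ" "b \<in> circ" using rigidD[OF ab] by auto
  have ne: "a \<noteq> b" using q(2) qc circ by auto
  have closer: False if "z \<in> open_segment q p" "z \<in> chords (rigid C)" for z
  proof -
    have "z \<in> closed_segment m p"
      using that(1) q(1) by (meson closed_segment_subset convex_closed_segment ends_in_segment(2) open_closed_segment subsetD)
    then show False using near[of z] that(2) dist_open_segment_less[OF that(1)] by simp
  qed
  have vis: "e \<in> visible p"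
    if ef: "(e, f) \<in> rigid C" "q \<in> closed_segment e f" "e \<noteq> f" for e f
  proof (rule ccontr)
    assume "e \<notin> visible p"
    then obtain g h where gh: "(g, h) \<in> rigid C" "0 < orient g h p" "\<not> 0 \<le> orient g h e"
      using rigidD(1,4)[OF ef(1)] unfolding visible_def by blast
    have gh3: "orient g h e < 0" using gh(3) by simp
    have "0 \<le> orient g h e * orient g h f" using ncrD[OF rigid_ncr gh(1) ef(1)] .
    then have f: "orient g h f \<le> 0" using gh3 by (simp add: zero_le_mult_iff)
    have "q \<in> open_segment e f" using ef qc rigidD[OF ef(1)] by (auto simp: open_segment_def)
    then have "0 < orient h g q"
      using orient_open_segment_pos[of q e f h g] f gh3 orient_swap[of h g] by simp
    then have "orient g h q < 0" using orient_swap[of h g q] by simp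
    then show False using cross[OF gh(1) _ gh(2) qc(2)] closer by blast
  qed
  have A: "a \<in> visible p" "b \<in> visible p"
    using vis[OF ab q(2) ne] vis[OF rigid_sym[OF ab]] q(2) ne by (auto simp: closed_segment_commute)
  have opp: "orient e f m < 0" if "0 < orient e f p" "orient e f q = 0" for e f
    using orient_open_segment_pos[OF qo, of e f] that by force
  have q0: "orient a b q = 0" "orient b a q = 0" using orient_on_segment[OF q(2)] orient_swap[of b a q] by auto
  consider "0 < orient a b p" | "0 < orient b a p"
    using loose_nonzero[OF p ab ne] orient_swap[of b a p] by linarith
  then show thesis
  proof cases
    case 1 show thesis by (rule that[OF ab A opp[OF 1 q0(1)] 1])
  next
    case 2 show thesis by (rule that[OF rigid_sym[OF ab] A(2,1) opp[OF 2 q0(2)] 2])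
  qed
qed

text \<open>Suppose \<open>q\<close> is in a triangle of \<open>Delta C\<close>. A side with
  \<open>p\<close> on its right would have all visible points, and hence \<open>q\<close>, weakly on
  its right. So \<open>p\<close> is left of all three sides and inside the triangle, although it is
  in \<open>C\<close>.\<close>

lemma hull_visible:
  assumes p: "p \<in> loose" shows "convex hull (visible p) \<subseteq> C"
proof
  fix q assume q: "q \<in> convex hull (visible p)"
  show "q \<in> C"
  proof (rule ccontr)
    assume "q \<notin> C"
    moreover have "q \<in> convex hull C" using q hull_mono[OF visible_subset(1)] by blast
    ultimately have "q \<in> \<Union>(Delta C)" unfolding Delta_def Union_components by simp
    then obtain t where "t \<in> Delta C" "q \<in> t" by blast
    then obtain a b c where t: "q \<in> tri a b c" "0 < orient a b c" "(a, b) \<in> rigid C" "(b, c) \<in> rigid C" "(c, a) \<in> rigid C"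
      "tri a b c \<inter> C = {}" using Delta_tri by metis
    have no: "0 < orient e f p" if ef: "(e, f) \<in> rigid C" "e \<noteq> f" "0 < orient e f q" for e f
    proof (rule ccontr)
      assume "\<not> ?thesis"
      then have "0 < orient f e p" using loose_nonzero[OF p ef(1,2)] orient_swap[of f e p] by simp
      then have "visible p \<subseteq> {k. 0 \<le> orient f e k}" using visibleD rigid_sym[OF ef(1)] by blast
      then have "convex hull (visible p) \<subseteq> {k. 0 \<le> orient f e k}" by (intro hull_minimal convex_orient)
      then show False using q ef(3) orient_swap[of f e q] by force
    qed
    have "a \<noteq> b" "b \<noteq> c" "c \<noteq> a" using t(2) by auto
    then have "p \<in> tri a b c" using no[OF t(3)] no[OF t(4)] no[OF t(5)] t(1) by (simp add: tri_def)
    then show False using t(6) loose_basic(1)[OF p] by blast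
  qed
qed

text \<open>The ray from \<open>a\<close> through \<open>p\<close> ends at a point \<open>m\<close>
  strictly left of \<open>a b\<close>. Either \<open>m\<close> is visible, or an end of the edge
  hiding it will do.\<close>

lemma visible_opposite:
  assumes p: "p \<in> loose" and ab: "(a, b) \<in> rigid C" "0 < orient a b p"
  obtains k where "k \<in> visible p" "0 < orient a b k"
proof -
  note pb = loose_basic[OF p]
  have circ: "a \<in> circ" "b \<in> circ" "a \<noteq> b" using rigidD[OF ab(1)] ab(2) by auto
  have "p \<noteq> a" using pb circ by auto
  then obtain m where m: "m \<in> circ" "p \<in> closed_segment a m"
    using ray_circ[of a p] circ pb circ_subset_disc by blast
  have mpos: "0 < orient a b m"
    using orient_segment_nonpos[OF m(2), of a b] ab(2) by force
  show thesis
  proof (cases "m \<in> visible p")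
    case False
    obtain e f where ef: "(e, f) \<in> rigid C" "e \<in> visible p" "f \<in> visible p" "orient e f m < 0" "0 < orient e f p"
      using visible_edge[OF p m(1) False] .
    have nn: "0 \<le> orient a b e" "0 \<le> orient a b f" using visibleD[OF _ ab] ef by auto
    have "0 < orient a b e \<or> 0 < orient a b f"
    proof (rule ccontr)
      assume "\<not> ?thesis"
      then have "orient a b e = 0" "orient a b f = 0" using nn by auto
      then have "e = a \<or> e = b" "f = a \<or> f = b"
        using orient_circ_eq_0[of a b e] orient_circ_eq_0[of a b f] circ rigidD[OF ef(1)] by auto
      then show False using ef(4,5) mpos ab(2) orient_swap[of b a] by auto
    qed
    then show thesis using that ef by blast
  qed (use that mpos in blast)
qed

text \<open>If no face lies in the cap, the whole cap is in \<open>C\<close>. Then the chord from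
  \<open>m\<close> to a visible point strictly on the other side lies in \<open>C\<close> and
  crosses the rigid chord \<open>a b\<close>.\<close>

lemma face_beyond_edge:
  assumes p: "p \<in> loose" and ab: "(a, b) \<in> rigid C" "a \<in> visible p" "b \<in> visible p" "0 < orient a b p"
    and m: "m \<in> circ" "orient a b m < 0"
  obtains x where "x \<in> faces C" "x \<subseteq> beyond a b"
proof (rule ccontr)
  assume no: "\<not> thesis"
  have circ: "a \<in> circ" "b \<in> circ" "a \<noteq> b" using rigidD[OF ab(1)] ab(4) by auto
  have full: "beyond a b \<subseteq> C"
  proof
    fix q assume q: "q \<in> beyond a b"
    show "q \<in> C"
    proof (rule ccontr)
      assume "q \<notin> C"
      then obtain x where x: "x \<in> faces C" "q \<in> x" using in_face q by (auto simp: beyond_def)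
      then have "\<forall>v\<in>x. orient a b v < 0"
        using face_one_side[OF x(1) circ rigidD(3)[OF ab(1)]] q by (force simp: beyond_def)
      then show False using no that x(1) face_basic(3)[OF x(1)] by (auto simp: beyond_def)
    qed
  qed
  obtain k where k: "k \<in> visible p" "0 < orient a b k" using visible_opposite[OF p ab(1,4)] .
  have kc: "k \<in> circ" using k visible_subset by auto
  have "orient a b m * orient a b k < 0" using m k by (intro mult_neg_pos)
  then obtain q where q: "q \<in> open_segment m k" "orient a b q = 0" using orient_sign_change by blast
  have mk: "closed_segment m k \<subseteq> disc" using chord_subset_disc m kc by blast
  have qab: "q \<in> closed_segment a b"
    using q line_meets_disc[of a b q] circ mk open_closed_segment by blast
  have un: "closed_segment m k = closed_segment m q \<union> closed_segment q k"
    using q(1) Un_closed_segment open_closed_segment by metis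
  have "closed_segment q k \<subseteq> C"
  proof -
    have "closed_segment a b \<subseteq> convex hull (visible p)" using ab by (simp add: closed_segment_subset hull_inc)
    then have "closed_segment q k \<subseteq> convex hull (visible p)"
      using qab hull_inc[OF k(1), of convex] by (intro closed_segment_subset) auto
    then show ?thesis using hull_visible[OF p] by blast
  qed
  moreover have "closed_segment m q \<subseteq> C"
  proof
    fix v assume v: "v \<in> closed_segment m q"
    show "v \<in> C"
    proof (cases "v = q \<or> v = m")
      case True
      then show ?thesis using qab rigidD(3)[OF ab(1)] full m circ_subset_disc by (auto simp: beyond_def)
    next
      case False
      then have "v \<in> open_segment m q" using v by (simp add: open_segment_def)
      then have "0 < orient b a v"
        using orient_open_segment_pos[of v m q b a] m(2) q(2) orient_swap[of b a] by simp
      then have "v \<in> beyond a b" using v un mk orient_swap[of b a v] by (auto simp: beyond_def)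
      then show ?thesis using full by blast
    qed
  qed
  ultimately have "closed_segment m k \<subseteq> C" using un by blast
  then have "0 \<le> orient a b m * orient a b k" using rigidD(6)[OF ab(1) m(1) kc] by blast
  then show False using m k by (auto simp: zero_le_mult_iff)
qed

end

section \<open>Edges of a gap and the caps behind them\<close>

context tri1_set begin

definition edge :: "complex \<Rightarrow> complex \<Rightarrow> complex \<Rightarrow> bool" where
  "edge p a b \<longleftrightarrow> (a, b) \<in> rigid C \<and> a \<in> visible p \<and> b \<in> visible p \<and> 0 < orient a b p"

lemma edgeD:
  assumes "edge p a b"
  shows "(a, b) \<in> rigid C" "a \<in> visible p" "b \<in> visible p" "0 < orient a b p" "a \<in> circ" "b \<in> circ" "a \<noteq> b"
    "\<And>k. k \<in> visible p \<Longrightarrow> 0 \<le> orient a b k"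
  using assms rigidD[of a b C] visibleD[of _ p a b] unfolding edge_def by auto

text \<open>Each edge has the ends of the other weakly on its left, so neither cap is cut by the
  other edge. By symmetry two caps are equal or disjoint.\<close>

lemma edge_subset_beyond:
  assumes e: "edge p a b" and f: "edge p a' b'" and q: "q \<in> beyond a b" "q \<in> beyond a' b'"
  shows "beyond a b \<subseteq> beyond a' b'"
proof -
  have "0 \<le> orient a b a'" "0 \<le> orient a b b'" using edgeD(8)[OF e] edgeD(2,3)[OF f] by auto
  then have "beyond a b \<inter> closed_segment a' b' = {}"
    using orient_segment_nonneg[of _ a' b' a b] by (force simp: beyond_def)
  then have "(\<forall>v\<in>beyond a b. 0 < orient a' b' v) \<or> (\<forall>v\<in>beyond a b. orient a' b' v < 0)"
    using edgeD[OF f] convex_connected[OF convex_beyond[of a b]] by (intro one_side) (auto simp: beyond_def)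
  moreover have "orient a' b' q < 0" using q by (simp add: beyond_def)
  ultimately have "\<forall>v\<in>beyond a b. orient a' b' v < 0" using q(1) by (meson less_asym)
  then show ?thesis by (auto simp: beyond_def)
qed

lemma edges_beyond_disjoint:
  assumes "edge p a b" "edge p a' b'" "m \<in> beyond a' b'" "m \<notin> beyond a b"
  shows "beyond a b \<inter> beyond a' b' = {}"
proof (rule ccontr)
  assume "\<not> ?thesis"
  then obtain q where q: "q \<in> beyond a b" "q \<in> beyond a' b'" by blast
  then have "beyond a' b' \<subseteq> beyond a b" by (intro edge_subset_beyond[OF assms(2,1)])
  then show False using assms(3,4) by blast
qed

text \<open>A loose point is behind some side of every triangle. That side reversed is a rigid chord
  with \<open>p\<close> on its left, which keeps all visible points behind the side.\<close>

lemma triangle_hides: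
  assumes p: "p \<in> loose" and c: "c \<in> Delta C"
  obtains u v w where "c = tri u v w" "0 < orient u v w" "u \<in> circ" "v \<in> circ" "w \<in> circ" "(u, v) \<in> rigid C"
    "\<And>k. k \<in> visible p \<Longrightarrow> orient u v k \<le> 0"
proof -
  obtain a b d where t: "c = tri a b d" "0 < orient a b d" "(a, b) \<in> rigid C" "(b, d) \<in> rigid C" "(d, a) \<in> rigid C"
    "a \<in> circ" "b \<in> circ" "d \<in> circ" "tri a b d \<inter> C = {}"
    using Delta_tri[OF c] by metis
  have "p \<notin> tri a b d" using t(9) loose_basic(1)[OF p] by blast
  moreover have "a \<noteq> b" "b \<noteq> d" "d \<noteq> a" using t(2) by auto
  ultimately have out: "orient a b p < 0 \<or> orient b d p < 0 \<or> orient d a p < 0"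
    using loose_nonzero[OF p t(3)] loose_nonzero[OF p t(4)] loose_nonzero[OF p t(5)] by (auto simp: tri_def)
  have hid: "orient u v k \<le> 0" if "(u, v) \<in> rigid C" "orient u v p < 0" "k \<in> visible p" for u v k
    using visibleD[OF that(3) rigid_sym[OF that(1)]] that(2) orient_swap[of v u] by simp
  have o: "0 < orient b d a" "0 < orient d a b"
    using t(2) orient_rotate[of b d a] orient_rotate[of a b d] by auto
  from out show thesis
  proof (elim disjE)
    assume n: "orient a b p < 0" show thesis by (rule that[of a b d]) (use t hid[OF t(3) n] in auto)
  next
    assume n: "orient b d p < 0" show thesis
      by (rule that[of b d a]) (use t o hid[OF t(4) n] tri_rotate[of b d a] in auto)
  next
    assume n: "orient d a p < 0" show thesis
      by (rule that[of d a b]) (use t o hid[OF t(5) n] tri_rotate[of a b d] in auto)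
  qed
qed

text \<open>The visible set determines the gap: a visible point strictly left of \<open>a b\<close>
  forces every loose point with the same visible set to be there as well.\<close>

lemma edge_cong:
  assumes p: "p \<in> loose" and q: "q \<in> loose" and v: "visible p = visible q" and e: "edge p a b"
  shows "edge q a b"
proof -
  note ed = edgeD[OF e]
  obtain k where k: "k \<in> visible p" "0 < orient a b k" using visible_opposite[OF p ed(1,4)] .
  have "0 < orient a b q"
  proof (rule ccontr)
    assume "\<not> ?thesis"
    then have "0 < orient b a q" using loose_nonzero[OF q ed(1,7)] orient_swap[of b a q] by simp
    then have "0 \<le> orient b a k" using visibleD[OF _ rigid_sym[OF ed(1)]] k(1) v by blast
    then show False using k(2) orient_swap[of b a k] by simp
  qed
  then show ?thesis using ed v by (simp add: edge_def)
qed

lemma edges_common_start: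
  assumes "edge p a b" "edge p a b'" shows "b = b'"
proof (rule ccontr)
  assume ne: "b \<noteq> b'"
  note e = edgeD[OF assms(1)] and f = edgeD[OF assms(2)]
  have "0 \<le> orient a b b'" "0 \<le> orient a b' b" using e(8)[OF f(3)] f(8)[OF e(3)] by auto
  moreover have "orient a b' b = - orient a b b'" by (metis orient_rotate orient_swap)
  moreover have "orient a b b' \<noteq> 0"
    using orient_circ_eq_0[OF e(5,6) f(6)] e(7) f(7) ne by blast
  ultimately show False by linarith
qed

text \<open>For chords chosen in different gaps. A crossing point would lie on the line of
  \<open>a b\<close>, so \<open>e\<close> and \<open>f\<close> would be \<open>a\<close> and
  \<open>b\<close>; but then \<open>e f\<close> is rigid and cannot be crossed.\<close>

lemma separated_noncrossing:
  assumes ab: "(a, b) \<in> rigid C" "a \<noteq> b" and circ: "c \<in> circ" "d \<in> circ" "e \<in> circ" "f \<in> circ"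
    and cd: "0 \<le> orient a b c" "0 \<le> orient a b d" "closed_segment c d \<subseteq> C"
    and ef: "orient a b e \<le> 0" "orient a b f \<le> 0"
  shows "0 \<le> orient c d e * orient c d f"
proof (rule ccontr)
  assume "\<not> ?thesis"
  then have n: "orient c d e * orient c d f < 0" by simp
  then obtain z where z: "z \<in> open_segment e f" "orient c d z = 0" using orient_sign_change by blast
  have "c \<noteq> d" using n by auto
  moreover have "z \<in> disc" using z(1) circ chord_subset_disc open_closed_segment by blast
  ultimately have "z \<in> closed_segment c d" using line_meets_disc circ z(2) by blast
  then have nn: "0 \<le> orient a b z" using orient_segment_nonneg cd by blast
  have "orient a b e = 0 \<and> orient a b f = 0"
    using orient_open_segment_pos[OF z(1), of b a] ef nn orient_swap[of b a] by force
  then have "e = a \<or> e = b" "f = a \<or> f = b"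
    using orient_circ_eq_0[of a b e] orient_circ_eq_0[of a b f] circ rigidD[OF ab(1)] ab(2) by auto
  moreover have "e \<noteq> f" using z(1) by auto
  ultimately have "(e, f) \<in> rigid C" using ab(1) rigid_sym by blast
  then have "0 \<le> orient e f c * orient e f d" using rigidD(6) circ cd(3) by blast
  then show False using n nc_sym[OF circ] by simp
qed

end

locale separated_faces = tri1_set +
  assumes sep: "\<And>x y z. x \<in> faces C \<Longrightarrow> y \<in> faces C \<Longrightarrow> z \<in> faces C \<Longrightarrow>
    x \<noteq> y \<Longrightarrow> y \<noteq> z \<Longrightarrow> x \<noteq> z \<Longrightarrow> \<exists>c\<in>Delta C. separates3 c x y z"
begin

text \<open>There are faces in three disjoint caps. A triangle separating them has a side
  \<open>u v\<close> with all visible points on the far side. Its near side \<open>P\<close> is cut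
  by no edge, so \<open>P\<close> lies in the cap of any edge that has one of these faces in
  \<open>P\<close>. At most one face is in \<open>P\<close>; the other two are both behind
  \<open>u v\<close> and not separated.\<close>

lemma no_three_edges:
  assumes p: "p \<in> loose" and e: "edge p a1 b1" "edge p a2 b2" "edge p a3 b3"
    and m: "m1 \<in> circ" "m2 \<in> circ" "m3 \<in> circ" "m1 \<in> beyond a1 b1" "m2 \<in> beyond a2 b2" "m3 \<in> beyond a3 b3"
      "m2 \<notin> beyond a1 b1" "m3 \<notin> beyond a1 b1" "m3 \<notin> beyond a2 b2"
  shows False
proof -
  have ex: "\<exists>x. x \<in> faces C \<and> x \<subseteq> beyond a b"
    if "edge p a b" "k \<in> circ" "k \<in> beyond a b" for a b k
  proof -
    have "orient a b k < 0" using that(3) by (simp add: beyond_def)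
    then show ?thesis using face_beyond_edge[OF p edgeD(1-4)[OF that(1)] that(2)] by blast
  qed
  obtain x1 where x1: "x1 \<in> faces C" "x1 \<subseteq> beyond a1 b1" using ex[OF e(1) m(1,4)] by blast
  obtain x2 where x2: "x2 \<in> faces C" "x2 \<subseteq> beyond a2 b2" using ex[OF e(2) m(2,5)] by blast
  obtain x3 where x3: "x3 \<in> faces C" "x3 \<subseteq> beyond a3 b3" using ex[OF e(3) m(3,6)] by blast
  have d: "beyond a1 b1 \<inter> beyond a2 b2 = {}" "beyond a1 b1 \<inter> beyond a3 b3 = {}" "beyond a2 b2 \<inter> beyond a3 b3 = {}"
    using edges_beyond_disjoint[OF e(1,2) m(5,7)] edges_beyond_disjoint[OF e(1,3) m(6,8)]
      edges_beyond_disjoint[OF e(2,3) m(6,9)] by auto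
  note ne = face_basic(1)[OF x1(1)] face_basic(1)[OF x2(1)] face_basic(1)[OF x3(1)]
  have "x1 \<noteq> x2" "x2 \<noteq> x3" "x1 \<noteq> x3" using d x1(2) x2(2) x3(2) ne by blast+
  then obtain c where c: "c \<in> Delta C" "separates3 c x1 x2 x3" using sep[OF x1(1) x2(1) x3(1)] by blast
  obtain u v w where t: "c = tri u v w" "0 < orient u v w" "u \<in> circ" "v \<in> circ" "w \<in> circ" "(u, v) \<in> rigid C"
    "\<And>k. k \<in> visible p \<Longrightarrow> orient u v k \<le> 0"
    using triangle_hides[OF p c(1)] by metis
  have uv: "u \<noteq> v" using t(2) by auto
  define P where "P = disc \<inter> {q. 0 < orient u v q}"
  have side: "x \<subseteq> beyond u v \<or> x \<subseteq> P" if "x \<in> faces C" for x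
  proof -
    have "x \<subseteq> disc" using face_basic(3)[OF that] by blast
    then show ?thesis
      using face_one_side[OF that t(3,4) uv rigidD(3)[OF t(6)]] unfolding P_def beyond_def by blast
  qed
  have PB: "P \<subseteq> beyond a b" if e': "edge p a b" and x: "x \<subseteq> P" "x \<subseteq> beyond a b" "x \<noteq> {}" for a b x
  proof -
    have "orient u v a \<le> 0" "orient u v b \<le> 0" using t(7) edgeD(2,3)[OF e'] by auto
    then have "P \<inter> closed_segment a b = {}"
      using orient_segment_nonpos[of _ a b u v] by (force simp: P_def)
    then have "(\<forall>q\<in>P. 0 < orient a b q) \<or> (\<forall>q\<in>P. orient a b q < 0)"
      using edgeD(5-7)[OF e'] by (intro one_side) (auto simp: P_def intro!: convex_connected convex_Int convex_disc convex_orient)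
    moreover obtain q where "q \<in> x" using x(3) by blast
    then have "q \<in> P" "orient a b q < 0" using x by (auto simp: beyond_def)
    ultimately have "\<forall>q\<in>P. orient a b q < 0" by (meson less_asym)
    then show ?thesis by (auto simp: P_def beyond_def)
  qed
  have two: "\<not> (x \<subseteq> P \<and> y \<subseteq> P)" if "edge p a b" "edge p a' b'" "x \<subseteq> beyond a b" "y \<subseteq> beyond a' b'"
    "x \<noteq> {}" "y \<noteq> {}" "beyond a b \<inter> beyond a' b' = {}" for x y a b a' b'
    using PB[OF that(1) _ that(3,5)] PB[OF that(2) _ that(4,6)] that(5,7) by blast
  have s: "separates3 c x1 x2 x3" "separates3 c x2 x3 x1" "separates3 c x3 x1 x2"
    using c separates3_rotate by blast+
  show False
    using side[OF x1(1)] side[OF x2(1)] side[OF x3(1)] s ne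
      two[OF e(1,2) x1(2) x2(2) ne(1,2) d(1)] two[OF e(1,3) x1(2) x3(2) ne(1,3) d(2)] two[OF e(2,3) x2(2) x3(2) ne(2,3) d(3)]
      not_separates3_beyond[OF t(3-5,2), of x1 x2 x3] not_separates3_beyond[OF t(3-5,2), of x2 x3 x1]
      not_separates3_beyond[OF t(3-5,2), of x3 x1 x2]
    unfolding t(1) by blast
qed

text \<open>Without edges any apex works, with one edge its starting point. With two edges the
  apexes are the two starting points: a hidden point on one side of the line \<open>a1 a2\<close>
  can only be behind the edge that starts at the apex used on that side.\<close>

lemma fan_exists:
  assumes p: "p \<in> loose"
  shows "\<exists>F. F \<subseteq> visible p \<times> visible p \<and> ncr F \<and> (\<forall>q\<in>loose. visible q = visible p \<longrightarrow> q \<in> chords F)"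
proof -
  let ?A = "visible p"
  have edge_ex: "\<exists>a b. edge p a b \<and> m \<in> beyond a b" if m: "m \<in> circ" "m \<notin> ?A" for m
    using visible_edge[OF p m] m circ_subset_disc unfolding edge_def beyond_def by blast
  have fan: ?thesis if uw: "u \<in> ?A" "w \<in> ?A"
    and U: "\<And>k. k \<in> circ \<Longrightarrow> k \<notin> ?A \<Longrightarrow> orient u w k \<le> 0 \<Longrightarrow> \<exists>b. edge p u b \<and> k \<in> beyond u b"
    and W: "\<And>k. k \<in> circ \<Longrightarrow> k \<notin> ?A \<Longrightarrow> 0 \<le> orient u w k \<Longrightarrow> \<exists>b. edge p w b \<and> k \<in> beyond w b" for u w
  proof (intro exI[of _ "double_fan ?A u w"] conjI ballI impI)
    show "double_fan ?A u w \<subseteq> ?A \<times> ?A" using uw by (auto simp: double_fan_def)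
    show "ncr (double_fan ?A u w)" using ncr_double_fan[OF visible_subset(2) uw] .
    fix q assume q: "q \<in> loose" "visible q = ?A"
    show "q \<in> chords (double_fan ?A u w)"
    proof (rule double_fan_covers[OF visible_subset(2) uw loose_basic(2,3)[OF q(1)]])
      fix k assume k: "k \<in> circ" "k \<notin> ?A"
      show "\<exists>b. 0 < orient u b q \<and> orient u b k < 0" if "orient u w k \<le> 0"
        using U[OF k that] edge_cong[OF p q(1) q(2)[symmetric]] edgeD(4) unfolding beyond_def by blast
      show "\<exists>b. 0 < orient w b q \<and> orient w b k < 0" if "0 \<le> orient u w k"
        using W[OF k that] edge_cong[OF p q(1) q(2)[symmetric]] edgeD(4) unfolding beyond_def by blast
    qed
  qed
  show ?thesis
  proof (cases "circ \<subseteq> ?A")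
    case True
    have "complex_of_real (1 / (2 * pi)) \<in> circ" by (simp add: circ_def norm_divide norm_mult)
    then show ?thesis using True by (intro fan[of "complex_of_real (1 / (2 * pi))" "complex_of_real (1 / (2 * pi))"]) auto
  next
    case False
    then obtain m1 where m1: "m1 \<in> circ" "m1 \<notin> ?A" by blast
    obtain a1 b1 where e1: "edge p a1 b1" "m1 \<in> beyond a1 b1" using edge_ex[OF m1] by blast
    show ?thesis
    proof (cases "circ - ?A \<subseteq> beyond a1 b1")
      case True
      then show ?thesis using fan[of a1 a1] e1(1) edgeD(2)[OF e1(1)] by blast
    next
      case False
      then obtain m2 where m2: "m2 \<in> circ" "m2 \<notin> ?A" "m2 \<notin> beyond a1 b1" by blast
      obtain a2 b2 where e2: "edge p a2 b2" "m2 \<in> beyond a2 b2" using edge_ex[OF m2(1,2)] by blast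
      have all: "k \<in> beyond a1 b1 \<or> k \<in> beyond a2 b2" if k: "k \<in> circ" "k \<notin> ?A" for k
      proof (rule ccontr)
        assume n: "\<not> ?thesis"
        obtain a3 b3 where e3: "edge p a3 b3" "k \<in> beyond a3 b3" using edge_ex[OF k] by blast
        show False
          using no_three_edges[OF p e1(1) e2(1) e3(1) m1(1) m2(1) k(1) e1(2) e2(2) e3(2) m2(3)] n by blast
      qed
      have ne: "a1 \<noteq> a2" using edges_common_start e1 e2 m2(3) by blast
      have arc: "0 < orient a' a k" if "edge p a b" "edge p a' b'" "a' \<noteq> a" "k \<in> circ" "k \<in> beyond a b" for a b a' b' k
        using orient_arc[of a b k a'] edgeD[OF that(1)] edgeD[OF that(2)] that by (auto simp: beyond_def)
      show ?thesis
      proof (rule fan[of a1 a2])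
        fix k assume k: "k \<in> circ" "k \<notin> ?A"
        show "\<exists>b. edge p a1 b \<and> k \<in> beyond a1 b" if "orient a1 a2 k \<le> 0"
          using all[OF k] arc[OF e2(1) e1(1) ne k(1)] that e1(1) by force
        show "\<exists>b. edge p a2 b \<and> k \<in> beyond a2 b" if "0 \<le> orient a1 a2 k"
          using all[OF k] arc[OF e1(1) e2(1) ne[symmetric] k(1)] that e2(1) orient_swap[of a1 a2 k] by force
      qed (use edgeD(2) e1 e2 in auto)
    qed
  qed
qed

lemma sub_triangulation_C: "sub_triangulation C"
proof -
  \<comment> \<open>The choice depends on the visible set and not on the point, so all points of a
    gap receive the same fans.\<close>
  define Fam where "Fam A = (SOME F. F \<subseteq> A \<times> A \<and> ncr F \<and> (\<forall>q\<in>loose. visible q = A \<longrightarrow> q \<in> chords F))" for A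
  have Fam: "Fam (visible p) \<subseteq> visible p \<times> visible p" "ncr (Fam (visible p))" "p \<in> chords (Fam (visible p))"
    if p: "p \<in> loose" for p
    using someI_ex[OF fan_exists[OF p]] p unfolding Fam_def by blast+
  have seg: "closed_segment c d \<subseteq> C" "c \<in> circ" "d \<in> circ"
    if p: "p \<in> loose" and cd: "(c, d) \<in> Fam (visible p)" for p c d
  proof -
    have "c \<in> visible p" "d \<in> visible p" using Fam(1)[OF p] cd by auto
    then show "c \<in> circ" "d \<in> circ" "closed_segment c d \<subseteq> C"
      using visible_subset(2) hull_visible[OF p] closed_segment_subset[of c "convex hull visible p" d]
      by (auto simp: hull_inc)
  qed
  define L where "L = rigid C \<union> (\<Union>p\<in>loose. Fam (visible p))"
  have Lseg: "closed_segment a b \<subseteq> C" "a \<in> circ" "b \<in> circ" if "(a, b) \<in> L" for a b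
    using that seg rigidD(1-3)[of a b C] unfolding L_def by blast+
  have "ncr L" unfolding ncr_def
  proof clarify
    fix a b c d assume ab: "(a, b) \<in> L" and cd: "(c, d) \<in> L"
    note abC = Lseg[OF ab] and cdC = Lseg[OF cd]
    consider "(a, b) \<in> rigid C" | "(c, d) \<in> rigid C"
      | p q where "p \<in> loose" "q \<in> loose" "(a, b) \<in> Fam (visible p)" "(c, d) \<in> Fam (visible q)"
      using ab cd by (auto simp: L_def)
    then show "0 \<le> orient a b c * orient a b d"
    proof cases
      case 1 show ?thesis by (rule rigidD(6)[OF 1 cdC(2,3,1)])
    next
      case 2
      have "0 \<le> orient c d a * orient c d b" by (rule rigidD(6)[OF 2 abC(2,3,1)])
      then show ?thesis using nc_sym[OF abC(2,3) cdC(2,3)] by simp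
    next
      case 3
      show ?thesis
      proof (cases "visible p = visible q")
        case True
        then show ?thesis using ncrD[OF Fam(2)[OF 3(1)] 3(3), of c d] 3(4) by simp
      next
        case False
        \<comment> \<open>If no rigid chord separated \<open>p\<close> from \<open>q\<close>, both
          would be on the same side of each, and their visible sets would agree.\<close>
        have "\<exists>e f. (e, f) \<in> rigid C \<and> 0 < orient e f p \<and> orient e f q < 0"
        proof (rule ccontr)
          assume n: "\<not> ?thesis"
          have iff: "0 < orient e f p \<longleftrightarrow> 0 < orient e f q" if ef: "(e, f) \<in> rigid C" for e f
          proof (cases "e = f")
            case ne: False
            have "orient e f p \<noteq> 0" "orient e f q \<noteq> 0" using loose_nonzero ef ne 3(1,2) by auto
            moreover have "\<not> (0 < orient e f p \<and> orient e f q < 0)" "\<not> (0 < orient f e p \<and> orient f e q < 0)"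
              using n ef rigid_sym[OF ef] by auto
            ultimately show ?thesis using orient_swap[of f e] by auto
          qed simp
          then have "visible p = visible q" unfolding visible_def by (auto split: prod.splits)
          then show False using False by simp
        qed
        then obtain e f where ef: "(e, f) \<in> rigid C" "0 < orient e f p" "orient e f q < 0" by blast
        have vp: "a \<in> visible p" "b \<in> visible p" "c \<in> visible q" "d \<in> visible q"
          using Fam(1) 3 by blast+
        have "0 < orient f e q" using ef(3) orient_swap[of f e q] by simp
        then have "0 \<le> orient f e c" "0 \<le> orient f e d" using visibleD[OF _ rigid_sym[OF ef(1)]] vp by auto
        then have "orient e f c \<le> 0" "orient e f d \<le> 0" using orient_swap[of f e] by auto
        moreover have "0 \<le> orient e f a" "0 \<le> orient e f b" using visibleD[OF _ ef(1,2)] vp by auto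
        moreover have "e \<noteq> f" using ef(2) by auto
        ultimately show ?thesis
          using separated_noncrossing[OF ef(1)] abC cdC by blast
      qed
    qed
  qed
  moreover have "L \<subseteq> circ \<times> circ" using Lseg by auto
  moreover have "chords L = C"
  proof
    show "chords L \<subseteq> C" using Lseg(1) by (auto simp: chords_def)
    show "C \<subseteq> chords L"
    proof
      fix p assume p: "p \<in> C"
      show "p \<in> chords L"
      proof (cases "p \<in> loose")
        case True
        then show ?thesis using Fam(3)[OF True] chords_mono[of "Fam (visible p)" L] by (auto simp: L_def)
      next
        case False
        then show ?thesis using p chords_mono[of "rigid C" L] by (auto simp: loose_def L_def)
      qed
    qed
  qed
  ultimately show ?thesis using sub_triangulationI by blast
qed

end

section \<open>Hausdorff limits\<close>

lemma bounded_infdist: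
  fixes A B :: "complex set" assumes "A \<subseteq> disc" "B \<subseteq> disc" "B \<noteq> {}"
  shows "bdd_above ((\<lambda>a. infdist a B) ` A)"
proof -
  obtain b where b: "b \<in> B" using assms(3) by blast
  have "infdist a B \<le> 1 / pi" if "a \<in> A" for a
  proof -
    have "infdist a B \<le> dist a b" using b by (rule infdist_le)
    also have "\<dots> \<le> norm a + norm b" by (simp add: dist_norm norm_triangle_ineq4)
    also have "\<dots> \<le> 1 / (2 * pi) + 1 / (2 * pi)"
      using that b assms by (intro add_mono) (auto simp: disc_def)
    finally show ?thesis by simp
  qed
  then show ?thesis by (intro bdd_aboveI2)
qed

lemma infdist_le_hausdorff:
  assumes "A \<subseteq> disc" "B \<subseteq> disc" "A \<noteq> {}" "B \<noteq> {}"
  shows "a \<in> A \<Longrightarrow> infdist a B \<le> hausdorff_dist A B" "b \<in> B \<Longrightarrow> infdist b A \<le> hausdorff_dist A B"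
  using cSUP_upper[OF _ bounded_infdist[OF assms(1,2,4)], of a] cSUP_upper[OF _ bounded_infdist[OF assms(2,1,3)], of b]
  unfolding hausdorff_dist_def by auto

lemma hausdorff_dist_le:
  assumes "A \<noteq> {}" "B \<noteq> {}" "\<And>a. a \<in> A \<Longrightarrow> infdist a B \<le> e" "\<And>b. b \<in> B \<Longrightarrow> infdist b A \<le> e"
  shows "hausdorff_dist A B \<le> e"
  unfolding hausdorff_dist_def using assms by (intro max.boundedI cSUP_least) auto

lemma hausdorff_dist_nonneg:
  assumes "A \<subseteq> disc" "B \<subseteq> disc" "A \<noteq> {}" "B \<noteq> {}" shows "0 \<le> hausdorff_dist A B"
  using infdist_le_hausdorff(1)[OF assms] infdist_nonneg assms(3) order_trans by blast

text \<open>The sum of a convex set and a ball is convex, so the \<open>e\<close>-neighbourhood of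
  the hull of \<open>A\<close> contains the hull of \<open>C\<close> once it contains
  \<open>C\<close>.\<close>

lemma hull_near:
  fixes A C :: "'a::euclidean_space set"
  assumes "\<And>b. b \<in> C \<Longrightarrow> \<exists>a\<in>A. dist a b < e" "p \<in> convex hull C"
  shows "\<exists>q\<in>convex hull A. dist q p < e"
proof -
  let ?N = "\<Union>x\<in>convex hull A. \<Union>y\<in>ball 0 e. {x + y}"
  have "C \<subseteq> ?N"
  proof
    fix b assume "b \<in> C"
    then obtain a where "a \<in> A" "dist a b < e" using assms(1) by blast
    then have "a \<in> convex hull A" "b - a \<in> ball 0 e" "b = a + (b - a)"
      by (auto simp: hull_inc dist_norm norm_minus_commute)
    then show "b \<in> ?N" by blast
  qed
  then have "convex hull C \<subseteq> ?N"
    by (intro hull_minimal convex_sums) auto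
  then obtain q y where "q \<in> convex hull A" "norm y < e" "p = q + y" using assms(2) by auto
  then show ?thesis by (intro bexI[of _ q]) (auto simp: dist_norm)
qed

lemma closest_point_not_interior:
  fixes S :: "'a::euclidean_space set"
  assumes "closed S" "S \<noteq> {}" "p \<notin> S" shows "closest_point S p \<notin> interior S"
proof
  assume i: "closest_point S p \<in> interior S"
  then have "affine hull S = UNIV" "rel_interior S = interior S"
    using affine_hull_nonempty_interior rel_interior_nonempty_interior by blast+
  then have "closest_point S p \<in> rel_frontier S"
    using assms interior_subset[of S] by (intro closest_point_in_rel_frontier) auto
  then show False using i \<open>rel_interior S = interior S\<close> by (simp add: rel_frontier_def)
qed

text \<open>Tychonoff's theorem replaces an explicit diagonal argument: a countable power of
  \<open>K\<close> is compact, and convergence there is coordinatewise.\<close>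

lemma sequence_diagonal:
  fixes E :: "nat \<Rightarrow> nat \<Rightarrow> 'a::metric_space"
  assumes "compact K" "\<And>n i. E n i \<in> K"
  obtains r l where "strict_mono (r :: nat \<Rightarrow> nat)" "\<And>i. (\<lambda>n. E (r n) i) \<longlonglongrightarrow> l i"
proof -
  have "compactin (product_topology (\<lambda>_. euclidean) UNIV) (PiE UNIV (\<lambda>_::nat. K))"
    unfolding compactin_PiE using assms(1) by simp
  then have "compact (PiE UNIV (\<lambda>_::nat. K))" by (simp add: euclidean_product_topology)
  moreover have "E n \<in> PiE UNIV (\<lambda>_. K)" for n using assms(2) by auto
  ultimately obtain l r where lr: "strict_mono (r :: nat \<Rightarrow> nat)" "(E \<circ> r) \<longlonglongrightarrow> l"
    unfolding compact_def by metis
  have "(\<lambda>n. E (r n) i) \<longlonglongrightarrow> l i" for i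
  proof -
    have "continuous_on UNIV (\<lambda>f :: nat \<Rightarrow> 'a. f i)" by simp
    then have "isCont (\<lambda>f. f i) l" unfolding continuous_on_eq_continuous_at[OF open_UNIV] by blast
    then show ?thesis using isCont_tendsto_compose[OF _ lr(2)] by (simp add: o_def)
  qed
  then show thesis using that lr(1) by blast
qed

locale converging =
  fixes Cs :: "nat \<Rightarrow> complex set" and C :: "complex set"
  assumes closed_C: "closed C" and nonempty_C: "C \<noteq> {}" and C_subset_disc: "C \<subseteq> disc"
    and sub: "\<And>n. sub_triangulation (Cs n)" and lim: "hausdorff_tendsto Cs C"
begin

lemma Cs_basic: "closed (Cs n)" "Cs n \<noteq> {}" "Cs n \<subseteq> disc"
  using sub[of n] by (auto simp: sub_triangulation_def)

lemma hausdorff_dist_tendsto: "(\<lambda>n. hausdorff_dist (Cs n) C) \<longlonglongrightarrow> 0"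
  using lim by (simp add: hausdorff_tendsto_def)

lemma limit_in_C:
  assumes "strict_mono r" "\<And>n. x n \<in> Cs (r n)" "x \<longlonglongrightarrow> l" shows "l \<in> C"
proof -
  have "(\<lambda>n. infdist (x n) C) \<longlonglongrightarrow> infdist l C" using assms(3) by (intro tendsto_infdist)
  moreover have "(\<lambda>n. infdist (x n) C) \<longlonglongrightarrow> 0"
  proof (rule tendsto_sandwich[of "\<lambda>_. 0" _ _ "\<lambda>n. hausdorff_dist (Cs (r n)) C"])
    show "(\<lambda>n. hausdorff_dist (Cs (r n)) C) \<longlonglongrightarrow> 0"
      using LIMSEQ_subseq_LIMSEQ[OF hausdorff_dist_tendsto assms(1)] by (simp add: o_def)
    show "eventually (\<lambda>n. infdist (x n) C \<le> hausdorff_dist (Cs (r n)) C) sequentially"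
      using infdist_le_hausdorff(1)[OF Cs_basic(3) C_subset_disc Cs_basic(2) nonempty_C assms(2)] by simp
  qed (auto simp: infdist_nonneg)
  ultimately have "infdist l C = 0" using LIMSEQ_unique by blast
  then show ?thesis using in_closed_iff_infdist_zero[OF closed_C nonempty_C] by simp
qed

lemma approximating_sequence:
  assumes "c \<in> C" obtains x where "\<And>n. x n \<in> Cs n" "x \<longlonglongrightarrow> c"
proof -
  have "\<exists>x\<in>Cs n. infdist c (Cs n) = dist c x" for n
    using infdist_attains_inf[OF Cs_basic(1,2)] by metis
  then obtain x where x: "\<And>n. x n \<in> Cs n" "\<And>n. infdist c (Cs n) = dist c (x n)" by metis
  have "dist (x n) c \<le> hausdorff_dist (Cs n) C" for n
    using infdist_le_hausdorff(2)[OF Cs_basic(3) C_subset_disc Cs_basic(2) nonempty_C assms, of n] x(2)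
    by (simp add: dist_commute)
  then have "x \<longlonglongrightarrow> c"
    using hausdorff_dist_tendsto unfolding tendsto_dist_iff[of x]
    by (intro tendsto_sandwich[of "\<lambda>_. 0" "\<lambda>n. dist (x n) c" _ "\<lambda>n. hausdorff_dist (Cs n) C"]) auto
  then show thesis using that x by blast
qed

lemma eventually_near:
  assumes "0 < e"
  shows "eventually (\<lambda>n. (\<forall>a\<in>Cs n. \<exists>b\<in>C. dist a b < e) \<and> (\<forall>b\<in>C. \<exists>a\<in>Cs n. dist a b < e)) sequentially"
proof -
  have near: "\<exists>b\<in>B. dist a b < e" if "closed B" "B \<noteq> {}" "infdist a B < e" for a :: complex and B
    using infdist_attains_inf[OF that(1,2)] that(3) by metis
  have "eventually (\<lambda>n. hausdorff_dist (Cs n) C < e) sequentially"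
    using order_tendstoD(2)[OF hausdorff_dist_tendsto assms] .
  then show ?thesis
  proof eventually_elim
    case (elim n)

    show ?case
    proof (intro conjI ballI)
      fix a assume "a \<in> Cs n"
      then have "infdist a C < e" using infdist_le_hausdorff(1)[OF Cs_basic(3) C_subset_disc Cs_basic(2) nonempty_C, of a n] elim by simp
      then show "\<exists>b\<in>C. dist a b < e" using near[OF closed_C nonempty_C] by blast
    next
      fix b assume "b \<in> C"
      then have "infdist b (Cs n) < e" using infdist_le_hausdorff(2)[OF Cs_basic(3) C_subset_disc Cs_basic(2) nonempty_C, of b n] elim by simp
      then show "\<exists>a\<in>Cs n. dist a b < e" using near[OF Cs_basic(1,2)] by (metis dist_commute)
    qed
  qed
qed

lemma limit_chords:
  obtains L where "L \<subseteq> circ \<times> circ" "ncr L" "chords L = C"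
proof -
  have "\<exists>L. L \<subseteq> circ \<times> circ \<and> ncr L \<and> chords L = Cs n" for n
    using sub_triangulation_chords[OF sub] by metis
  then obtain Ls where Ls: "\<And>n. Ls n \<subseteq> circ \<times> circ" "\<And>n. ncr (Ls n)" "\<And>n. chords (Ls n) = Cs n" by metis
  obtain D where D: "countable D" "D \<subseteq> C" "C \<subseteq> closure D" using separable .
  have Dne: "D \<noteq> {}" using D(3) nonempty_C by auto
  define d where "d = from_nat_into D"
  have d: "d i \<in> C" "range d = D" for i
    using D Dne from_nat_into[of D i] range_from_nat_into[of D] by (auto simp: d_def)
  have "\<exists>x. (\<forall>n. x n \<in> Cs n) \<and> x \<longlonglongrightarrow> d i" for i using approximating_sequence[OF d(1)] by metis
  then obtain x where x: "\<And>i n. x i n \<in> Cs n" "\<And>i. x i \<longlonglongrightarrow> d i" by metis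
  have "\<exists>e. e \<in> Ls n \<and> x i n \<in> closed_segment (fst e) (snd e)" for n i
    using x(1)[of i n] unfolding Ls(3)[symmetric] chords_def by force
  then obtain E where E: "\<And>n i. E n i \<in> Ls n" "\<And>n i. x i n \<in> closed_segment (fst (E n i)) (snd (E n i))" by metis
  have "E n i \<in> circ \<times> circ" for n i using E(1) Ls(1) by blast
  then obtain r l where r: "strict_mono (r :: nat \<Rightarrow> nat)" and l: "\<And>i. (\<lambda>n. E (r n) i) \<longlonglongrightarrow> l i"
    using sequence_diagonal[OF compact_Times[OF compact_circ compact_circ]] by metis
  note l1 = tendsto_fst[OF l] and l2 = tendsto_snd[OF l]
  \<comment> \<open>The limits \<open>l i\<close> only serve the countable dense set. With the
    closure the union of the chords is compact, and so it contains the closure of that set.\<close>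
  define L where "L = closure (range l)"
  have "l i \<in> circ \<times> circ" for i
    by (rule closed_sequentially[OF closed_Times[OF compact_imp_closed compact_imp_closed] _ l])
      (use \<open>\<And>n i. E n i \<in> circ \<times> circ\<close> compact_circ in auto)
  then have Lc: "L \<subseteq> circ \<times> circ"
    unfolding L_def by (intro closure_minimal closed_Times compact_imp_closed compact_circ) blast
  have "ncr (range l)" unfolding ncr_def
  proof clarify
    fix a b c e i j assume eq: "(a, b) = l i" "(c, e) = l j"
    have "(\<lambda>n. orient (fst (E (r n) i)) (snd (E (r n) i)) (fst (E (r n) j)) * orient (fst (E (r n) i)) (snd (E (r n) i)) (snd (E (r n) j)))
      \<longlonglongrightarrow> orient (fst (l i)) (snd (l i)) (fst (l j)) * orient (fst (l i)) (snd (l i)) (snd (l j))"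
      by (intro tendsto_intros l1 l2)
    moreover have "0 \<le> orient (fst (E (r n) i)) (snd (E (r n) i)) (fst (E (r n) j)) * orient (fst (E (r n) i)) (snd (E (r n) i)) (snd (E (r n) j))" for n
      using ncrD[OF Ls(2)] E(1) by (metis prod.collapse)
    ultimately have "0 \<le> orient (fst (l i)) (snd (l i)) (fst (l j)) * orient (fst (l i)) (snd (l i)) (snd (l j))"
      by (intro tendsto_lowerbound) auto
    then show "0 \<le> orient a b c * orient a b e" by (simp flip: eq)
  qed
  then have "ncr L" unfolding L_def by (rule ncr_closure)
  moreover have "chords L = C"
  proof
    have "closed_segment (fst (l i)) (snd (l i)) \<subseteq> C" for i
    proof
      fix q assume "q \<in> closed_segment (fst (l i)) (snd (l i))"
      then obtain s where s: "0 \<le> s" "s \<le> 1" "q = (1 - s) *\<^sub>R fst (l i) + s *\<^sub>R snd (l i)" by (auto simp: in_segment)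
      have "(1 - s) *\<^sub>R fst (E (r n) i) + s *\<^sub>R snd (E (r n) i) \<in> Cs (r n)" for n
      proof -
        have "(1 - s) *\<^sub>R fst (E (r n) i) + s *\<^sub>R snd (E (r n) i) \<in> closed_segment (fst (E (r n) i)) (snd (E (r n) i))"
          using s unfolding in_segment by blast
        then show ?thesis unfolding Ls(3)[symmetric] chords_def using E(1)[of "r n" i] by force
      qed
      moreover have "(\<lambda>n. (1 - s) *\<^sub>R fst (E (r n) i) + s *\<^sub>R snd (E (r n) i)) \<longlonglongrightarrow> q"
        unfolding s(3) by (intro tendsto_intros l1 l2)
      ultimately show "q \<in> C" by (rule limit_in_C[OF r])
    qed
    then have "range l \<subseteq> {(a, b). closed_segment a b \<subseteq> C}" unfolding case_prod_unfold by blast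
    then have "L \<subseteq> {(a, b). closed_segment a b \<subseteq> C}"
      unfolding L_def by (intro closure_minimal closed_pairs_segment_subset closed_C)
    then show "chords L \<subseteq> C" by (auto simp: chords_def)
    have "d i \<in> chords L" for i
    proof -
      have "(\<lambda>n. x i (r n)) \<longlonglongrightarrow> d i" using LIMSEQ_subseq_LIMSEQ[OF x(2) r] by (simp add: o_def)
      then have "d i \<in> closed_segment (fst (l i)) (snd (l i))" by (rule chord_limit[OF E(2) _ l1 l2])
      moreover have "l i \<in> L" unfolding L_def using closure_subset[of "range l"] by auto
      ultimately show ?thesis unfolding chords_def by force
    qed
    then have "D \<subseteq> chords L" using d(2) by blast
    moreover have "closed (chords L)"
      using compact_chords[OF _ Lc] compact_imp_closed by (simp add: L_def)
    ultimately show "C \<subseteq> chords L" using D(3) closure_minimal by blast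
  qed
  ultimately show thesis using that Lc by blast
qed

text \<open>Eventually a fixed ball around \<open>p\<close> misses \<open>Cs n\<close>. If
  \<open>p\<close> were outside the hull of \<open>Cs n\<close>, the nearest point of the hull would
  be in \<open>Cs n\<close> and inside that ball. So \<open>p\<close> is in a triangle whose sides
  avoid the ball; the uniform radius later keeps the triangles from degenerating.\<close>

lemma eventually_triangle:
  assumes p: "p \<in> convex hull C" "p \<notin> C"
  obtains \<delta> where "0 < \<delta>"
    "eventually (\<lambda>n. \<exists>a b c. a \<in> circ \<and> b \<in> circ \<and> c \<in> circ \<and> 0 < orient a b c \<and> ball p \<delta> \<subseteq> tri a b c \<and>
       tri a b c \<inter> Cs n = {} \<and> closed_segment a b \<subseteq> Cs n \<and> closed_segment b c \<subseteq> Cs n \<and> closed_segment c a \<subseteq> Cs n) sequentially"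
proof -
  obtain e where e: "0 < e" "ball p e \<subseteq> - C" using closed_C p(2) open_Compl openE by (metis ComplI)
  have "eventually (\<lambda>n. \<exists>a b c. a \<in> circ \<and> b \<in> circ \<and> c \<in> circ \<and> 0 < orient a b c \<and> ball p (e / 2) \<subseteq> tri a b c \<and>
       tri a b c \<inter> Cs n = {} \<and> closed_segment a b \<subseteq> Cs n \<and> closed_segment b c \<subseteq> Cs n \<and> closed_segment c a \<subseteq> Cs n) sequentially"
    using eventually_near[OF half_gt_zero[OF e(1)]]
  proof eventually_elim
    case (elim n)
    interpret T: tri1_set "Cs n" using sub_triangulation_tri1_set[OF sub] .
    have dis: "ball p (e / 2) \<inter> Cs n = {}"
    proof (rule ccontr)
      assume "\<not> ?thesis"
      then obtain a where a: "a \<in> Cs n" "dist p a < e / 2" by auto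
      then obtain b where "b \<in> C" "dist a b < e / 2" using elim by blast
      then have "dist p b < e" using a(2) dist_triangle[of p b a] by simp
      then show False using e(2) \<open>b \<in> C\<close> by auto
    qed
    have "p \<in> convex hull (Cs n)"
    proof (rule ccontr)
      assume np: "p \<notin> convex hull (Cs n)"
      obtain q where q: "q \<in> convex hull Cs n" "dist q p < e / 2"
        using hull_near[of C "Cs n" "e / 2" p] elim p(1) by blast
      define z where "z = closest_point (convex hull Cs n) p"
      have z: "z \<in> convex hull Cs n" "dist p z \<le> dist p q"
        using closest_point_in_set[OF T.closed_hull, of p] closest_point_le[OF T.closed_hull q(1), of p] q(1)
        unfolding z_def by (metis empty_iff)+
      have "z \<in> Cs n"
        using T.hull_boundary_in_C[OF z(1)] closest_point_not_interior[OF T.closed_hull _ np] q(1)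
        unfolding z_def by (metis empty_iff)
      moreover have "z \<in> ball p (e / 2)" using z(2) q(2) by (simp add: dist_commute)
      ultimately show False using dis by blast
    qed
    moreover have "p \<in> ball p (e / 2)" using e(1) by simp
    then have "p \<notin> Cs n" using dis by blast
    ultimately have "p \<in> \<Union>(Delta (Cs n))" unfolding Delta_def Union_components by simp
    then obtain t where "t \<in> Delta (Cs n)" "p \<in> t" by blast
    then obtain a b c where t: "p \<in> tri a b c" "0 < orient a b c" "(a, b) \<in> rigid (Cs n)" "(b, c) \<in> rigid (Cs n)" "(c, a) \<in> rigid (Cs n)"
      "tri a b c \<inter> Cs n = {}" using T.Delta_tri by metis
    have "ball p (e / 2) \<subseteq> tri a b c"
    proof (rule ccontr)
      assume "\<not> ?thesis"
      then have "ball p (e / 2) \<inter> frontier (tri a b c) \<noteq> {}"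
        using t(1) \<open>p \<in> ball p (e / 2)\<close> by (intro connected_Int_frontier connected_ball) blast+
      then show False using dis rigidD(3)[OF t(3)] rigidD(3)[OF t(4)] rigidD(3)[OF t(5)] unfolding frontier_tri[OF t(2)] by blast
    qed
    then show ?case
      using t rigidD[OF t(3)] rigidD[OF t(4)] by (intro exI[of _ a] exI[of _ b] exI[of _ c]) (auto dest: rigidD(3)[OF t(5), THEN subsetD])
  qed
  then show thesis using that[of "e / 2"] e(1) by auto
qed

lemma limit_triangle:
  assumes p: "p \<in> convex hull C" "p \<notin> C"
  obtains a b c where "a \<in> circ" "b \<in> circ" "c \<in> circ" "0 < orient a b c" "p \<in> tri a b c" "tri a b c \<inter> C = {}"
    "closed_segment a b \<subseteq> C" "closed_segment b c \<subseteq> C" "closed_segment c a \<subseteq> C"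
proof -
  obtain \<delta> where \<delta>: "0 < \<delta>"
    "eventually (\<lambda>n. \<exists>a b c. a \<in> circ \<and> b \<in> circ \<and> c \<in> circ \<and> 0 < orient a b c \<and> ball p \<delta> \<subseteq> tri a b c \<and>
       tri a b c \<inter> Cs n = {} \<and> closed_segment a b \<subseteq> Cs n \<and> closed_segment b c \<subseteq> Cs n \<and> closed_segment c a \<subseteq> Cs n) sequentially"
    using eventually_triangle[OF p] .
  then obtain N where N: "\<And>n. N \<le> n \<Longrightarrow> \<exists>a b c. a \<in> circ \<and> b \<in> circ \<and> c \<in> circ \<and> 0 < orient a b c \<and> ball p \<delta> \<subseteq> tri a b c \<and>
       tri a b c \<inter> Cs n = {} \<and> closed_segment a b \<subseteq> Cs n \<and> closed_segment b c \<subseteq> Cs n \<and> closed_segment c a \<subseteq> Cs n"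
    unfolding eventually_sequentially by blast
  have "\<exists>e. fst e \<in> circ \<and> fst (snd e) \<in> circ \<and> snd (snd e) \<in> circ \<and> 0 < orient (fst e) (fst (snd e)) (snd (snd e))
      \<and> ball p \<delta> \<subseteq> tri (fst e) (fst (snd e)) (snd (snd e)) \<and> tri (fst e) (fst (snd e)) (snd (snd e)) \<inter> Cs (N + n) = {}
      \<and> closed_segment (fst e) (fst (snd e)) \<subseteq> Cs (N + n) \<and> closed_segment (fst (snd e)) (snd (snd e)) \<subseteq> Cs (N + n)
      \<and> closed_segment (snd (snd e)) (fst e) \<subseteq> Cs (N + n)" for n
    using N[of "N + n"] by (metis fst_conv snd_conv le_add1)
  then obtain E where E: "\<And>n. fst (E n) \<in> circ \<and> fst (snd (E n)) \<in> circ \<and> snd (snd (E n)) \<in> circ \<and> 0 < orient (fst (E n)) (fst (snd (E n))) (snd (snd (E n)))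
      \<and> ball p \<delta> \<subseteq> tri (fst (E n)) (fst (snd (E n))) (snd (snd (E n))) \<and> tri (fst (E n)) (fst (snd (E n))) (snd (snd (E n))) \<inter> Cs (N + n) = {}
      \<and> closed_segment (fst (E n)) (fst (snd (E n))) \<subseteq> Cs (N + n) \<and> closed_segment (fst (snd (E n))) (snd (snd (E n))) \<subseteq> Cs (N + n)
      \<and> closed_segment (snd (snd (E n))) (fst (E n)) \<subseteq> Cs (N + n)" by metis
  have "E n \<in> circ \<times> (circ \<times> circ)" for n using E[of n] by (metis mem_Times_iff)
  moreover have "compact (circ \<times> (circ \<times> circ))" by (intro compact_Times compact_circ)
  ultimately obtain l r0 where l: "l \<in> circ \<times> (circ \<times> circ)" "strict_mono (r0 :: nat \<Rightarrow> nat)" "(E \<circ> r0) \<longlonglongrightarrow> l"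
    unfolding compact_def by metis
  obtain a b c where labc: "l = (a, b, c)" by (cases l) auto
  define A B D where "A n = fst (E (r0 n))" and "B n = fst (snd (E (r0 n)))" and "D n = snd (snd (E (r0 n)))" for n
  define r where "r n = N + r0 n" for n
  have r: "strict_mono r" using l(2) by (simp add: strict_mono_def r_def)
  have lim3: "A \<longlonglongrightarrow> a" "B \<longlonglongrightarrow> b" "D \<longlonglongrightarrow> c"
    using tendsto_fst[OF l(3)] tendsto_fst[OF tendsto_snd[OF l(3)]] tendsto_snd[OF tendsto_snd[OF l(3)]]
    by (simp_all add: labc A_def[abs_def] B_def[abs_def] D_def[abs_def] o_def)
  have T: "A n \<in> circ" "B n \<in> circ" "D n \<in> circ" "0 < orient (A n) (B n) (D n)" "ball p \<delta> \<subseteq> tri (A n) (B n) (D n)"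
    "tri (A n) (B n) (D n) \<inter> Cs (r n) = {}" "closed_segment (A n) (B n) \<subseteq> Cs (r n)"
    "closed_segment (B n) (D n) \<subseteq> Cs (r n)" "closed_segment (D n) (A n) \<subseteq> Cs (r n)" for n
    using E[of "r0 n"] by (simp_all add: A_def B_def D_def r_def)
  have circ: "a \<in> circ" "b \<in> circ" "c \<in> circ" using l(1) labc by auto
  have ballpos: "ball p \<delta> \<subseteq> {q. 0 \<le> orient a b q}" "ball p \<delta> \<subseteq> {q. 0 \<le> orient b c q}" "ball p \<delta> \<subseteq> {q. 0 \<le> orient c a q}"
  proof -
    have "0 \<le> orient (A n) (B n) q \<and> 0 \<le> orient (B n) (D n) q \<and> 0 \<le> orient (D n) (A n) q" if "q \<in> ball p \<delta>" for q n
      using T(5)[of n] that by (auto simp: tri_def subset_iff less_imp_le)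
    then show "ball p \<delta> \<subseteq> {q. 0 \<le> orient a b q}" "ball p \<delta> \<subseteq> {q. 0 \<le> orient b c q}" "ball p \<delta> \<subseteq> {q. 0 \<le> orient c a q}"
      using tendsto_lowerbound[OF tendsto_orient[OF lim3(1,2) tendsto_const], of 0]
        tendsto_lowerbound[OF tendsto_orient[OF lim3(2,3) tendsto_const], of 0]
        tendsto_lowerbound[OF tendsto_orient[OF lim3(3,1) tendsto_const], of 0]
      by auto
  qed
  have pin: "p \<in> interior (ball p \<delta>)" using \<delta>(1) by simp
  \<comment> \<open>Two opposite half-planes would confine the ball to a line. This excludes that
    exactly two vertices merge in the limit.\<close>
  have opp: "u = v" if "ball p \<delta> \<subseteq> {q. 0 \<le> orient u v q}" "ball p \<delta> \<subseteq> {q. 0 \<le> orient v u q}" for u v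
    using orient_interior_pos[OF pin that(1)] orient_interior_pos[OF pin that(2)] orient_swap[of u v p] by force
  have norm_p: "norm p < 1 / (2 * pi)"
  proof -
    have "ball p \<delta> \<subseteq> disc" using T(5)[of 0] tri_subset_disc(3)[OF T(1-4), of 0] by blast
    then have "p \<in> interior disc" using \<delta>(1) by (meson centre_in_ball interior_maximal open_ball subsetD)
    then show ?thesis by (simp add: disc_def)
  qed
  \<comment> \<open>If all three vertices tended to \<open>a\<close>, the triangles would shrink to
    \<open>a\<close>, giving \<open>p = a\<close> on the circle.\<close>
  have not_all: "\<not> (a = b \<and> b = c)"
  proof
    assume eq: "a = b \<and> b = c"
    have "dist p a \<le> e" if "0 < e" for e
    proof -
      have "eventually (\<lambda>n. dist (A n) a < e \<and> dist (B n) a < e \<and> dist (D n) a < e) sequentially"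
        using tendstoD[OF lim3(1) that] tendstoD[OF lim3(2) that] tendstoD[OF lim3(3) that] eq
        by (auto intro: eventually_conj)
      then obtain n where n: "dist (A n) a < e" "dist (B n) a < e" "dist (D n) a < e"
        using eventually_happens sequentially_bot by blast
      have "tri (A n) (B n) (D n) \<subseteq> convex hull {A n, B n, D n}" by (rule tri_subset_hull[OF T(4)])
      also have "\<dots> \<subseteq> cball a e" using n by (intro hull_minimal) (auto simp: dist_commute)
      finally have "p \<in> cball a e" using subsetD[OF T(5)[of n], of p] \<delta>(1) by auto
      then show ?thesis by (simp add: dist_commute)
    qed
    then have "p = a" by (metis dist_le_zero_iff field_le_epsilon add_0)
    then show False using norm_p circ by (simp add: circ_def)
  qed
  have ne: "a \<noteq> b" "b \<noteq> c" "c \<noteq> a" using not_all opp ballpos by metis+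
  have p3: "0 < orient a b p" "0 < orient b c p" "0 < orient c a p"
    using orient_interior_pos[OF pin ballpos(1) ne(1)] orient_interior_pos[OF pin ballpos(2) ne(2)]
      orient_interior_pos[OF pin ballpos(3) ne(3)] by auto
  have "orient a b c = orient a b p + orient b c p + orient c a p" by (simp add: orient_def algebra_simps)
  then have o: "0 < orient a b c" using p3 by simp
  have seg: "closed_segment u v \<subseteq> C" if uv: "U \<longlonglongrightarrow> u" "W \<longlonglongrightarrow> v" and in_Cs: "\<And>n. closed_segment (U n) (W n) \<subseteq> Cs (r n)" for u v U W
  proof
    fix q assume "q \<in> closed_segment u v"
    then obtain s where s: "0 \<le> s" "s \<le> 1" "q = (1 - s) *\<^sub>R u + s *\<^sub>R v" by (auto simp: in_segment)
    have "(1 - s) *\<^sub>R U n + s *\<^sub>R W n \<in> Cs (r n)" for n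
      using in_Cs[of n] s(1,2) unfolding in_segment subset_iff by blast
    moreover have "(\<lambda>n. (1 - s) *\<^sub>R U n + s *\<^sub>R W n) \<longlonglongrightarrow> q" unfolding s(3) by (intro tendsto_intros uv)
    ultimately show "q \<in> C" by (rule limit_in_C[OF r])
  qed
  have dis: "tri a b c \<inter> C = {}"
  proof (rule ccontr)
    assume "\<not> ?thesis"
    then obtain q where q: "q \<in> tri a b c" "q \<in> C" by blast
    obtain x where x: "\<And>n. x n \<in> Cs n" "x \<longlonglongrightarrow> q" using approximating_sequence[OF q(2)] by metis
    have xr: "(\<lambda>n. x (r n)) \<longlonglongrightarrow> q" using LIMSEQ_subseq_LIMSEQ[OF x(2) r] by (simp add: o_def)
    have q3: "0 < orient a b q" "0 < orient b c q" "0 < orient c a q" using q(1) by (auto simp: tri_def)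
    have "eventually (\<lambda>n. 0 < orient (A n) (B n) (x (r n))) sequentially"
      "eventually (\<lambda>n. 0 < orient (B n) (D n) (x (r n))) sequentially"
      "eventually (\<lambda>n. 0 < orient (D n) (A n) (x (r n))) sequentially"
      using order_tendstoD(1)[OF tendsto_orient[OF lim3(1,2) xr] q3(1)]
        order_tendstoD(1)[OF tendsto_orient[OF lim3(2,3) xr] q3(2)]
        order_tendstoD(1)[OF tendsto_orient[OF lim3(3,1) xr] q3(3)] by auto
    then have "eventually (\<lambda>n. x (r n) \<in> tri (A n) (B n) (D n)) sequentially"
      by eventually_elim (simp add: tri_def)
    then obtain n where "x (r n) \<in> tri (A n) (B n) (D n)" using eventually_happens sequentially_bot by blast
    then show False using T(6)[of n] x(1)[of "r n"] by blast
  qed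
  show thesis
    using that[OF circ o _ dis seg[OF lim3(1,2) T(7)] seg[OF lim3(2,3) T(8)] seg[OF lim3(3,1) T(9)]] p3
    by (simp add: tri_def)
qed

lemma limit_sub_triangulation: "sub_triangulation C"
proof -
  obtain L where L: "L \<subseteq> circ \<times> circ" "ncr L" "chords L = C" using limit_chords .
  have "Tri1 C" unfolding Tri1_def
  proof
    fix x assume x: "x \<in> Delta C"
    then have xc: "x \<in> components (convex hull C - C)" by (simp add: Delta_def)
    obtain p where p: "p \<in> x" using in_components_nonempty[OF xc] by blast
    then have pC: "p \<in> convex hull C" "p \<notin> C" using in_components_subset[OF xc] by auto
    obtain a b c where t: "a \<in> circ" "b \<in> circ" "c \<in> circ" "0 < orient a b c" "p \<in> tri a b c" "tri a b c \<inter> C = {}"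
      "closed_segment a b \<subseteq> C" "closed_segment b c \<subseteq> C" "closed_segment c a \<subseteq> C"
      using limit_triangle[OF pC] .
    have "convex hull {a, b, c} \<subseteq> convex hull C" using t(7-9) by (intro hull_mono) auto
    then have "tri a b c \<subseteq> convex hull C - C" using tri_subset_hull[OF t(4)] t(6) by blast
    then have "tri a b c \<in> components (convex hull C - C)"
      using t by (intro tri_in_components) auto
    then have "x = tri a b c" using components_eq[OF xc] p t(5) by blast
    then show "x \<in> open_triangles circ" using t(1-4) unfolding open_triangles_iff by blast
  qed
  then have "tri1_set C"
    using closed_C nonempty_C C_subset_disc chords_hull_circ[OF L(1,3)] by unfold_locales
  then show ?thesis using tri1_set.sub_triangulationI L by blast
qed

end

section \<open>Approximation by finite families\<close>

lemma closed_convex_contains_centre: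
  fixes S :: "'a::euclidean_space set"
  assumes S: "convex S" "closed S" and near: "\<And>y. y \<in> ball q e \<Longrightarrow> \<exists>x\<in>S. dist x y < m" and "m < e" "0 < e"
  shows "q \<in> S"
proof (rule ccontr)
  assume "q \<notin> S"
  then obtain a b where ab: "inner a q < b" "\<And>x. x \<in> S \<Longrightarrow> b < inner a x"
    using separating_hyperplane_closed_point[OF S] by blast
  have "q \<in> ball q e" using assms(5) by simp
  then obtain x0 where "x0 \<in> S" using near by blast
  then have a0: "a \<noteq> 0" using ab by fastforce
  \<comment> \<open>Any \<open>k\<close> with \<open>0 <= k\<close>, \<open>m <= k\<close> and
    \<open>k < e\<close> works: the point \<open>y\<close> at distance \<open>k\<close> from
    \<open>q\<close>, directly away from \<open>S\<close>, is farther than \<open>m\<close> from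
    \<open>S\<close>.\<close>
  define k where "k = max 0 ((m + e) / 2)"
  have k: "0 \<le> k" "k < e" "m \<le> k" using assms(4,5) unfolding k_def max_def by auto
  define y where "y = q - (k / norm a) *\<^sub>R a"
  have "dist q y = k" using a0 k by (simp add: y_def dist_norm)
  then obtain x where x: "x \<in> S" "dist x y < m" using near[of y] k by auto
  have "inner a (x - y) = inner a x - inner a q + k * norm a"
    using a0 by (simp add: y_def inner_diff_right power2_norm_eq_inner[symmetric] power2_eq_square)
  then have "k * norm a < inner a (x - y)" using ab x(1) by fastforce
  also have "\<dots> \<le> norm a * norm (x - y)" by (rule norm_cauchy_schwarz)
  finally have "k * norm a < norm (x - y) * norm a" by (simp add: mult.commute)
  then have "k < dist x y" using a0 by (simp add: dist_norm)
  then show False using x(2) k(3) by simp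
qed

lemma hull_perturbation:
  fixes A B :: "'a::euclidean_space set"
  assumes A: "ball q e \<subseteq> convex hull A" and near: "\<And>a. a \<in> A \<Longrightarrow> \<exists>b\<in>B. dist b a < m" and B: "finite B"
    and m: "m < e" "0 < e"
  shows "q \<in> interior (convex hull B)"
proof -
  define d where "d = (e - m) / 2"
  \<comment> \<open>Moving the centre by \<open>d'\<close> leaves the radius \<open>e - d'\<close>,
    still larger than \<open>m\<close> because of \<open>d\<close> and positive because of
    \<open>e / 2\<close>.\<close>
  define d' where "d' = min d (e / 2)"
  have d: "0 < d" "0 < d'" using m by (auto simp: d_def d'_def)
  have "ball q d' \<subseteq> convex hull B"
  proof
    fix p assume p: "p \<in> ball q d'"
    show "p \<in> convex hull B"
    proof (rule closed_convex_contains_centre)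
      show "closed (convex hull B)" using B by (simp add: compact_imp_closed finite_imp_compact_convex_hull)
      show "m < e - d'" using m by (simp add: d'_def d_def min_def field_simps)
      show "0 < e - d'" using m by (simp add: d'_def min_def)
      fix y assume "y \<in> ball p (e - d')"
      then have "y \<in> ball q e" using p dist_triangle[of q y p] by auto
      then show "\<exists>x\<in>convex hull B. dist x y < m" using A by (intro hull_near[OF near]) auto
    qed simp
  qed
  then show ?thesis using d mem_interior by blast
qed

lemma interior_hull3_orient:
  assumes "q \<in> interior (convex hull {a, b, c})" shows "orient a b c \<noteq> 0"
proof
  assume 0: "orient a b c = 0"
  have no: "x = y" if "orient x y z = 0" "{x, y, z} = {a, b, c}" for x y z
  proof (rule ccontr)
    assume ne: "x \<noteq> y"
    have "convex hull {x, y, z} \<subseteq> {p. 0 \<le> orient x y p}" "convex hull {x, y, z} \<subseteq> {p. 0 \<le> orient y x p}"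
      using that(1) by (intro hull_minimal convex_orient; simp add: orient_swap[of y x])+
    then have "0 < orient x y q" "0 < orient y x q"
      using orient_interior_pos[OF assms] that(2) ne by metis+
    then show False using orient_swap[of x y q] by simp
  qed
  have "a = b" using no[OF 0] by simp
  moreover have "b = c" using no[of b c a] 0 orient_rotate[of b c a] by (simp add: insert_commute)
  ultimately show False using assms by simp
qed

text \<open>Stated for either orientation, since that of a triple of moved vertices is not known
  beforehand; the symmetry of \<open>G\<close> covers both.\<close>

lemma maxnc_triangle_interior:
  assumes "maxnc V G" "V \<subseteq> circ" "(a, b) \<in> G" "(b, c) \<in> G" "(c, a) \<in> G" "q \<in> interior (convex hull {a, b, c})"
  shows "q \<notin> chords G"
proof -
  have G: "ncr G" "G \<subseteq> circ \<times> circ" using assms(1,2) by (auto simp: maxnc_def)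
  consider "0 < orient a b c" | "0 < orient b a c"
    using interior_hull3_orient[OF assms(6)] orient_swap[of b a c] by linarith
  then show ?thesis
  proof cases
    case 1
    then show ?thesis using ncr_triangle_disjoint[OF G assms(3-5) 1] assms(6) interior_hull3[OF 1] by blast
  next
    case 2
    then have "interior (convex hull {a, b, c}) = tri b a c"
      using interior_hull3[OF 2] by (simp add: insert_commute)
    then show ?thesis
      using ncr_triangle_disjoint[OF G maxnc_sym[OF assms(1,3)] maxnc_sym[OF assms(1,5)] maxnc_sym[OF assms(1,4)] 2] assms(6) by blast
  qed
qed

text \<open>Finitely many triangles of \<open>Delta C\<close> contain all points of the hull far from \<open>C\<close>. Once their sides,
  slightly moved by \<open>\<rho>\<close>, are among the chords, no further chord can leave a neighbourhood of \<open>C\<close>.\<close>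

lemma (in chord_set) finite_approximation:
  assumes e: "0 < e"
  obtains F where "finite F" "F \<noteq> {}" "F \<subseteq> M"
    "\<And>V G \<rho>. finite V \<Longrightarrow> V \<subseteq> circ \<Longrightarrow> V \<subseteq> convex hull C \<Longrightarrow> maxnc V G \<Longrightarrow>
       (\<And>a b. (a, b) \<in> F \<Longrightarrow> (\<rho> a, \<rho> b) \<in> G \<and> dist (\<rho> a) a < e \<and> dist (\<rho> b) b < e) \<Longrightarrow>
       hausdorff_dist (chords G) C \<le> 3 * e"
proof -
  \<comment> \<open>The distance \<open>2 * e\<close> leaves room for the perturbation: the ball of
    this radius around a point of \<open>P\<close> stays in its triangle, so the point remains
    interior when the vertices move by less than \<open>e\<close>.\<close>
  define P where "P = convex hull C \<inter> {q. 2 * e \<le> infdist q C}"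
  have "closed {q. 2 * e \<le> infdist q C}" by (intro closed_Collect_le continuous_intros)
  then have "compact P" unfolding P_def by (intro compact_Int_closed compact_convex_hull compact_C)
  moreover have "P \<subseteq> \<Union>(Delta C)"
    unfolding P_def Delta_def Union_components using e by (auto simp: infdist_zero)
  moreover have "open t" if "t \<in> Delta C" for t using Delta_tri[OF that] open_tri by metis
  ultimately obtain \<D> where D: "\<D> \<subseteq> Delta C" "finite \<D>" "P \<subseteq> \<Union>\<D>" by (rule compactE)
  have "\<exists>a b c. t = tri a b c \<and> 0 < orient a b c \<and> (a, b) \<in> rigid C \<and> (b, c) \<in> rigid C \<and> (c, a) \<in> rigid C" if "t \<in> \<D>" for t
    using Delta_tri[of t] D(1) that by (metis subsetD)
  then obtain fa fb fc where f: "\<And>t. t \<in> \<D> \<Longrightarrow> t = tri (fa t) (fb t) (fc t)" "\<And>t. t \<in> \<D> \<Longrightarrow> 0 < orient (fa t) (fb t) (fc t)"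
    "\<And>t. t \<in> \<D> \<Longrightarrow> (fa t, fb t) \<in> rigid C \<and> (fb t, fc t) \<in> rigid C \<and> (fc t, fa t) \<in> rigid C" by metis
  define F1 where "F1 = (\<Union>t\<in>\<D>. {(fa t, fb t), (fb t, fc t), (fc t, fa t)})"
  have F1: "finite F1" "F1 \<subseteq> M" using D(2) f(3) rigid_M by (auto simp: F1_def)
  have "open {q. infdist q (closed_segment (fst g) (snd g)) < e}" for g :: "complex \<times> complex"
    by (intro open_Collect_less continuous_intros)
  moreover have "C \<subseteq> (\<Union>g\<in>M. {q. infdist q (closed_segment (fst g) (snd g)) < e})"
  proof
    fix q assume "q \<in> C"
    then obtain a b where "(a, b) \<in> M" "q \<in> closed_segment a b" unfolding chords_M[symmetric] chords_def by auto
    then show "q \<in> (\<Union>g\<in>M. {q. infdist q (closed_segment (fst g) (snd g)) < e})"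
      using e by (intro UN_I[of "(a, b)"]) auto
  qed
  ultimately obtain F0 where F0: "F0 \<subseteq> M" "finite F0" "C \<subseteq> (\<Union>g\<in>F0. {q. infdist q (closed_segment (fst g) (snd g)) < e})"
    by (rule compactE_image[OF compact_C])
  show thesis
  proof (rule that[of "F0 \<union> F1"])
    show "finite (F0 \<union> F1)" "F0 \<union> F1 \<noteq> {}" "F0 \<union> F1 \<subseteq> M" using F0 F1 nonempty_C by auto
    fix V G and \<rho> :: "complex \<Rightarrow> complex"
    assume V: "finite V" "V \<subseteq> circ" "V \<subseteq> convex hull C" and G: "maxnc V G"
      and \<rho>: "\<And>a b. (a, b) \<in> F0 \<union> F1 \<Longrightarrow> (\<rho> a, \<rho> b) \<in> G \<and> dist (\<rho> a) a < e \<and> dist (\<rho> b) b < e"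
    have dense: "infdist q (chords G) \<le> 3 * e" if q: "q \<in> C" for q
    proof -
      obtain a b where ab: "(a, b) \<in> F0" "infdist q (closed_segment a b) < e" using F0(3) q by force
      obtain z where z: "z \<in> closed_segment a b" "dist q z < e"
        using infdist_attains_inf[OF closed_segment, of a b q] ab(2) by (metis ends_in_segment(1) empty_iff)
      obtain s where s: "0 \<le> s" "s \<le> 1" "z = (1 - s) *\<^sub>R a + s *\<^sub>R b" using z(1) by (auto simp: in_segment)
      \<comment> \<open>The point with the same parameter on the moved chord; by convexity it is
        within \<open>e\<close> of \<open>z\<close>.\<close>
      define z' where "z' = (1 - s) *\<^sub>R \<rho> a + s *\<^sub>R \<rho> b"
      have r: "(\<rho> a, \<rho> b) \<in> G" "dist (\<rho> a) a < e" "dist (\<rho> b) b < e" using \<rho> ab(1) by auto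
      have "z' \<in> closed_segment (\<rho> a) (\<rho> b)" unfolding z'_def in_segment using s by blast
      then have "z' \<in> chords G" using r(1) by (auto simp: chords_def)
      moreover have "dist z z' \<le> (1 - s) * dist (\<rho> a) a + s * dist (\<rho> b) b"
      proof -
        have "z' - z = (1 - s) *\<^sub>R (\<rho> a - a) + s *\<^sub>R (\<rho> b - b)" by (simp add: z'_def s(3) algebra_simps)
        then have "norm (z' - z) \<le> norm ((1 - s) *\<^sub>R (\<rho> a - a)) + norm (s *\<^sub>R (\<rho> b - b))"
          by (simp only: norm_triangle_ineq)
        then show ?thesis using s by (simp add: dist_norm norm_minus_commute)
      qed
      moreover have "(1 - s) * dist (\<rho> a) a + s * dist (\<rho> b) b \<le> (1 - s) * e + s * e"
        using r s by (intro add_mono mult_left_mono) auto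
      moreover have "(1 - s) * e + s * e = e" by (simp add: algebra_simps)
      ultimately have "infdist q (chords G) \<le> dist q z'" "dist z z' \<le> e" by (auto intro: infdist_le)
      then show ?thesis using z(2) dist_triangle[of q z' z] e by simp
    qed
    have close: "infdist q C \<le> 3 * e" if q: "q \<in> chords G" for q
    proof (rule ccontr)
      assume n: "\<not> ?thesis"
      have "q \<in> convex hull C"
        using q maxnc_subset_hull(2)[OF G] hull_minimal[OF V(3), of convex] by auto
      then have "q \<in> P" using n e by (simp add: P_def)
      then obtain t where t: "t \<in> \<D>" "q \<in> t" using D(3) by blast
      define a b c where "a = fa t" and "b = fb t" and "c = fc t"
      have abc: "t = tri a b c" "0 < orient a b c" "(a, b) \<in> rigid C" "(b, c) \<in> rigid C" "(c, a) \<in> rigid C"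
        using f t(1) by (auto simp: a_def b_def c_def)
      have inF: "(a, b) \<in> F0 \<union> F1" "(b, c) \<in> F0 \<union> F1" "(c, a) \<in> F0 \<union> F1"
        using t(1) by (auto simp: F1_def a_def b_def c_def)
      have "ball q (2 * e) \<inter> C = {}"
      proof (rule ccontr)
        assume "\<not> ?thesis"
        then obtain x where "x \<in> C" "dist q x < 2 * e" by auto
        then have "infdist q C < 2 * e" using infdist_le[of x C q] by simp
        then show False using n e by simp
      qed
      then have "ball q (2 * e) \<inter> frontier t = {}"
        using rigidD(3)[OF abc(3)] rigidD(3)[OF abc(4)] rigidD(3)[OF abc(5)] unfolding abc(1) frontier_tri[OF abc(2)] by blast
      moreover have qb: "q \<in> ball q (2 * e)" using e by simp
      ultimately have "ball q (2 * e) \<subseteq> t"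
        using connected_Int_frontier[OF connected_ball, of q "2 * e" t] t(2) by blast
      then have "ball q (2 * e) \<subseteq> convex hull {a, b, c}" using tri_subset_hull[OF abc(2)] abc(1) by blast
      then have "q \<in> interior (convex hull {\<rho> a, \<rho> b, \<rho> c})"
        by (rule hull_perturbation[where m = e]) (use \<rho>[OF inF(1)] \<rho>[OF inF(2)] e in auto)
      then show False
        using maxnc_triangle_interior[OF G V(2)] \<rho>[OF inF(1)] \<rho>[OF inF(2)] \<rho>[OF inF(3)] q by blast
    qed
    have "F0 \<union> F1 \<noteq> {}" using F0 nonempty_C by auto
    then have "chords G \<noteq> {}" using \<rho> by (force simp: chords_def)
    then show "hausdorff_dist (chords G) C \<le> 3 * e"
      by (intro hausdorff_dist_le nonempty_C close dense)
  qed
qed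

lemma sub_triangulation_finite_limit:
  assumes "sub_triangulation C"
  shows "\<exists>Cs. (\<forall>n. finite_sub_triangulation (Cs n)) \<and> hausdorff_tendsto Cs C"
proof -
  obtain M where "chord_set C M" using sub_triangulation_chord_set[OF assms] .
  then interpret chord_set C M .
  have "\<exists>T. finite_sub_triangulation T \<and> hausdorff_dist T C \<le> 3 * inverse (real (Suc n))" for n
  proof -
    obtain F where F: "finite F" "F \<noteq> {}" "F \<subseteq> M"
      "\<And>V G \<rho>. finite V \<Longrightarrow> V \<subseteq> circ \<Longrightarrow> V \<subseteq> convex hull C \<Longrightarrow> maxnc V G \<Longrightarrow>
       (\<And>a b. (a, b) \<in> F \<Longrightarrow> (\<rho> a, \<rho> b) \<in> G \<and> dist (\<rho> a) a < inverse (real (Suc n)) \<and> dist (\<rho> b) b < inverse (real (Suc n))) \<Longrightarrow>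
       hausdorff_dist (chords G) C \<le> 3 * inverse (real (Suc n))"
      using finite_approximation[of "inverse (real (Suc n))"] by (metis inverse_positive_iff_positive of_nat_0_less_iff zero_less_Suc)
    \<comment> \<open>The endpoints of \<open>F\<close> serve as vertices without being moved, so
      \<open>\<rho>\<close> will be the identity.\<close>
    define V where "V = fst ` F \<union> snd ` F"
    have V: "finite V" "V \<noteq> {}" "F \<subseteq> V \<times> V" using F(1,2) by (auto simp: V_def image_iff) force+
    have "V \<subseteq> circ" using F(3) M_circ by (auto simp: V_def)
    moreover have "V \<subseteq> C" using F(3) M_segment by (force simp: V_def)
    then have "V \<subseteq> convex hull C" using hull_subset[of C convex] by blast
    moreover have "ncr F" using ncr_M F(3) unfolding ncr_def by blast
    then obtain G where G: "F \<subseteq> G" "maxnc V G" using maxnc_extend[OF V(1) \<open>V \<subseteq> circ\<close> V(3)] by blast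
    ultimately have "hausdorff_dist (chords G) C \<le> 3 * inverse (real (Suc n))"
      by (intro F(4)[of V G "\<lambda>a. a"]) (use V in auto)
    then show ?thesis using maxnc_finite_sub_triangulation[OF G(2) V(1) \<open>V \<subseteq> circ\<close> V(2)] by blast
  qed
  then obtain Cs where Cs: "\<And>n. finite_sub_triangulation (Cs n)" "\<And>n. hausdorff_dist (Cs n) C \<le> 3 * inverse (real (Suc n))" by metis
  have sub: "Cs n \<subseteq> disc" "Cs n \<noteq> {}" for n using Cs(1)[of n] by (auto simp: finite_sub_triangulation_def sub_triangulation_def)
  have "(\<lambda>n. 3 * inverse (real (Suc n))) \<longlonglongrightarrow> 3 * 0" by (intro tendsto_mult_left LIMSEQ_inverse_real_of_nat)
  then have l: "(\<lambda>n. 3 * inverse (real (Suc n))) \<longlonglongrightarrow> 0" by (simp only: mult_zero_right)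
  have "0 \<le> hausdorff_dist (Cs n) C" for n
    by (rule hausdorff_dist_nonneg[OF sub(1) C_subset_disc sub(2) nonempty_C])
  then have "hausdorff_tendsto Cs C" unfolding hausdorff_tendsto_def
    by (intro tendsto_sandwich[OF _ _ tendsto_const l] always_eventually allI Cs(2))
  then show ?thesis using Cs(1) by blast
qed

text \<open>The approximation with error \<open>e\<close> exists only for \<open>n\<close> large in
  terms of \<open>e\<close>. For each \<open>n\<close> a triangulation is taken whose distance to
  \<open>C\<close> is within 1 / (n + 1) of the infimum over all maximal families; it is eventually
  as good as needed for every \<open>e\<close>.\<close>

lemma circle_triangulation_regular_limit:
  assumes "circle_triangulation C"
  shows "\<exists>Cs. (\<forall>n. finite_sub_triangulation (Cs n)) \<and> hausdorff_tendsto Cs C \<and>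
     (\<forall>n\<ge>3. regular_ngon_triangulation n (Cs n))"
proof -
  have circ_C: "circ \<subseteq> C" and subC: "sub_triangulation C" using assms by (auto simp: circle_triangulation_def)
  obtain M where "chord_set C M" using sub_triangulation_chord_set[OF subC] .
  then interpret chord_set C M .
  define good where "good n = {chords G | G. maxnc (ngon_vertices n) G}" for n
  have V: "finite (ngon_vertices n)" "ngon_vertices n \<subseteq> circ" for n using ngon_vertex_circ by auto
  have Vne: "ngon_vertices n \<noteq> {}" if "0 < n" for n using that by auto
  have fin: "finite_sub_triangulation T" if "T \<in> good n" "0 < n" for T n
    using that maxnc_finite_sub_triangulation[OF _ V Vne] by (auto simp: good_def)
  have reg: "regular_ngon_triangulation n T" if "T \<in> good n" "3 \<le> n" for T n
    using that regular_ngon_triangulation_maxnc by (auto simp: good_def)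
  have ne: "good n \<noteq> {}" for n
    using maxnc_extend[OF V, of "{}" n] by (auto simp: good_def ncr_def)
  have nonneg: "0 \<le> hausdorff_dist T C" if "T \<in> good n" "0 < n" for T n
    using fin[OF that] hausdorff_dist_nonneg[of T C] C_subset_disc nonempty_C
    by (auto simp: finite_sub_triangulation_def sub_triangulation_def)
  have appr: "eventually (\<lambda>n. \<exists>T\<in>good n. hausdorff_dist T C \<le> 3 * e) sequentially" if e: "0 < e" for e
  proof -
    obtain F where F: "finite F" "F \<noteq> {}" "F \<subseteq> M"
      "\<And>V G \<rho>. finite V \<Longrightarrow> V \<subseteq> circ \<Longrightarrow> V \<subseteq> convex hull C \<Longrightarrow> maxnc V G \<Longrightarrow>
       (\<And>a b. (a, b) \<in> F \<Longrightarrow> (\<rho> a, \<rho> b) \<in> G \<and> dist (\<rho> a) a < e \<and> dist (\<rho> b) b < e) \<Longrightarrow>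
       hausdorff_dist (chords G) C \<le> 3 * e"
      using finite_approximation[OF e] by metis
    have Fc: "F \<subseteq> circ \<times> circ" and nF: "ncr F" using F(3) M_circ ncr_M unfolding ncr_def by blast+
    have "eventually (\<lambda>n. 0 < n \<and> 1 / real n < e) sequentially"
      using order_tendstoD(2)[OF lim_1_over_n e] eventually_gt_at_top[of 0] by eventually_elim auto
    then show ?thesis
    proof eventually_elim
      case (elim n)
      define F' where "F' = (\<lambda>(a, b). (round_vertex n a, round_vertex n b)) ` F"
      have F': "F' \<subseteq> ngon_vertices n \<times> ngon_vertices n"
        using round_vertex(1)[of n] elim Fc unfolding F'_def by fastforce
      have "ncr F'" unfolding F'_def using ncr_round_vertex[OF _ Fc nF] elim by simp
      then obtain G where G: "F' \<subseteq> G" "maxnc (ngon_vertices n) G" using maxnc_extend[OF V F'] by blast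
      have "hausdorff_dist (chords G) C \<le> 3 * e"
      proof (rule F(4)[OF V _ G(2), of "round_vertex n"])
        \<comment> \<open>Here the circle has to be part of \<open>C\<close>: rounded endpoints need
          not be endpoints of chords of \<open>F\<close>, but they stay in the hull.\<close>
        show "ngon_vertices n \<subseteq> convex hull C" using V(2) circ_C hull_subset[of C convex] by blast
        fix a b assume ab: "(a, b) \<in> F"
        then have "a \<in> circ" "b \<in> circ" using Fc by auto
        then have "dist (round_vertex n a) a < e" "dist (round_vertex n b) b < e"
          using round_vertex(2)[of n] elim by (meson order_le_less_trans)+
        moreover have "(round_vertex n a, round_vertex n b) \<in> F'" unfolding F'_def using ab by force
        ultimately show "(round_vertex n a, round_vertex n b) \<in> G \<and> dist (round_vertex n a) a < e \<and> dist (round_vertex n b) b < e"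
          using G(1) by blast
      qed
      then show ?case using G(2) by (auto simp: good_def)
    qed
  qed
  define I where "I n = Inf ((\<lambda>T. hausdorff_dist T C) ` good n)" for n
  \<comment> \<open>The polygon with index 0 has no vertices and would give the empty set, so index
    1 stands in for it.\<close>
  have "\<exists>T\<in>good (max n 1). hausdorff_dist T C < I (max n 1) + inverse (real (Suc n))" for n
    using cInf_lessD[of "(\<lambda>T. hausdorff_dist T C) ` good (max n 1)" "I (max n 1) + inverse (real (Suc n))"] ne[of "max n 1"]
    by (auto simp: I_def)
  then obtain Cs where Cs: "\<And>n. Cs n \<in> good (max n 1)" "\<And>n. hausdorff_dist (Cs n) C < I (max n 1) + inverse (real (Suc n))"
    by metis
  have "(\<lambda>n. hausdorff_dist (Cs n) C) \<longlonglongrightarrow> 0"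
  proof (rule tendstoI)
    fix e :: real assume e: "0 < e"
    have "eventually (\<lambda>n. inverse (real (Suc n)) < e / 2) sequentially"
      by (rule order_tendstoD(2)[OF LIMSEQ_inverse_real_of_nat]) (use e in simp)
    moreover have "eventually (\<lambda>n. \<exists>T\<in>good n. hausdorff_dist T C \<le> 3 * (e / 6)) sequentially"
      using appr[of "e / 6"] e by simp
    ultimately show "eventually (\<lambda>n. dist (hausdorff_dist (Cs n) C) 0 < e) sequentially"
      using eventually_ge_at_top[of 1]
    proof eventually_elim
      case (elim n)
      then obtain T where T: "T \<in> good n" "hausdorff_dist T C \<le> e / 2" by auto
      have mx: "max n 1 = n" using elim by simp
      have "I n \<le> hausdorff_dist T C" unfolding I_def
        by (rule cINF_lower[OF _ T(1)]) (use nonneg elim in \<open>auto intro!: bdd_belowI2[of _ 0]\<close>)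
      then have "hausdorff_dist (Cs n) C < e" using Cs(2)[of n] elim T(2) unfolding mx by simp
      moreover have "0 \<le> hausdorff_dist (Cs n) C" using nonneg[OF Cs(1)] by simp
      ultimately show ?case by simp
    qed
  qed
  then have "hausdorff_tendsto Cs C" by (simp add: hausdorff_tendsto_def)
  moreover have "finite_sub_triangulation (Cs n)" for n using fin[OF Cs(1)] by simp
  moreover have "regular_ngon_triangulation n (Cs n)" if "3 \<le> n" for n
    using reg[of "Cs n" n] Cs(1)[of n] that by (simp add: max_def)
  ultimately show ?thesis by blast
qed

section \<open>Limits of triangulated regular polygons contain the circle\<close>

lemma ngon_vertex_near:
  assumes "0 < n" "z \<in> circ"
  obtains k where "k < n" "dist (ngon_vertex t n k) z \<le> 1 / real n"
proof -
  define x where "x = (ang z - t) / (2 * pi)"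
  \<comment> \<open>The fraction of a full turn from vertex 0 to \<open>z\<close>. The polygon may
    be rotated by any \<open>t\<close>, so the angle has to be reduced modulo a full turn.\<close>
  define y where "y = frac x"
  have y: "0 \<le> y" "y < 1" by (simp_all add: y_def frac_lt_1)
  have "ang z = t + 2 * pi * y + 2 * pi * of_int \<lfloor>x\<rfloor>"
  proof -
    have "2 * pi * x = ang z - t" by (simp add: x_def)
    then show ?thesis by (simp add: y_def frac_def algebra_simps)
  qed
  then have "cis (ang z) = cis (t + 2 * pi * y) * cis (2 * pi * of_int \<lfloor>x\<rfloor>)" by (simp only: cis_mult)
  moreover have "cis (2 * pi * of_int \<lfloor>x\<rfloor>) = 1" by (rule cis_multiple_2pi) simp
  ultimately have z: "z = rcis (1 / (2 * pi)) (t + 2 * pi * y)"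
    using circ_ang(1)[OF assms(2)] by (simp add: rcis_def)
  define k where "k = nat \<lfloor>real n * y\<rfloor>"
  have ny: "0 \<le> real n * y" "real n * y < real n" using y assms(1) by auto
  then have k: "real k \<le> real n * y" "real n * y < real k + 1" "k < n" unfolding k_def by linarith+
  have "dist (ngon_vertex t n k) z \<le> 1 / (2 * pi) * \<bar>(t + 2 * pi * real k / real n) - (t + 2 * pi * y)\<bar>"
    unfolding z ngon_vertex_def dist_norm by (rule norm_rcis_diff_le) simp
  also have "\<dots> = \<bar>real k - real n * y\<bar> / real n"
  proof -
    have "(t + 2 * pi * real k / real n) - (t + 2 * pi * y) = 2 * pi / real n * (real k - real n * y)"
      using assms(1) by (simp add: field_simps)
    then show ?thesis using assms(1) by (simp add: abs_mult)
  qed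
  also have "\<dots> \<le> 1 / real n" using k by (intro divide_right_mono) auto
  finally show thesis using that k(3) by blast
qed

lemma (in converging) regular_limit_circle:
  assumes "\<And>n. 3 \<le> n \<Longrightarrow> regular_ngon_triangulation n (Cs n)"
  shows "circ \<subseteq> C"
proof
  fix z assume z: "z \<in> circ"
  \<comment> \<open>Indices are shifted by 3, where the polygons start. The rotation may vary with
    \<open>n\<close>, but every point of the circle is within 1 / (n + 3) of some vertex.\<close>
  have "\<exists>x\<in>Cs (n + 3). dist x z \<le> 1 / real (n + 3)" for n
  proof -
    obtain t L where t: "Cs (n + 3) = (\<Union>(a, b)\<in>ngon_sides t (n + 3) \<union> L. closed_segment a b)"
      using assms[of "n + 3"] unfolding regular_ngon_triangulation_def by auto
    obtain k where k: "k < n + 3" "dist (ngon_vertex t (n + 3) k) z \<le> 1 / real (n + 3)"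
      using ngon_vertex_near[of "n + 3" z] z by auto
    have "(ngon_vertex t (n + 3) k, ngon_vertex t (n + 3) (Suc k)) \<in> ngon_sides t (n + 3)"
      using k(1) by (auto simp: ngon_sides_def)
    then have "ngon_vertex t (n + 3) k \<in> Cs (n + 3)" unfolding t by force
    then show ?thesis using k(2) by blast
  qed
  then obtain x where x: "\<And>n. x n \<in> Cs (n + 3)" "\<And>n. dist (x n) z \<le> 1 / real (n + 3)" by metis
  have "(\<lambda>n. 1 / real (n + 3)) \<longlonglongrightarrow> 0" by (rule LIMSEQ_ignore_initial_segment[OF lim_1_over_n])
  then have "x \<longlonglongrightarrow> z"
    unfolding tendsto_dist_iff[of x] using x(2)
    by (intro tendsto_sandwich[of "\<lambda>_. 0" "\<lambda>n. dist (x n) z" _ "\<lambda>n. 1 / real (n + 3)"]) auto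
  then show "z \<in> C" by (rule limit_in_C[of "\<lambda>n. n + 3", rotated 2]) (use x(1) in \<open>auto simp: strict_mono_def\<close>)
qed

lemma convergingI:
  assumes "closed C" "C \<noteq> {}" "C \<subseteq> disc" "\<And>n. finite_sub_triangulation (Cs n)" "hausdorff_tendsto Cs C"
  shows "converging Cs C"
  using assms by unfold_locales (auto simp: finite_sub_triangulation_def)

theorem proposition4p3:
  fixes C :: "complex set"
  assumes "closed C" and "C \<noteq> {}" and "C \<subseteq> disc"
  shows "(sub_triangulation C \<longleftrightarrow>
            Tri1 C \<and> {p. p extreme_point_of (convex hull C)} \<subseteq> circ \<and>
            (\<forall>x \<in> Delta C \<union> Nabla C. \<forall>y \<in> Delta C \<union> Nabla C. \<forall>z \<in> Delta C \<union> Nabla C.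
               x \<noteq> y \<and> y \<noteq> z \<and> x \<noteq> z \<longrightarrow>
               (\<exists>!c. c \<in> Delta C \<and>
                  (\<exists>X \<in> components (disc - frontier c).
                   \<exists>Y \<in> components (disc - frontier c).
                   \<exists>Z \<in> components (disc - frontier c).
                     X \<noteq> Y \<and> Y \<noteq> Z \<and> X \<noteq> Z \<and> x \<subseteq> X \<and> y \<subseteq> Y \<and> z \<subseteq> Z))))
       \<and> (sub_triangulation C \<longleftrightarrow>
            (\<exists>Cs :: nat \<Rightarrow> complex set.
               (\<forall>n. finite_sub_triangulation (Cs n)) \<and> hausdorff_tendsto Cs C))
       \<and> (circle_triangulation C \<longleftrightarrow>
            (\<exists>Cs :: nat \<Rightarrow> complex set.
               (\<forall>n. finite_sub_triangulation (Cs n)) \<and> hausdorff_tendsto Cs C \<and>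
               (\<forall>n \<ge> 3. regular_ngon_triangulation n (Cs n))))"
proof -
  have 1: "sub_triangulation C \<longleftrightarrow> Tri1 C \<and> {p. p extreme_point_of (convex hull C)} \<subseteq> circ \<and>
      (\<forall>x \<in> faces C. \<forall>y \<in> faces C. \<forall>z \<in> faces C.
         x \<noteq> y \<and> y \<noteq> z \<and> x \<noteq> z \<longrightarrow> (\<exists>!c. c \<in> Delta C \<and> separates3 c x y z))"
    (is "_ \<longleftrightarrow> ?R")
  proof
    assume C: "sub_triangulation C"
    then have "Tri1 C" by (simp add: sub_triangulation_def)
    then show ?R using sub_triangulation_extreme[OF C] sub_triangulation_separating[OF C] by simp
  next
    assume R: ?R
    have "tri1_set C" by (rule tri1_setI_extreme[OF assms R[THEN conjunct1] R[THEN conjunct2, THEN conjunct1]])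
    moreover have "\<exists>c\<in>Delta C. separates3 c x y z"
      if "x \<in> faces C" "y \<in> faces C" "z \<in> faces C" "x \<noteq> y" "y \<noteq> z" "x \<noteq> z" for x y z
    proof -
      have "\<exists>!c. c \<in> Delta C \<and> separates3 c x y z"
        using that by (intro R[THEN conjunct2, THEN conjunct2, rule_format] conjI)
      then show ?thesis by blast
    qed
    ultimately interpret separated_faces C by (intro separated_faces.intro separated_faces_axioms.intro)
    show "sub_triangulation C" by (rule sub_triangulation_C)
  qed
  have 2: "sub_triangulation C \<longleftrightarrow>
      (\<exists>Cs. (\<forall>n. finite_sub_triangulation (Cs n)) \<and> hausdorff_tendsto Cs C)"
    using sub_triangulation_finite_limit converging.limit_sub_triangulation[OF convergingI[OF assms]]
    by blast
  have 3: "circle_triangulation C \<longleftrightarrow>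
      (\<exists>Cs. (\<forall>n. finite_sub_triangulation (Cs n)) \<and> hausdorff_tendsto Cs C \<and>
         (\<forall>n \<ge> 3. regular_ngon_triangulation n (Cs n)))"
  proof
    assume "circle_triangulation C"
    then show "\<exists>Cs. (\<forall>n. finite_sub_triangulation (Cs n)) \<and> hausdorff_tendsto Cs C \<and>
         (\<forall>n \<ge> 3. regular_ngon_triangulation n (Cs n))"
      by (rule circle_triangulation_regular_limit)
  next
    assume "\<exists>Cs. (\<forall>n. finite_sub_triangulation (Cs n)) \<and> hausdorff_tendsto Cs C \<and>
         (\<forall>n \<ge> 3. regular_ngon_triangulation n (Cs n))"
    then obtain Cs where Cs: "\<And>n. finite_sub_triangulation (Cs n)" "hausdorff_tendsto Cs C"
      "\<And>n. 3 \<le> n \<Longrightarrow> regular_ngon_triangulation n (Cs n)" by blast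
    interpret converging Cs C by (rule convergingI[OF assms Cs(1,2)])
    show "circle_triangulation C"
      unfolding circle_triangulation_def using limit_sub_triangulation regular_limit_circle Cs(3) by blast
  qed
  show ?thesis using 1 2 3 unfolding separates3_def by (intro conjI)
qed

end
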